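(* Let $p$ be a prime and let $\mathcal{F}=\{F_1,\dots,F_n\}$ with $F_i(x)=(-1)^{b_i}p^{k_i}x+d_i$, where $b_i\in\{0,1\}$, $k_i\in\mathbb{Z}$, $k_i\ge1$ and $d_i\in\mathbb{Z}_p\cap\mathbb{Q}$, and let $K$ be its $p$-adic self-similar set. Consider the NDFA associated to $\mathcal{F}$, and suppose there is a state $q$ belonging to an essential class $EC$ of it such that there are two paths starting and ending at $q$ whose lengths are coprime. Let $E\subseteq\{0,\dots,p-1\}$ be the set of digits that occur in words accepted by the NDFA started at states of $EC$. Then for every $j\ge0$ and all sufficiently large $k$, the Hausdorff dimension of $\psi_{j,k}(K)$ equals $\log(\#E)/\log(p)$.
   Context: $K$ is the unique non-empty compact subset of $\mathbb{Q}_p$ with $K=\bigcup_iF_i(K)$; $K\subseteq\mathbb{Z}_p$. For $m\ge1$ and $x\in\mathbb{Z}_p$ let $D_m(x)\in\{0,\dots,p^m-1\}$ be the integer with $x\equiv D_m(x)\pmod{p^m}$. The transducer of $\mathcal{F}$ has states $(c,\varepsilon)$ with $c\in\mathbb{Z}_p\cap\mathbb{Q}$, $\varepsilon\in\{+1,-1\}$, initial state $(0,+1)$; from $(c,\varepsilon)$ and for each $i$ there is a transition reading $i$, outputting the $k_i$ $p$-adic digits of $D_{k_i}(c+\varepsilon d_i)$ (least significant first) and going to $\big(p^{-k_i}(c+\varepsilon d_i-D_{k_i}(c+\varepsilon d_i)),\ \varepsilon(-1)^{b_i}\big)$; only states reachable from the initial state are kept (finitely many). The NDFA associated to $\mathcal{F}$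 is obtained by forgetting the inputs and replacing each transition outputting $k$ digits by a path of $k$ edges, each labelled by one digit, through $k-1$ new intermediate states; all states are accepting, and it recognizes the $p$-adic expansions of elements of $K$. Lengths of paths are numbers of edges of this NDFA, i.e. numbers of output digits. An essential class is a maximal set of states any two of which are joined by paths inside it, such that every path starting in it stays in it. For $x=\sum_{i\ge0}a_ip^i\in\mathbb{Z}_p$ and integers $j\ge0$, $k\ge1$, the decimation is $\psi_{j,k}(x)=\sum_{m\ge0}a_{j+mk}p^m$, and $\psi_{j,k}(K)=\{\psi_{j,k}(x):x\in K\}$. Hausdorff dimension is with respect to $|x-y|_p$. *)

theory Defs
  imports "HOL-Analysis.Analysis" "HOL-Computational_Algebra.Squarefree"
begin

section \<open>The field of $p$-adic numbers\<close>

text \<open>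
  The prime $p$ is the cardinality of the type parameter \<open>'p\<close>; the type \<open>'p padic\<close> is the
  completion of the rationals with respect to the $p$-adic absolute value.
\<close>

class prime_card =
  assumes prime_card: "prime CARD('a)"

definition rat_padic_abs :: "nat \<Rightarrow> rat \<Rightarrow> real" where
  "rat_padic_abs p x =
     (if x = 0 then 0
      else real p powi (int (multiplicity (int p) (snd (quotient_of x)))
                      - int (multiplicity (int p) (fst (quotient_of x)))))"

lemma rat_padic_abs_0 [simp]: "rat_padic_abs p 0 = 0"
  by (simp add: rat_padic_abs_def)

lemma rat_padic_abs_frac:
  assumes "prime p" "a \<noteq> 0" "b \<noteq> 0"
  shows "rat_padic_abs p (of_int a / of_int b) =
           real p powi (int (multiplicity (int p) b) - int (multiplicity (int p) a))"
proof -
  define x :: rat where "x = of_int a / of_int b"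
  obtain c d where cd: "quotient_of x = (c, d)"
    by fastforce
  have d: "d > 0" and x: "x = of_int c / of_int d"
    using cd quotient_of_denom_pos quotient_of_div by blast+
  have "x \<noteq> 0"
    using assms by (simp add: x_def)
  then have c: "c \<noteq> 0"
    using x by auto
  have "(of_int (a * d) :: rat) = of_int (c * b)"
    using x assms d unfolding x_def by (simp add: field_simps)
  then have eq: "a * d = c * b"
    by (simp only: of_int_eq_iff)
  have pr: "prime_elem (int p)"
    using assms(1) by auto
  have "multiplicity (int p) a + multiplicity (int p) d = multiplicity (int p) c + multiplicity (int p) b"
    using prime_elem_multiplicity_mult_distrib[OF pr, of a d]
      prime_elem_multiplicity_mult_distrib[OF pr, of c b] eq assms c d by simp
  then have "int (multiplicity (int p) d) - int (multiplicity (int p) c) =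
     int (multiplicity (int p) b) - int (multiplicity (int p) a)"
    by linarith
  then show ?thesis
    using \<open>x \<noteq> 0\<close> cd by (simp add: rat_padic_abs_def flip: x_def)
qed

lemma rat_frac_cases:
  obtains a b where "b \<noteq> (0::int)" "x = (of_int a / of_int b :: rat)"
  by (metis Fract_of_int_quotient Rat_cases less_irrefl)

lemma rat_padic_abs_nonneg [simp]: "rat_padic_abs p x \<ge> 0"
  by (simp add: rat_padic_abs_def)

lemma rat_padic_abs_eq_0 [simp]: "prime p \<Longrightarrow> rat_padic_abs p x = 0 \<longleftrightarrow> x = 0"
  by (auto simp: rat_padic_abs_def)

lemma rat_padic_abs_1 [simp]: "prime p \<Longrightarrow> rat_padic_abs p 1 = 1"
  using rat_padic_abs_frac[of p 1 1] by simp

lemma rat_padic_abs_minus [simp]: "rat_padic_abs p (- x) = rat_padic_abs p x"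
  by (cases "quotient_of x") (auto simp: rat_padic_abs_def rat_uminus_code)

lemma rat_padic_abs_minus_commute: "rat_padic_abs p (x - y) = rat_padic_abs p (y - x)"
  by (metis minus_diff_eq rat_padic_abs_minus)

lemma rat_padic_abs_mult:
  assumes "prime p"
  shows "rat_padic_abs p (x * y) = rat_padic_abs p x * rat_padic_abs p y"
proof (cases "x = 0 \<or> y = 0")
  case False
  obtain a b where b: "b \<noteq> 0" and x: "x = of_int a / of_int b"
    by (rule rat_frac_cases)
  obtain c d where d: "d \<noteq> 0" and y: "y = of_int c / of_int d"
    by (rule rat_frac_cases)
  have ac: "a \<noteq> 0" "c \<noteq> 0"
    using False x y by auto
  have pr: "prime_elem (int p)" and p0: "real p \<noteq> 0"
    using assms by (auto simp: prime_gt_0_nat)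
  have "x * y = of_int (a * c) / of_int (b * d)"
    by (simp add: x y)
  then have "rat_padic_abs p (x * y) = real p powi (int (multiplicity (int p) (b * d)) - int (multiplicity (int p) (a * c)))"
    using rat_padic_abs_frac[OF assms, of "a * c" "b * d"] ac b d by simp
  also have "\<dots> = real p powi ((int (multiplicity (int p) b) - int (multiplicity (int p) a))
      + (int (multiplicity (int p) d) - int (multiplicity (int p) c)))"
    using prime_elem_multiplicity_mult_distrib[OF pr, of a c]
      prime_elem_multiplicity_mult_distrib[OF pr, of b d] ac b d by (simp add: algebra_simps)
  also have "\<dots> = rat_padic_abs p x * rat_padic_abs p y"
    using rat_padic_abs_frac[OF assms, of a b] rat_padic_abs_frac[OF assms, of c d] ac b d p0
    by (simp add: x y power_int_add)
  finally show ?thesis .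
qed auto

lemma rat_padic_abs_inverse:
  assumes "prime p"
  shows "rat_padic_abs p (inverse x) = inverse (rat_padic_abs p x)"
proof (cases "x = 0")
  case False
  then have "rat_padic_abs p x * rat_padic_abs p (inverse x) = 1"
    using rat_padic_abs_mult[OF assms, of x "inverse x"] assms by simp
  then show ?thesis
    by (metis inverse_unique)
qed auto

lemma rat_padic_abs_ultrametric:
  assumes "prime p"
  shows "rat_padic_abs p (x + y) \<le> max (rat_padic_abs p x) (rat_padic_abs p y)"
proof (cases "x = 0 \<or> y = 0 \<or> x + y = 0")
  case True
  then show ?thesis
    by (auto simp: le_max_iff_disj)
next
  case False
  obtain a b where b: "b \<noteq> 0" and x: "x = of_int a / of_int b"
    by (rule rat_frac_cases)
  obtain c d where d: "d \<noteq> 0" and y: "y = of_int c / of_int d"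
    by (rule rat_frac_cases)
  have ac: "a \<noteq> 0" "c \<noteq> 0"
    using False x y by auto
  define u v w where "u = a * d" and "v = c * b" and "w = b * d"
  have x': "x = of_int u / of_int w" and y': "y = of_int v / of_int w"
    using b d by (simp_all add: x y u_def v_def w_def)
  have xy: "x + y = of_int (u + v) / of_int w"
    by (simp add: x' y' add_divide_distrib)
  have nz: "u \<noteq> 0" "v \<noteq> 0" "w \<noteq> 0"
    using ac b d by (simp_all add: u_def v_def w_def)
  have nz': "u + v \<noteq> 0"
    using False xy by (metis divide_eq_0_iff of_int_0)
  define m where "m = min (multiplicity (int p) u) (multiplicity (int p) v)"
  have "int p ^ m dvd u" "int p ^ m dvd v"
    unfolding m_def by (auto intro!: multiplicity_dvd')
  then have "int p ^ m dvd u + v"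
    by simp
  moreover have "\<not> is_unit (int p)"
    using assms by (auto simp: prime_nat_iff)
  ultimately have "m \<le> multiplicity (int p) (u + v)"
    using nz' by (intro multiplicity_geI)
  then have le: "real p powi (int (multiplicity (int p) w) - int (multiplicity (int p) (u + v)))
      \<le> real p powi (int (multiplicity (int p) w) - int m)"
    using prime_ge_1_nat[OF assms] by (intro power_int_increasing) auto
  have "m = multiplicity (int p) u \<or> m = multiplicity (int p) v"
    by (auto simp: m_def)
  then have "real p powi (int (multiplicity (int p) w) - int m) \<le> max (rat_padic_abs p x) (rat_padic_abs p y)"
    using rat_padic_abs_frac[OF assms nz(1,3)] rat_padic_abs_frac[OF assms nz(2,3)]
    by (auto simp: x' y')
  then show ?thesis
    using le rat_padic_abs_frac[OF assms nz'(1) nz(3)] by (simp add: xy)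
qed

lemma rat_padic_abs_triangle:
  assumes "prime p"
  shows "rat_padic_abs p (x + y) \<le> rat_padic_abs p x + rat_padic_abs p y"
  using rat_padic_abs_ultrametric[OF assms, of x y] rat_padic_abs_nonneg[of p x]
    rat_padic_abs_nonneg[of p y] by linarith

lemma rat_padic_abs_diff_le:
  assumes "prime p"
  shows "\<bar>rat_padic_abs p x - rat_padic_abs p y\<bar> \<le> rat_padic_abs p (x - y)"
  using rat_padic_abs_triangle[OF assms, of "x - y" y] rat_padic_abs_triangle[OF assms, of "y - x" x]
  by (simp add: rat_padic_abs_minus_commute[of p y x] abs_le_iff)

definition padic_vanishes :: "nat \<Rightarrow> (nat \<Rightarrow> rat) \<Rightarrow> bool" where
  "padic_vanishes p X \<longleftrightarrow> (\<lambda>n. rat_padic_abs p (X n)) \<longlonglongrightarrow> 0"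

definition padic_cauchy :: "nat \<Rightarrow> (nat \<Rightarrow> rat) \<Rightarrow> bool" where
  "padic_cauchy p X \<longleftrightarrow> (\<forall>r>0. \<exists>N. \<forall>m\<ge>N. \<forall>n\<ge>N. rat_padic_abs p (X m - X n) < r)"

lemma padic_vanishes_bound:
  assumes "\<And>n. rat_padic_abs p (X n) \<le> f n" "f \<longlonglongrightarrow> 0"
  shows "padic_vanishes p X"
  unfolding padic_vanishes_def
  by (rule tendsto_sandwich[OF _ _ tendsto_const assms(2)]) (auto simp: assms(1))

lemma padic_vanishes_const [simp]: "prime p \<Longrightarrow> padic_vanishes p (\<lambda>n. c) \<longleftrightarrow> c = 0"
  by (simp add: padic_vanishes_def LIMSEQ_const_iff)

lemma padic_vanishes_minus: "padic_vanishes p (\<lambda>n. - X n) \<longleftrightarrow> padic_vanishes p X"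
  by (simp add: padic_vanishes_def)

lemma padic_vanishes_add:
  assumes "prime p" "padic_vanishes p X" "padic_vanishes p Y"
  shows "padic_vanishes p (\<lambda>n. X n + Y n)"
  using rat_padic_abs_triangle[OF assms(1)]
  by (rule padic_vanishes_bound) (use assms in \<open>auto simp: padic_vanishes_def intro: tendsto_add_zero\<close>)

lemma padic_vanishes_diff:
  assumes "prime p" "padic_vanishes p X" "padic_vanishes p Y"
  shows "padic_vanishes p (\<lambda>n. X n - Y n)"
  using padic_vanishes_add[OF assms(1,2), of "\<lambda>n. - Y n"] assms(3) by (simp add: padic_vanishes_minus)

lemma padic_vanishes_eventually:
  assumes "padic_vanishes p X" "eventually (\<lambda>n. X n = Y n) sequentially"
  shows "padic_vanishes p Y"
  using assms unfolding padic_vanishes_def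
  by (elim Lim_transform_eventually) (auto elim: eventually_mono)

lemma padic_cauchy_const [simp]: "padic_cauchy p (\<lambda>n. c)"
  by (auto simp: padic_cauchy_def)

lemma padic_cauchy_convergent:
  assumes "prime p" "padic_cauchy p X"
  shows "convergent (\<lambda>n. rat_padic_abs p (X n))"
proof -
  have "Cauchy (\<lambda>n. rat_padic_abs p (X n))"
  proof (rule metric_CauchyI)
    fix e :: real
    assume "e > 0"
    then obtain N where N: "\<And>m n. m \<ge> N \<Longrightarrow> n \<ge> N \<Longrightarrow> rat_padic_abs p (X m - X n) < e"
      using assms unfolding padic_cauchy_def by meson
    have "dist (rat_padic_abs p (X m)) (rat_padic_abs p (X n)) < e" if "m \<ge> N" "n \<ge> N" for m n
      using rat_padic_abs_diff_le[OF assms(1), of "X m" "X n"] N[OF that] by (simp add: dist_real_def)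
    then show "\<exists>M. \<forall>m\<ge>M. \<forall>n\<ge>M. dist (rat_padic_abs p (X m)) (rat_padic_abs p (X n)) < e"
      by blast
  qed
  then show ?thesis
    by (rule Cauchy_convergent)
qed

lemma padic_cauchy_bounded:
  assumes "prime p" "padic_cauchy p X"
  obtains B where "B > 0" "\<And>n. rat_padic_abs p (X n) \<le> B"
proof -
  have "Bseq (\<lambda>n. rat_padic_abs p (X n))"
    using padic_cauchy_convergent[OF assms] by (rule convergent_imp_Bseq)
  then show ?thesis
    using that by (auto elim!: BseqE)
qed

lemma padic_cauchy_not_vanishes:
  assumes "prime p" "padic_cauchy p X" "\<not> padic_vanishes p X"
  obtains b where "b > 0" "eventually (\<lambda>n. rat_padic_abs p (X n) > b) sequentially"
proof -
  obtain L where L: "(\<lambda>n. rat_padic_abs p (X n)) \<longlonglongrightarrow> L"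
    using padic_cauchy_convergent[OF assms(1,2)] by (auto simp: convergent_def)
  have "L \<ge> 0"
    by (rule LIMSEQ_le_const[OF L]) auto
  moreover have "L \<noteq> 0"
    using L assms(3) by (auto simp: padic_vanishes_def)
  ultimately show ?thesis
    using that[of "L / 2"] order_tendstoD(1)[OF L, of "L / 2"] by auto
qed

lemma padic_cauchy_add:
  assumes "prime p" "padic_cauchy p X" "padic_cauchy p Y"
  shows "padic_cauchy p (\<lambda>n. X n + Y n)"
  unfolding padic_cauchy_def
proof (intro allI impI)
  fix r :: real
  assume r: "r > 0"
  obtain M where M: "\<And>m n. m \<ge> M \<Longrightarrow> n \<ge> M \<Longrightarrow> rat_padic_abs p (X m - X n) < r"
    using assms(2) r unfolding padic_cauchy_def by meson
  obtain N where N: "\<And>m n. m \<ge> N \<Longrightarrow> n \<ge> N \<Longrightarrow> rat_padic_abs p (Y m - Y n) < r"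
    using assms(3) r unfolding padic_cauchy_def by meson
  have "rat_padic_abs p (X m + Y m - (X n + Y n)) < r" if "m \<ge> max M N" "n \<ge> max M N" for m n
    using rat_padic_abs_ultrametric[OF assms(1), of "X m - X n" "Y m - Y n"] M[of m n] N[of m n] that
    by (auto simp: algebra_simps)
  then show "\<exists>N. \<forall>m\<ge>N. \<forall>n\<ge>N. rat_padic_abs p (X m + Y m - (X n + Y n)) < r"
    by blast
qed

lemma padic_cauchy_minus: "padic_cauchy p X \<Longrightarrow> padic_cauchy p (\<lambda>n. - X n)"
  unfolding padic_cauchy_def by (simp add: rat_padic_abs_minus_commute)

lemma padic_cauchy_mult:
  assumes p: "prime p" and "padic_cauchy p X" "padic_cauchy p Y"
  shows "padic_cauchy p (\<lambda>n. X n * Y n)"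
  unfolding padic_cauchy_def
proof (intro allI impI)
  fix r :: real
  assume r: "r > 0"
  obtain A where A: "A > 0" "\<And>n. rat_padic_abs p (X n) \<le> A"
    using padic_cauchy_bounded[OF assms(1,2)] by blast
  obtain B where B: "B > 0" "\<And>n. rat_padic_abs p (Y n) \<le> B"
    using padic_cauchy_bounded[OF assms(1,3)] by blast
  obtain M where M: "\<And>m n. m \<ge> M \<Longrightarrow> n \<ge> M \<Longrightarrow> rat_padic_abs p (X m - X n) < r / B"
    using assms(2) r B unfolding padic_cauchy_def by (meson divide_pos_pos)
  obtain N where N: "\<And>m n. m \<ge> N \<Longrightarrow> n \<ge> N \<Longrightarrow> rat_padic_abs p (Y m - Y n) < r / A"
    using assms(3) r A unfolding padic_cauchy_def by (meson divide_pos_pos)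
  have "rat_padic_abs p (X m * Y m - X n * Y n) < r" if "m \<ge> max M N" "n \<ge> max M N" for m n
  proof -
    have "rat_padic_abs p (X m * (Y m - Y n)) \<le> A * rat_padic_abs p (Y m - Y n)"
      by (simp add: rat_padic_abs_mult[OF p] mult_right_mono A)
    also have "\<dots> < A * (r / A)"
      using A N that by (intro mult_strict_left_mono) auto
    finally have 1: "rat_padic_abs p (X m * (Y m - Y n)) < r"
      using A by simp
    have "rat_padic_abs p ((X m - X n) * Y n) \<le> rat_padic_abs p (X m - X n) * B"
      by (simp add: rat_padic_abs_mult[OF p] mult_left_mono B)
    also have "\<dots> < r / B * B"
      using B M that by (intro mult_strict_right_mono) auto
    finally have 2: "rat_padic_abs p ((X m - X n) * Y n) < r"
      using B by simp
    have "X m * Y m - X n * Y n = X m * (Y m - Y n) + (X m - X n) * Y n"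
      by (simp add: algebra_simps)
    then show ?thesis
      using rat_padic_abs_ultrametric[OF p, of "X m * (Y m - Y n)" "(X m - X n) * Y n"] 1 2 by auto
  qed
  then show "\<exists>N. \<forall>m\<ge>N. \<forall>n\<ge>N. rat_padic_abs p (X m * Y m - X n * Y n) < r"
    by blast
qed

lemma padic_vanishes_mult:
  assumes "prime p" "padic_cauchy p X" "padic_vanishes p Y"
  shows "padic_vanishes p (\<lambda>n. X n * Y n)"
proof -
  obtain B where B: "B > 0" "\<And>n. rat_padic_abs p (X n) \<le> B"
    using padic_cauchy_bounded[OF assms(1,2)] by blast
  have "(\<lambda>n. B * rat_padic_abs p (Y n)) \<longlonglongrightarrow> 0"
    using assms(3) unfolding padic_vanishes_def by (rule tendsto_mult_right_zero)
  then show ?thesis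
    by (rule padic_vanishes_bound[rotated]) (simp add: rat_padic_abs_mult[OF assms(1)] mult_right_mono B)
qed

lemma rat_padic_abs_diff_inverse:
  assumes p: "prime p" and b: "b > 0" "rat_padic_abs p x > b" "rat_padic_abs p y > b"
  shows "rat_padic_abs p (inverse x - inverse y) \<le> rat_padic_abs p (x - y) / b\<^sup>2"
proof -
  have nz: "x \<noteq> 0" "y \<noteq> 0"
    using b by auto
  then have "inverse x - inverse y = - (inverse x * (x - y) * inverse y)"
    by (simp add: field_simps)
  then have "rat_padic_abs p (inverse x - inverse y) =
      rat_padic_abs p (x - y) / (rat_padic_abs p x * rat_padic_abs p y)"
    by (simp only: rat_padic_abs_mult[OF p] rat_padic_abs_inverse[OF p] rat_padic_abs_minus) (simp add: divide_simps)
  also have "\<dots> \<le> rat_padic_abs p (x - y) / b\<^sup>2"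
    unfolding power2_eq_square using b by (intro divide_left_mono mult_mono) auto
  finally show ?thesis .
qed

lemma padic_cauchy_inverse:
  assumes p: "prime p" and X: "padic_cauchy p X" "\<not> padic_vanishes p X"
  shows "padic_cauchy p (\<lambda>n. inverse (X n))"
  unfolding padic_cauchy_def
proof (intro allI impI)
  fix r :: real
  assume r: "r > 0"
  obtain b M where b: "b > 0" and M: "\<And>n. n \<ge> M \<Longrightarrow> rat_padic_abs p (X n) > b"
    using padic_cauchy_not_vanishes[OF assms] unfolding eventually_sequentially by metis
  obtain N where N: "\<And>m n. m \<ge> N \<Longrightarrow> n \<ge> N \<Longrightarrow> rat_padic_abs p (X m - X n) < r * b\<^sup>2"
    using X(1) r b unfolding padic_cauchy_def by (meson mult_pos_pos zero_less_power)
  have "rat_padic_abs p (inverse (X m) - inverse (X n)) < r" if "m \<ge> max M N" "n \<ge> max M N" for m n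
    using rat_padic_abs_diff_inverse[OF p b M M, of m n] N[of m n] that b
    by (smt (verit) max.bounded_iff pos_divide_less_eq zero_less_power)
  then show "\<exists>N. \<forall>m\<ge>N. \<forall>n\<ge>N. rat_padic_abs p (inverse (X m) - inverse (X n)) < r"
    by blast
qed

lemma padic_vanishes_diff_inverse:
  assumes p: "prime p" and X: "padic_cauchy p X" "\<not> padic_vanishes p X"
    and Y: "padic_cauchy p Y" "\<not> padic_vanishes p Y"
    and XY: "padic_vanishes p (\<lambda>n. X n - Y n)"
  shows "padic_vanishes p (\<lambda>n. inverse (X n) - inverse (Y n))"
proof -
  obtain a where a: "a > 0" "eventually (\<lambda>n. rat_padic_abs p (X n) > a) sequentially"
    using padic_cauchy_not_vanishes[OF p X] by blast
  obtain b where b: "b > 0" "eventually (\<lambda>n. rat_padic_abs p (Y n) > b) sequentially"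
    using padic_cauchy_not_vanishes[OF p Y] by blast
  have ev: "eventually (\<lambda>n. rat_padic_abs p (inverse (X n) - inverse (Y n))
      \<le> rat_padic_abs p (X n - Y n) / (min a b)\<^sup>2) sequentially"
    using a(2) b(2)
    by eventually_elim (use a(1) b(1) in \<open>auto intro!: rat_padic_abs_diff_inverse[OF p]\<close>)
  have "(\<lambda>n. rat_padic_abs p (X n - Y n) / (min a b)\<^sup>2) \<longlonglongrightarrow> 0"
    using XY unfolding padic_vanishes_def by (rule tendsto_divide_zero)
  then show ?thesis
    unfolding padic_vanishes_def
    by (intro tendsto_sandwich[OF _ ev tendsto_const]) auto
qed

text \<open>The Cauchy sequences form a ring, in which the null sequences are a maximal ideal.\<close>

typedef ('a::prime_card) padic_seq = "{X. padic_cauchy CARD('a) X}"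
  by (rule exI[of _ "\<lambda>n. 0"]) simp

setup_lifting type_definition_padic_seq

declare prime_card [simp]

instantiation padic_seq :: (prime_card) comm_ring_1
begin

lift_definition zero_padic_seq :: "'a padic_seq" is "\<lambda>n. 0"
  by simp

lift_definition one_padic_seq :: "'a padic_seq" is "\<lambda>n. 1"
  by simp

lift_definition plus_padic_seq :: "'a padic_seq \<Rightarrow> 'a padic_seq \<Rightarrow> 'a padic_seq"
  is "\<lambda>X Y n. X n + Y n"
  by (simp add: padic_cauchy_add)

lift_definition uminus_padic_seq :: "'a padic_seq \<Rightarrow> 'a padic_seq" is "\<lambda>X n. - X n"
  by (simp add: padic_cauchy_minus)

lift_definition minus_padic_seq :: "'a padic_seq \<Rightarrow> 'a padic_seq \<Rightarrow> 'a padic_seq"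
  is "\<lambda>X Y n. X n - Y n"
  using padic_cauchy_add[OF prime_card _ padic_cauchy_minus] by simp

lift_definition times_padic_seq :: "'a padic_seq \<Rightarrow> 'a padic_seq \<Rightarrow> 'a padic_seq"
  is "\<lambda>X Y n. X n * Y n"
  by (simp add: padic_cauchy_mult)

instance
  by standard (transfer; simp add: algebra_simps fun_eq_iff)+

end

lift_definition padic_null :: "'a::prime_card padic_seq \<Rightarrow> bool" is "padic_vanishes CARD('a)" .

lemma padic_null_0 [simp]: "padic_null 0"
  by transfer simp

lemma padic_null_1 [simp]: "\<not> padic_null 1"
  by transfer simp

lemma padic_null_add: "padic_null X \<Longrightarrow> padic_null Y \<Longrightarrow> padic_null (X + Y)"
  by transfer (simp add: padic_vanishes_add)

lemma padic_null_minus [simp]: "padic_null (- X) \<longleftrightarrow> padic_null X"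
  by transfer (simp add: padic_vanishes_minus)

lemma padic_null_mult: "padic_null Y \<Longrightarrow> padic_null (X * Y)"
  by transfer (simp add: padic_vanishes_mult)

lift_definition padic_seq_inverse :: "'a::prime_card padic_seq \<Rightarrow> 'a padic_seq"
  is "\<lambda>X. if padic_vanishes CARD('a) X then (\<lambda>n. 0) else (\<lambda>n. inverse (X n))"
  by (simp add: padic_cauchy_inverse)

lemma padic_seq_inverse_null: "padic_null X \<Longrightarrow> padic_seq_inverse X = 0"
  by transfer simp

lemma padic_null_diff_inverse:
  "\<not> padic_null X \<Longrightarrow> \<not> padic_null Y \<Longrightarrow> padic_null (X - Y) \<Longrightarrow>
     padic_null (padic_seq_inverse X - padic_seq_inverse Y)"
  by transfer (simp add: padic_vanishes_diff_inverse)

lemma padic_null_inverse_mult: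
  "\<not> padic_null X \<Longrightarrow> padic_null (padic_seq_inverse X * X - 1)"
proof (transfer)
  fix X
  assume X: "padic_cauchy CARD('a) X" "\<not> padic_vanishes CARD('a) X"
  obtain b where "b > 0" "eventually (\<lambda>n. rat_padic_abs CARD('a) (X n) > b) sequentially"
    using padic_cauchy_not_vanishes[OF prime_card X] by blast
  from this(2) have "eventually (\<lambda>n. 0 = inverse (X n) * X n - 1) sequentially"
  proof (eventually_elim)
    fix n
    assume "rat_padic_abs CARD('a) (X n) > b"
    with \<open>b > 0\<close> have "X n \<noteq> 0"
      by (metis rat_padic_abs_0 less_asym)
    then show "0 = inverse (X n) * X n - 1"
      by simp
  qed
  from padic_vanishes_eventually[OF _ this]
  show "padic_vanishes CARD('a)
      (\<lambda>n. (if padic_vanishes CARD('a) X then \<lambda>n. 0 else (\<lambda>n. inverse (X n))) n * X n - 1)"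
    using X by simp
qed

lift_definition padic_seq_norm :: "'a::prime_card padic_seq \<Rightarrow> real"
  is "\<lambda>X. lim (\<lambda>n. rat_padic_abs CARD('a) (X n))" .

lemma padic_seq_norm_LIMSEQ:
  assumes "padic_cauchy CARD('a::prime_card) X"
  shows "(\<lambda>n. rat_padic_abs CARD('a) (X n)) \<longlonglongrightarrow> lim (\<lambda>n. rat_padic_abs CARD('a) (X n))"
  using padic_cauchy_convergent[OF prime_card assms] by (simp add: convergent_LIMSEQ_iff)

lemma padic_seq_norm_eq_0: "padic_seq_norm X = 0 \<longleftrightarrow> padic_null X"
proof (transfer)
  fix X
  assume "padic_cauchy CARD('a) X"
  from padic_seq_norm_LIMSEQ[OF this]
  show "lim (\<lambda>n. rat_padic_abs CARD('a) (X n)) = 0 \<longleftrightarrow> padic_vanishes CARD('a) X"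
    unfolding padic_vanishes_def by (metis limI)
qed

lemma padic_seq_norm_minus: "padic_seq_norm (- X) = padic_seq_norm X"
  by transfer simp

lemma padic_seq_norm_triangle: "padic_seq_norm (X + Y) \<le> padic_seq_norm X + padic_seq_norm Y"
proof (transfer)
  fix X Y
  assume *: "padic_cauchy CARD('a) X" "padic_cauchy CARD('a) Y"
  show "lim (\<lambda>n. rat_padic_abs CARD('a) (X n + Y n))
      \<le> lim (\<lambda>n. rat_padic_abs CARD('a) (X n)) + lim (\<lambda>n. rat_padic_abs CARD('a) (Y n))"
    by (rule LIMSEQ_le[OF padic_seq_norm_LIMSEQ[OF padic_cauchy_add[OF prime_card *]]
          tendsto_add[OF padic_seq_norm_LIMSEQ[OF *(1)] padic_seq_norm_LIMSEQ[OF *(2)]]])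
       (auto simp: rat_padic_abs_triangle)
qed

lemma padic_seq_norm_cong:
  assumes "padic_null (X - Y)"
  shows "padic_seq_norm X = padic_seq_norm Y"
proof -
  have "padic_seq_norm (X - Y) = 0"
    using assms by (simp add: padic_seq_norm_eq_0)
  then show ?thesis
    using padic_seq_norm_triangle[of "X - Y" Y] padic_seq_norm_triangle[of "- (X - Y)" X]
    by (simp add: padic_seq_norm_minus[of "X - Y", simplified])
qed

definition padicrel :: "'a::prime_card padic_seq \<Rightarrow> 'a padic_seq \<Rightarrow> bool" where
  "padicrel X Y \<longleftrightarrow> padic_null (X - Y)"

lemma padicrel_refl [simp]: "padicrel X X"
  by (simp add: padicrel_def)

lemma equivp_padicrel: "equivp padicrel"
proof (rule equivpI)
  show "reflp padicrel"
    by (simp add: reflp_def)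
  show "symp padicrel"
    unfolding symp_def padicrel_def using padic_null_minus minus_diff_eq by metis
  show "transp padicrel"
    unfolding padicrel_def by (rule transpI) (force dest: padic_null_add)
qed

quotient_type 'a padic = "'a::prime_card padic_seq" / padicrel
  by (rule equivp_padicrel)

instantiation padic :: (prime_card) field
begin

lift_definition zero_padic :: "'a padic" is 0 .

lift_definition one_padic :: "'a padic" is 1 .

lift_definition plus_padic :: "'a padic \<Rightarrow> 'a padic \<Rightarrow> 'a padic" is "(+)"
  unfolding padicrel_def add_diff_add by (rule padic_null_add)

lift_definition uminus_padic :: "'a padic \<Rightarrow> 'a padic" is uminus
  unfolding padicrel_def minus_diff_minus by (simp del: minus_diff_eq)

lift_definition times_padic :: "'a padic \<Rightarrow> 'a padic \<Rightarrow> 'a padic" is "(*)"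
proof -
  fix X X' Y Y' :: "'a padic_seq"
  assume "padicrel X X'" "padicrel Y Y'"
  then have "padic_null (X * (Y - Y') + Y' * (X - X'))"
    unfolding padicrel_def by (intro padic_null_add padic_null_mult)
  then show "padicrel (X * Y) (X' * Y')"
    by (simp add: padicrel_def algebra_simps)
qed

lift_definition inverse_padic :: "'a padic \<Rightarrow> 'a padic" is padic_seq_inverse
proof -
  fix X Y :: "'a padic_seq"
  assume *: "padicrel X Y"
  then have "padic_null X \<longleftrightarrow> padic_null Y"
    using padic_null_add[of "X - Y" Y] padic_null_add[of "- (X - Y)" X]
      padic_null_minus[of "X - Y"] by (auto simp: padicrel_def)
  then show "padicrel (padic_seq_inverse X) (padic_seq_inverse Y)"
    using * padic_null_diff_inverse[of X Y] unfolding padicrel_def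
    by (cases "padic_null X") (simp_all add: padic_seq_inverse_null)
qed

definition "x - y = x + - y" for x y :: "'a padic"

definition "x div y = x * inverse y" for x y :: "'a padic"

instance
proof
  fix a b c :: "'a padic"
  show "a + b = b + a" "(a + b) + c = a + (b + c)" "0 + a = a" "- a + a = 0"
    "(a * b) * c = a * (b * c)" "a * b = b * a" "1 * a = a" "(a + b) * c = a * c + b * c"
    by (transfer; simp add: algebra_simps)+
  show "a - b = a + - b"
    by (rule minus_padic_def)
  show "(0::'a padic) \<noteq> 1"
    by transfer (simp add: padicrel_def)
  show "a \<noteq> 0 \<Longrightarrow> inverse a * a = 1"
    by transfer (simp add: padicrel_def padic_null_inverse_mult)
  show "a div b = a * inverse b"
    by (rule divide_padic_def)
  show "inverse (0::'a padic) = 0"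
    by transfer (simp add: padic_seq_inverse_null)
qed

end

lift_definition padic_norm :: "'a::prime_card padic \<Rightarrow> real" is padic_seq_norm
  by (simp add: padicrel_def padic_seq_norm_cong)

lemma padic_norm_eq_0: "padic_norm x = 0 \<longleftrightarrow> x = 0"
  by transfer (simp add: padicrel_def padic_seq_norm_eq_0)

lemma padic_norm_minus: "padic_norm (- x) = padic_norm x"
  by transfer (rule padic_seq_norm_minus)

lemma padic_norm_triangle: "padic_norm (x + y) \<le> padic_norm x + padic_norm y"
  by transfer (rule padic_seq_norm_triangle)

lemma of_nat_padic_seq: "Rep_padic_seq (of_nat m) = (\<lambda>n. of_nat m)"
  by (induction m) (simp_all add: zero_padic_seq.rep_eq one_padic_seq.rep_eq plus_padic_seq.rep_eq)

lemma of_nat_padic: "(of_nat m :: 'a::prime_card padic) = abs_padic (of_nat m)"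
  by (induction m) (simp_all add: zero_padic_def one_padic_def plus_padic.abs_eq)

lemma padic_norm_of_nat:
  "padic_norm (of_nat m :: 'a::prime_card padic) = rat_padic_abs CARD('a) (of_nat m)"
  unfolding of_nat_padic padic_norm.abs_eq padic_seq_norm.rep_eq of_nat_padic_seq by simp

instance padic :: (prime_card) field_char_0
proof
  have *: "n = 0" if "of_nat n = (0 :: 'a padic)" for n
  proof -
    have "rat_padic_abs CARD('a) (of_nat n) = 0"
      using that padic_norm_of_nat[of n, where 'a = 'a] padic_norm_eq_0[of "0 :: 'a padic"] by metis
    then show ?thesis
      using rat_padic_abs_eq_0[OF prime_card[where 'a = 'a], of "of_nat n"] by (metis of_nat_eq_0_iff)
  qed
  show "inj (of_nat :: nat \<Rightarrow> 'a padic)"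
  proof (rule injI)
    fix m n :: nat
    assume eq: "of_nat m = (of_nat n :: 'a padic)"
    show "m = n"
    proof (cases "m \<le> n")
      case True
      then have "of_nat (n - m) = (0 :: 'a padic)"
        by (subst of_nat_diff) (simp_all only: eq diff_self)
      from *[OF this] True show ?thesis
        by (rule_tac le_antisym) simp_all
    next
      case False
      then have "of_nat (m - n) = (0 :: 'a padic)"
        by (subst of_nat_diff) (use False in \<open>simp_all add: eq\<close>)
      from *[OF this] False show ?thesis
        by simp
    qed
  qed
qed

instantiation padic :: (prime_card) metric_space
begin

definition dist_padic :: "'a padic \<Rightarrow> 'a padic \<Rightarrow> real" where
  "dist_padic x y = padic_norm (x - y)"

definition uniformity_padic :: "('a padic \<times> 'a padic) filter" where
  "uniformity_padic = (INF e\<in>{0<..}. principal {(x, y). dist x y < e})"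

definition open_padic :: "'a padic set \<Rightarrow> bool" where
  "open_padic U \<longleftrightarrow> (\<forall>x\<in>U. \<forall>\<^sub>F (x', y) in uniformity. x' = x \<longrightarrow> y \<in> U)"

instance
proof
  fix x y z :: "'a padic"
  show "dist x y = 0 \<longleftrightarrow> x = y"
    by (simp add: dist_padic_def padic_norm_eq_0)
  show "dist x y \<le> dist x z + dist y z"
    using padic_norm_triangle[of "x - z" "- (y - z)"] by (simp only: dist_padic_def padic_norm_minus) simp
qed (rule uniformity_padic_def open_padic_def)+

end

lemma padic_norm_prime: "padic_norm (of_nat CARD('p) :: 'p::prime_card padic) = 1 / CARD('p)"
proof -
  have p: "prime CARD('p)"
    by (rule prime_card)
  have "multiplicity (int CARD('p)) (int CARD('p)) = 1"
    using p by (intro multiplicity_self) (auto simp: prime_nat_iff)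
  then show ?thesis
    using rat_padic_abs_frac[OF p, of "int CARD('p)" 1] p 
    by (simp add: padic_norm_of_nat power_int_minus divide_simps)
qed

definition Zp :: "'p::prime_card padic set" where
  "Zp = {x. padic_norm x \<le> 1}"

text \<open>
  For \<open>x \<in> Zp\<close>, \<open>padic_residue m x\<close> is the integer $D_m(x) \in \{0,\dots,p^m-1\}$ congruent to
  \<open>x\<close> modulo $p^m$, and \<open>padic_digits x\<close> is the sequence $(a_i)$ with $x = \sum_i a_i p^i$.
\<close>

definition padic_residue :: "nat \<Rightarrow> 'p::prime_card padic \<Rightarrow> nat" where
  "padic_residue m x =
     (THE t. t < CARD('p) ^ m \<and> (\<exists>y\<in>Zp. x - of_nat t = of_nat CARD('p) ^ m * y))"

definition padic_digits :: "'p::prime_card padic \<Rightarrow> nat \<Rightarrow> nat" where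
  "padic_digits x =
     (THE a. (\<forall>i. a i < CARD('p)) \<and> (\<lambda>i. of_nat (a i) * of_nat CARD('p) ^ i) sums x)"

definition decimation :: "nat \<Rightarrow> nat \<Rightarrow> 'p::prime_card padic \<Rightarrow> 'p padic" where
  "decimation j k x = (\<Sum>m. of_nat (padic_digits x (j + m * k)) * of_nat CARD('p) ^ m)"


section \<open>Hausdorff dimension\<close>

text \<open>
  Only exponents \<open>s > 0\<close> are used below, so that \<open>0 powr 0 = 0\<close> does no harm; covering sets are
  required to be bounded because \<^const>\<open>diameter\<close> is meaningless for unbounded sets.
\<close>

definition hausdorff_premeasure :: "real \<Rightarrow> real \<Rightarrow> 'a::metric_space set \<Rightarrow> ennreal" where
  "hausdorff_premeasure s \<delta> A =
     (INF U \<in> {U :: nat \<Rightarrow> 'a set. A \<subseteq> (\<Union>i. U i) \<and> (\<forall>i. bounded (U i) \<and> diameter (U i) \<le> \<delta>)}.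
        \<Sum>i. ennreal (diameter (U i) powr s))"

definition hausdorff_measure :: "real \<Rightarrow> 'a::metric_space set \<Rightarrow> ennreal" where
  "hausdorff_measure s A = (SUP \<delta> \<in> {0<..}. hausdorff_premeasure s \<delta> A)"

definition hausdorff_dim :: "'a::metric_space set \<Rightarrow> ereal" where
  "hausdorff_dim A = Inf {ereal s |s. s > 0 \<and> hausdorff_measure s A = 0}"


section \<open>Self-similar sets\<close>

text \<open>
  An iterated function system of $n$ maps is given by \<open>n\<close> and the coefficient functions
  \<open>b\<close>, \<open>k\<close>, \<open>d\<close> on the index set \<open>{1..n}\<close>.
\<close>

definition ifs_map ::
    "(nat \<Rightarrow> nat) \<Rightarrow> (nat \<Rightarrow> nat) \<Rightarrow> (nat \<Rightarrow> 'p padic) \<Rightarrow> nat \<Rightarrow> 'p::prime_card padic \<Rightarrow> 'p padic" where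
  "ifs_map b k d i x = (-1) ^ b i * of_nat CARD('p) ^ k i * x + d i"

text \<open>By Hutchinson's theorem there is exactly one such set as soon as \<open>n\<close> and all \<open>k i\<close> are positive.\<close>

definition is_self_similar_set ::
    "nat \<Rightarrow> (nat \<Rightarrow> nat) \<Rightarrow> (nat \<Rightarrow> nat) \<Rightarrow> (nat \<Rightarrow> 'p padic) \<Rightarrow> 'p::prime_card padic set \<Rightarrow> bool" where
  "is_self_similar_set n b k d K \<longleftrightarrow>
     compact K \<and> K \<noteq> {} \<and> K = (\<Union>i\<in>{1..n}. ifs_map b k d i ` K)"


section \<open>The transducer and the associated automaton\<close>

type_synonym 'p tstate = "'p padic \<times> int"

definition transducer_out ::
    "(nat \<Rightarrow> nat) \<Rightarrow> (nat \<Rightarrow> 'p padic) \<Rightarrow> 'p::prime_card tstate \<Rightarrow> nat \<Rightarrow> nat" where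
  "transducer_out k d s i = padic_residue (k i) (fst s + of_int (snd s) * d i)"

definition transducer_next ::
    "(nat \<Rightarrow> nat) \<Rightarrow> (nat \<Rightarrow> nat) \<Rightarrow> (nat \<Rightarrow> 'p padic) \<Rightarrow> 'p::prime_card tstate \<Rightarrow> nat \<Rightarrow> 'p tstate" where
  "transducer_next b k d s i =
     ((fst s + of_int (snd s) * d i - of_nat (transducer_out k d s i)) / of_nat CARD('p) ^ k i,
      snd s * (-1) ^ b i)"

inductive_set transducer_states ::
    "nat \<Rightarrow> (nat \<Rightarrow> nat) \<Rightarrow> (nat \<Rightarrow> nat) \<Rightarrow> (nat \<Rightarrow> 'p padic) \<Rightarrow> 'p::prime_card tstate set"
  for n b k d where
  initial: "(0, 1) \<in> transducer_states n b k d"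
| step: "s \<in> transducer_states n b k d \<Longrightarrow> i \<in> {1..n} \<Longrightarrow>
           transducer_next b k d s i \<in> transducer_states n b k d"

text \<open>
  \<open>Inner s i l\<close> is the intermediate state reached after the first \<open>l\<close> of the \<open>k i\<close> digits output
  by the transition reading \<open>i\<close> from \<open>s\<close>.
\<close>

datatype 'p nstate = Main "'p tstate" | Inner "'p tstate" nat nat

definition path_vertex ::
    "(nat \<Rightarrow> nat) \<Rightarrow> (nat \<Rightarrow> nat) \<Rightarrow> (nat \<Rightarrow> 'p padic) \<Rightarrow> 'p::prime_card tstate \<Rightarrow> nat \<Rightarrow> nat \<Rightarrow> 'p nstate" where
  "path_vertex b k d s i l =
     (if l = 0 then Main s
      else if l < k i then Inner s i l
      else Main (transducer_next b k d s i))"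

definition ndfa_states ::
    "nat \<Rightarrow> (nat \<Rightarrow> nat) \<Rightarrow> (nat \<Rightarrow> nat) \<Rightarrow> (nat \<Rightarrow> 'p padic) \<Rightarrow> 'p::prime_card nstate set" where
  "ndfa_states n b k d =
     Main ` transducer_states n b k d \<union>
     {Inner s i l | s i l. s \<in> transducer_states n b k d \<and> i \<in> {1..n} \<and> 1 \<le> l \<and> l < k i}"

inductive ndfa_edge ::
    "nat \<Rightarrow> (nat \<Rightarrow> nat) \<Rightarrow> (nat \<Rightarrow> nat) \<Rightarrow> (nat \<Rightarrow> 'p padic) \<Rightarrow>
     'p::prime_card nstate \<Rightarrow> nat \<Rightarrow> 'p nstate \<Rightarrow> bool"
  for n b k d where
  "s \<in> transducer_states n b k d \<Longrightarrow> i \<in> {1..n} \<Longrightarrow> l < k i \<Longrightarrow>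
     ndfa_edge n b k d
       (path_vertex b k d s i l)
       (transducer_out k d s i div CARD('p) ^ l mod CARD('p))
       (path_vertex b k d s i (Suc l))"

text \<open>
  \<open>nfa_path S \<E> q w q'\<close>: there is a path from \<open>q\<close> to \<open>q'\<close> labelled by the word \<open>w\<close> all of whose
  vertices lie in \<open>S\<close>; its number of edges is the length of \<open>w\<close>.
\<close>

inductive nfa_path :: "'q set \<Rightarrow> ('q \<Rightarrow> 'a \<Rightarrow> 'q \<Rightarrow> bool) \<Rightarrow> 'q \<Rightarrow> 'a list \<Rightarrow> 'q \<Rightarrow> bool"
  for S \<E> where
  Nil: "q \<in> S \<Longrightarrow> nfa_path S \<E> q [] q"
| Cons: "q \<in> S \<Longrightarrow> \<E> q a q' \<Longrightarrow> nfa_path S \<E> q' w q'' \<Longrightarrow> nfa_path S \<E> q (a # w) q''"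

definition internally_connected :: "('q \<Rightarrow> 'a \<Rightarrow> 'q \<Rightarrow> bool) \<Rightarrow> 'q set \<Rightarrow> bool" where
  "internally_connected \<E> C \<longleftrightarrow> (\<forall>q\<in>C. \<forall>q'\<in>C. \<exists>w. nfa_path C \<E> q w q')"

definition essential_class :: "'q set \<Rightarrow> ('q \<Rightarrow> 'a \<Rightarrow> 'q \<Rightarrow> bool) \<Rightarrow> 'q set \<Rightarrow> bool" where
  "essential_class Q \<E> C \<longleftrightarrow>
     C \<subseteq> Q \<and> internally_connected \<E> C \<and>
     (\<forall>C'. C \<subseteq> C' \<and> C' \<subseteq> Q \<and> internally_connected \<E> C' \<longrightarrow> C' = C) \<and>
     (\<forall>q\<in>C. \<forall>w q'. nfa_path Q \<E> q w q' \<longrightarrow> q' \<in> C)"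

text \<open>All states are accepting, so the words accepted from \<open>q\<close> are the labels of paths starting at \<open>q\<close>.\<close>

definition accepted_from :: "'q set \<Rightarrow> ('q \<Rightarrow> 'a \<Rightarrow> 'q \<Rightarrow> bool) \<Rightarrow> 'q \<Rightarrow> 'a list set" where
  "accepted_from Q \<E> q = {w. \<exists>q'. nfa_path Q \<E> q w q'}"

end

theory Submission
  imports Defs
begin

text \<open>
  Call two states $(c,\varepsilon)$, $(c',\varepsilon')$ of the transducer congruent if
  $\varepsilon=\varepsilon'$ and $c-c'\in\mathbb{Z}$. Every input letter acts injectively on the
  finitely many congruence classes, hence permutes them, so that the essential class contains a
  state $(m,1)$ congruent to the initial state $(0,1)$. Thus all digits of $m+x$ lie in $E$ for every
  $x\in K$. Adding an integer changes only finitely many digits of a $p$-adic integer, unless it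
  makes them eventually constant; so each decimation of $K$ is covered by countably many sets of
  sequences with digits eventually in $E$ or in a singleton, which gives the upper bound.

  For the lower bound, coprime loops at $q$ provide, for all large $k$, loops of length exactly $k$
  with an arbitrary digit of $E$ at a fixed place. By compactness of $K$ every sequence in
  $E^{\mathbb{N}}$ occurs, from some index on, in the decimation, which therefore has a
  Hoelder map of exponent $\log\#E/\log p$ onto $[0,1)$: read the digits in base $\#E$.
\<close>

section \<open>Arithmetic of $p$-adic integers\<close>

text \<open>Two obstacles shape the proof. The initial state need not lie in the essential class, so
  \<open>K\<close> may show digits outside \<open>E\<close>; and the automaton is nondeterministic,
  so words and paths do not correspond. The first is met by attaching to a state (c,\<epsilon>) the
  value set c + \<epsilon>K: the state (m,1) yields m + K, which differs from \<open>K\<close> only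
  by carries. A carry from adding 1 never stops only on -1, and a borrow only on 0; the resulting
  constant tail may use a digit outside \<open>E\<close>, but a one-letter alphabet has exponent 0.
  The second is harmless because the lower bound needs only that a path exists, and the upper bound
  counts digit words, never paths. No permutation of congruence classes is constructed: congruence
  pulls back along transitions, and the pigeonhole principle on a sequence of actual states does the
  rest. The threshold for k comes from the coin problem for two coprime loop lengths, enlarged by
  the detours from q to an edge with a given digit and back.\<close>

lemma padic_norm_nonneg: "padic_norm x \<ge> 0"
  using padic_norm_triangle[of x "- x"] padic_norm_eq_0[of "0 :: 'a padic"]
  by (simp add: padic_norm_minus)

lemma padic_norm_mult: "padic_norm (x * y) = padic_norm x * padic_norm (y :: 'p::prime_card padic)"
proof (transfer, transfer)
  fix X Y
  assume XY: "padic_cauchy CARD('p) X" "padic_cauchy CARD('p) Y"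
  have "(\<lambda>n. rat_padic_abs CARD('p) (X n * Y n)) \<longlonglongrightarrow>
      lim (\<lambda>n. rat_padic_abs CARD('p) (X n)) * lim (\<lambda>n. rat_padic_abs CARD('p) (Y n))"
    unfolding rat_padic_abs_mult[OF prime_card]
    by (intro tendsto_mult padic_seq_norm_LIMSEQ XY)
  then show "lim (\<lambda>n. rat_padic_abs CARD('p) (X n * Y n)) =
      lim (\<lambda>n. rat_padic_abs CARD('p) (X n)) * lim (\<lambda>n. rat_padic_abs CARD('p) (Y n))"
    by (rule limI)
qed

lemma padic_norm_ultrametric:
  "padic_norm (x + y) \<le> max (padic_norm x) (padic_norm (y :: 'p::prime_card padic))"
proof (transfer, transfer)
  fix X Y
  assume XY: "padic_cauchy CARD('p) X" "padic_cauchy CARD('p) Y"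
  show "lim (\<lambda>n. rat_padic_abs CARD('p) (X n + Y n)) \<le>
      max (lim (\<lambda>n. rat_padic_abs CARD('p) (X n))) (lim (\<lambda>n. rat_padic_abs CARD('p) (Y n)))"
    by (rule LIMSEQ_le[OF padic_seq_norm_LIMSEQ[OF padic_cauchy_add[OF prime_card XY]]
          tendsto_max[OF padic_seq_norm_LIMSEQ[OF XY(1)] padic_seq_norm_LIMSEQ[OF XY(2)]]])
       (auto simp: rat_padic_abs_ultrametric)
qed

lemma padic_norm_0 [simp]: "padic_norm 0 = 0"
  by (simp add: padic_norm_eq_0)

lemma padic_norm_1 [simp]: "padic_norm (1 :: 'p::prime_card padic) = 1"
  using padic_norm_of_nat[of 1, where 'a = 'p] by simp

lemma padic_norm_minus_commute: "padic_norm (x - y) = padic_norm (y - x)"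
  using padic_norm_minus[of "x - y"] by simp

lemma padic_norm_add_le:
  "padic_norm x \<le> r \<Longrightarrow> padic_norm y \<le> r \<Longrightarrow> padic_norm (x + y) \<le> r"
  using padic_norm_ultrametric[of x y] by linarith

lemma padic_norm_diff_le:
  "padic_norm x \<le> r \<Longrightarrow> padic_norm y \<le> r \<Longrightarrow> padic_norm (x - y) \<le> r"
  using padic_norm_add_le[of x r "- y"] by (simp add: padic_norm_minus)

lemma padic_norm_power: "padic_norm (x ^ m) = padic_norm x ^ m"
  by (induction m) (simp_all add: padic_norm_mult)

lemma padic_norm_inverse: "padic_norm (inverse x) = inverse (padic_norm x)"
proof (cases "x = 0")
  case False
  then have "padic_norm x * padic_norm (inverse x) = 1"
    using padic_norm_mult[of x "inverse x"] by simp
  then show ?thesis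
    by (metis inverse_unique)
qed auto

lemma padic_norm_divide: "padic_norm (x / y) = padic_norm x / padic_norm y"
  by (simp add: divide_inverse padic_norm_mult padic_norm_inverse)

abbreviation P :: "'p::prime_card padic" where
  "P \<equiv> of_nat CARD('p)"

lemma one_less_prime_card: "1 < CARD('p::prime_card)"
  using prime_gt_1_nat[OF prime_card[where 'a = 'p]] .

lemma prime_card_int [simp]: "prime (int CARD('p::prime_card))"
  by simp

lemma prime_card_nonzero [simp]: "CARD('p::prime_card) \<noteq> 0" "0 < CARD('p::prime_card)"
  using one_less_prime_card[where 'p = 'p] by linarith+

lemma padic_norm_prime_power:
  "padic_norm (P ^ m :: 'p::prime_card padic) = (1 / CARD('p)) ^ m"
  by (simp add: padic_norm_power padic_norm_prime)

lemma padic_norm_of_int: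
  "padic_norm (of_int a :: 'p::prime_card padic) = rat_padic_abs CARD('p) (of_int a)"
proof (cases "a \<ge> 0")
  case True
  then show ?thesis
    using padic_norm_of_nat[of "nat a", where 'a = 'p] by (simp add: of_nat_nat)
next
  case False
  then show ?thesis
    using padic_norm_of_nat[of "nat (- a)", where 'a = 'p]
    by (simp add: of_nat_nat padic_norm_minus)
qed

lemma padic_norm_of_int_le_power_iff:
  "padic_norm (of_int a :: 'p::prime_card padic) \<le> (1 / CARD('p)) ^ m \<longleftrightarrow> int CARD('p) ^ m dvd a"
proof (cases "a = 0")
  case False
  have p: "1 < real CARD('p)"
    using one_less_prime_card[where 'p = 'p] by simp
  have "padic_norm (of_int a :: 'p padic) = real CARD('p) powi (- int (multiplicity (int CARD('p)) a))"
    using rat_padic_abs_frac[OF prime_card[where 'a = 'p], of a 1] False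
    by (simp add: padic_norm_of_int)
  also have "\<dots> = (1 / CARD('p)) ^ multiplicity (int CARD('p)) a"
    by (simp add: power_int_minus power_divide divide_simps)
  finally have eq: "padic_norm (of_int a :: 'p padic) = (1 / CARD('p)) ^ multiplicity (int CARD('p)) a" .
  have "(1 / real CARD('p)) ^ multiplicity (int CARD('p)) a \<le> (1 / CARD('p)) ^ m \<longleftrightarrow>
      m \<le> multiplicity (int CARD('p)) a"
    using p by (intro power_decreasing_iff) auto
  also have "\<dots> \<longleftrightarrow> int CARD('p) ^ m dvd a"
    using False p by (subst power_dvd_iff_le_multiplicity) auto
  finally show ?thesis
    using eq by simp
qed auto

lemma padic_norm_of_int_le_1: "padic_norm (of_int a :: 'p::prime_card padic) \<le> 1"
  using padic_norm_of_int_le_power_iff[of a 0, where 'p = 'p] by simp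

lemma Zp_of_int [simp, intro!]: "of_int a \<in> Zp"
  by (simp add: Zp_def padic_norm_of_int_le_1)

lemma Zp_of_nat [simp, intro!]: "of_nat a \<in> Zp"
  using Zp_of_int[of "int a"] by simp

lemma Zp_add [intro]: "x \<in> Zp \<Longrightarrow> y \<in> Zp \<Longrightarrow> x + y \<in> Zp"
  by (simp add: Zp_def padic_norm_add_le)

lemma Zp_diff [intro]: "x \<in> Zp \<Longrightarrow> y \<in> Zp \<Longrightarrow> x - y \<in> Zp"
  by (simp add: Zp_def padic_norm_diff_le)

lemma Zp_mult [intro]: "x \<in> Zp \<Longrightarrow> y \<in> Zp \<Longrightarrow> x * y \<in> Zp"
  by (simp add: Zp_def padic_norm_mult mult_le_one padic_norm_nonneg)

lemma Zp_power [intro]: "x \<in> Zp \<Longrightarrow> x ^ m \<in> Zp"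
  by (simp add: Zp_def padic_norm_power power_le_one padic_norm_nonneg)

lemma padic_norm_le_power_iff:
  "padic_norm (x :: 'p::prime_card padic) \<le> (1 / CARD('p)) ^ m \<longleftrightarrow> (\<exists>y\<in>Zp. x = P ^ m * y)"
proof
  assume *: "padic_norm x \<le> (1 / CARD('p)) ^ m"
  have pos: "(1 / real CARD('p)) ^ m > 0"
    using one_less_prime_card[where 'p = 'p] by simp
  have "padic_norm (x / P ^ m) = padic_norm x / (1 / CARD('p)) ^ m"
    by (simp only: padic_norm_divide padic_norm_prime_power)
  also have "\<dots> \<le> 1"
    using * pos by (simp only: divide_le_eq_1_pos)
  finally have "x / P ^ m \<in> Zp"
    by (simp add: Zp_def)
  moreover have "x = P ^ m * (x / P ^ m)"
    by simp
  ultimately show "\<exists>y\<in>Zp. x = P ^ m * y"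
    by blast
next
  assume "\<exists>y\<in>Zp. x = P ^ m * y"
  then obtain y where y: "padic_norm y \<le> 1" "x = P ^ m * y"
    by (auto simp: Zp_def)
  have "padic_norm x = (1 / CARD('p)) ^ m * padic_norm y"
    by (simp only: y padic_norm_mult padic_norm_prime_power)
  also have "\<dots> \<le> (1 / CARD('p)) ^ m"
    using y(1) by (simp add: mult_left_le)
  finally show "padic_norm x \<le> (1 / CARD('p)) ^ m" .
qed

lemma prime_power_times_Zp_of_int:
  assumes "y \<in> Zp" "of_int a = (P ^ m * y :: 'p::prime_card padic)"
  shows "int CARD('p) ^ m dvd a"
  using assms padic_norm_le_power_iff[of "of_int a :: 'p padic" m] padic_norm_of_int_le_power_iff[of a m, where 'p = 'p]
  by blast

section \<open>Density of the rationals and the first digit of a p-adic integer\<close>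

lift_definition padic_seq_const :: "rat \<Rightarrow> 'p::prime_card padic_seq" is "\<lambda>r n. r"
  by simp

text \<open>The embedding of the rationals as constant Cauchy sequences. In contrast to the
  algebraic \<open>of_rat\<close> it comes with a representative, from which distances can be read
  off.\<close>

lift_definition padic_of_rat :: "rat \<Rightarrow> 'p::prime_card padic" is padic_seq_const .

lemma padic_of_rat_add: "padic_of_rat (r + s) = padic_of_rat r + padic_of_rat s"
  by (transfer, rule arg_cong2[where f = padicrel, THEN iffD2, OF _ refl padicrel_refl], transfer) simp

lemma padic_of_rat_mult: "padic_of_rat (r * s) = padic_of_rat r * padic_of_rat s"
  by (transfer, rule arg_cong2[where f = padicrel, THEN iffD2, OF _ refl padicrel_refl], transfer) simp

lemma padic_of_rat_minus: "padic_of_rat (- r) = - padic_of_rat r"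
  by (transfer, rule arg_cong2[where f = padicrel, THEN iffD2, OF _ refl padicrel_refl], transfer) simp

lemma padic_of_rat_0: "padic_of_rat 0 = 0"
  using padic_of_rat_add[of 0 0] by simp

lemma padic_of_rat_1: "padic_of_rat 1 = 1"
  by (transfer, rule arg_cong2[where f = padicrel, THEN iffD2, OF _ refl padicrel_refl], transfer) simp

lemma padic_of_rat_of_nat: "padic_of_rat (of_nat a) = of_nat a"
  by (induction a) (simp_all add: padic_of_rat_0 padic_of_rat_1 padic_of_rat_add)

lemma padic_seq_approx_const:
  "\<forall>\<epsilon>>0. \<exists>r. padic_seq_norm (X - padic_seq_const r :: 'p::prime_card padic_seq) < \<epsilon>"
proof (transfer, intro allI impI)
  fix \<epsilon> :: real and X
  assume X: "padic_cauchy CARD('p) X" and \<epsilon>: "\<epsilon> > 0"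
  then obtain N where N: "\<And>m. m \<ge> N \<Longrightarrow> rat_padic_abs CARD('p) (X m - X N) < \<epsilon> / 2"
    unfolding padic_cauchy_def by (metis half_gt_zero order_refl)
  have "padic_cauchy CARD('p) (\<lambda>n. X n + - X N)"
    by (intro padic_cauchy_add prime_card X padic_cauchy_const)
  from padic_seq_norm_LIMSEQ[OF this]
  have "lim (\<lambda>n. rat_padic_abs CARD('p) (X n - X N)) \<le> \<epsilon> / 2"
    by (intro LIMSEQ_le_const2[where a = "\<epsilon> / 2"]) (use N in \<open>force intro: exI[of _ N] less_imp_le\<close>)+
  then show "\<exists>r. lim (\<lambda>n. rat_padic_abs CARD('p) (X n - r)) < \<epsilon>"
    using \<epsilon> by (intro exI[of _ "X N"]) linarith
qed

lemma padic_approx_rat: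
  fixes x :: "'p::prime_card padic"
  assumes "\<epsilon> > 0"
  obtains r where "padic_norm (x - padic_of_rat r) < \<epsilon>"
proof -
  obtain X where x: "x = abs_padic X"
    by (metis Quotient3_abs_rep Quotient3_padic)
  obtain r where "padic_seq_norm (X - padic_seq_const r) < \<epsilon>"
    using padic_seq_approx_const assms by blast
  moreover have "x - padic_of_rat r = abs_padic (X - padic_seq_const r)"
    by (simp add: x padic_of_rat_def minus_padic_def uminus_padic.abs_eq plus_padic.abs_eq)
  ultimately show ?thesis
    using that[of r] by (simp add: padic_norm.abs_eq)
qed

lemma padic_of_rat_of_int: "padic_of_rat (of_int a) = of_int a"
  by (cases a) (simp_all add: padic_of_rat_of_nat padic_of_rat_minus padic_of_rat_1 padic_of_rat_add
      del: of_nat_Suc flip: of_nat_Suc)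

lemma prime_not_dvd_denominator:
  assumes "x \<in> Zp" "x * of_int b = (of_int a :: 'p::prime_card padic)" "coprime a b"
  shows "\<not> int CARD('p) dvd b"
proof
  assume *: "int CARD('p) dvd b"
  then obtain c where "b = int CARD('p) * c"
    by blast
  then have "of_int a = P ^ 1 * (x * of_int c)"
    using assms(2) by (simp add: mult.left_commute)
  then have "int CARD('p) ^ 1 dvd a"
    using assms(1) by (intro prime_power_times_Zp_of_int) auto
  then have "is_unit (int CARD('p))"
    using * assms(3) by (metis coprime_common_divisor power_one_right)
  then show False
    using prime_card_int not_prime_unit by blast
qed

lemma Zp_first_digit:
  fixes x :: "'p::prime_card padic"
  assumes "x \<in> Zp"
  shows "\<exists>t<CARD('p). \<exists>z\<in>Zp. x = of_nat t + P * z"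
proof -
  have "0 < 1 / real CARD('p)"
    by simp
  \<comment> \<open>Precision below 1/p suffices: \<open>x\<close> and the rational then agree
    modulo p.\<close>
  then obtain r where r: "padic_norm (x - padic_of_rat r) < 1 / CARD('p)"
    using padic_approx_rat by blast
  define y :: "'p padic" where "y = padic_of_rat r"
  obtain a b where ab: "quotient_of r = (a, b)"
    by fastforce
  then have "r * of_int b = of_int a" and cop: "coprime a b"
    using quotient_of_denom_pos[OF ab] quotient_of_div[OF ab] quotient_of_coprime[OF ab] by auto
  then have y: "y * of_int b = of_int a"
    unfolding y_def by (metis padic_of_rat_mult padic_of_rat_of_int)
  have xy: "\<exists>z\<in>Zp. x - y = P ^ 1 * z"
    using r by (subst padic_norm_le_power_iff[symmetric]) (simp add: y_def)
  then have "x - y \<in> Zp"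
    by auto
  from Zp_diff[OF assms this] have y_Zp: "y \<in> Zp"
    by simp
  \<comment> \<open>The denominator is a unit modulo p with the Bezout coefficient \<open>v\<close>
    as its inverse, so the digit sought is \<open>a * v\<close> modulo p.\<close>
  have "coprime (int CARD('p)) b"
    using prime_not_dvd_denominator[OF y_Zp y cop] prime_card_int by (simp add: prime_imp_coprime)
  then obtain u v where uv: "u * int CARD('p) + v * b = 1"
    using bezout_int[of "int CARD('p)" b] by auto
  define t where "t = nat (a * v mod int CARD('p))"
  have t: "int t = a * v mod int CARD('p)" "t < CARD('p)"
    by (simp_all add: t_def nat_less_iff)
  obtain s where s: "a * v = int t + int CARD('p) * s"
    using t(1) by (metis add.commute mult_div_mod_eq)
  have "y = y * of_int (u * int CARD('p) + v * b)"
    by (simp only: uv) simp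
  also have "\<dots> = P * (of_int u * y) + (y * of_int b) * of_int v"
    by (simp add: algebra_simps)
  also have "\<dots> = P * (of_int u * y) + of_int (a * v)"
    by (simp only: y) simp
  also have "\<dots> = of_nat t + P * (of_int u * y + of_int s)"
    by (simp only: s) (simp add: algebra_simps)
  finally have yt: "y = of_nat t + P * (of_int u * y + of_int s)" .
  obtain z where z: "z \<in> Zp" "x - y = P * z"
    using xy by auto
  have "x = of_nat t + P * (of_int u * y + of_int s + z)"
    using yt z(2) by (simp add: algebra_simps)
  then show ?thesis
    using t(2) z(1) y_Zp by blast
qed

section \<open>Digit expansions: uniqueness, existence, and their relation to the norm\<close>

lemma nat_eq_if_dvd_diff:
  assumes "int c dvd int s - int t" "s < c" "t < c"
  shows "s = t"
proof -
  have "int s mod int c = int t mod int c"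
    using assms(1) by (simp add: mod_eq_dvd_iff)
  then show ?thesis
    using assms(2,3) by simp
qed

lemma Zp_first_digit_unique:
  assumes "z \<in> Zp" "w \<in> Zp" "s < CARD('p)" "t < CARD('p)"
    and eq: "of_nat s + P * z = (of_nat t + P * w :: 'p::prime_card padic)"
  shows "s = t" "z = w"
proof -
  have "of_int (int s - int t) = P ^ 1 * (w - z)"
    using eq by (simp add: algebra_simps)
  then have "int CARD('p) ^ 1 dvd int s - int t"
    using assms(1,2) by (intro prime_power_times_Zp_of_int) auto
  then show "s = t"
    using assms(3,4) nat_eq_if_dvd_diff[of "CARD('p)" s t] by simp
  then show "z = w"
    using eq by simp
qed

text \<open>Congruences modulo every power of p replace convergence, so that digits can be peeled
  off algebraically; \<open>padic_sums_iff\<close> returns to the series in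
  \<open>padic_digits\<close>.\<close>

definition padic_expansion :: "(nat \<Rightarrow> nat) \<Rightarrow> 'p::prime_card padic \<Rightarrow> bool" where
  "padic_expansion a x \<longleftrightarrow> (\<forall>i. a i < CARD('p)) \<and>
     (\<forall>m. \<exists>z\<in>Zp. x = (\<Sum>i<m. of_nat (a i) * P ^ i) + P ^ m * z)"

lemma padic_expansion_Zp: "padic_expansion a x \<Longrightarrow> x \<in> Zp"
  by (auto simp: padic_expansion_def dest: spec[of _ 0])

lemma padic_expansion_less: "padic_expansion a (x :: 'p padic) \<Longrightarrow> a i < CARD('p::prime_card)"
  by (simp add: padic_expansion_def)

lemma padic_expansion_shift:
  assumes "padic_expansion a (x :: 'p::prime_card padic)"
  obtains z where "z \<in> Zp" "x = of_nat (a 0) + P * z" "padic_expansion (\<lambda>i. a (Suc i)) z"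
proof -
  obtain z where z: "z \<in> Zp" "x = of_nat (a 0) + P * z"
    using assms unfolding padic_expansion_def by (auto dest: spec[of _ 1])
  have "\<exists>w\<in>Zp. z = (\<Sum>i<m. of_nat (a (Suc i)) * P ^ i) + P ^ m * w" for m
  proof -
    obtain w where w: "w \<in> Zp" "x = (\<Sum>i<Suc m. of_nat (a i) * P ^ i) + P ^ Suc m * w"
      using assms unfolding padic_expansion_def by blast
    have "P * z = P * ((\<Sum>i<m. of_nat (a (Suc i)) * P ^ i) + P ^ m * w)"
      using w(2) z(2) unfolding sum.lessThan_Suc_shift
      by (simp add: algebra_simps sum_distrib_left)
    then show ?thesis
      using w(1) by auto
  qed
  then show ?thesis
    using assms z that by (auto simp: padic_expansion_def)
qed

lemma padic_expansion_tails:
  assumes "\<And>i. t i \<in> Zp" "\<And>i. a i < CARD('p)"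
    and "\<And>i. t i = of_nat (a i) + P * (t (Suc i) :: 'p::prime_card padic)"
  shows "padic_expansion a (t 0)"
proof -
  have "t 0 = (\<Sum>i<m. of_nat (a i) * P ^ i) + P ^ m * t m" for m
  proof (induction m)
    case (Suc m)
    then show ?case
      using assms(3)[of m] by (simp add: algebra_simps)
  qed simp
  then show ?thesis
    using assms(1,2) unfolding padic_expansion_def by blast
qed

lemma padic_expansion_exists:
  assumes "(x :: 'p::prime_card padic) \<in> Zp"
  shows "\<exists>a. padic_expansion a x"
proof -
  obtain f g where fg: "\<And>x :: 'p padic. x \<in> Zp \<Longrightarrow> f x < CARD('p) \<and> g x \<in> Zp \<and> x = of_nat (f x) + P * g x"
    using Zp_first_digit by metis
  have t: "(g ^^ i) x \<in> Zp" for i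
    by (induction i) (use assms fg in auto)
  have "padic_expansion (\<lambda>i. f ((g ^^ i) x)) ((g ^^ 0) x)"
    by (rule padic_expansion_tails) (use fg t in auto)
  then show ?thesis
    by auto
qed

lemma padic_expansion_unique:
  assumes "padic_expansion a x" "padic_expansion b (x :: 'p::prime_card padic)"
  shows "a = b"
proof
  fix i
  show "a i = b i"
    using assms
  proof (induction i arbitrary: a b x)
    case 0
    then show ?case
      by (metis Zp_first_digit_unique(1) padic_expansion_shift padic_expansion_less)
  next
    case (Suc i)
    obtain z where z: "z \<in> Zp" "x = of_nat (a 0) + P * z" "padic_expansion (\<lambda>i. a (Suc i)) z"
      using padic_expansion_shift[OF Suc.prems(1)] .
    obtain w where w: "w \<in> Zp" "x = of_nat (b 0) + P * w" "padic_expansion (\<lambda>i. b (Suc i)) w"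
      using padic_expansion_shift[OF Suc.prems(2)] .
    have "z = w"
      using Zp_first_digit_unique(2)[OF z(1) w(1)] padic_expansion_less[OF Suc.prems(1)]
        padic_expansion_less[OF Suc.prems(2)] z(2) w(2) by metis
    then show ?case
      using Suc.IH z(3) w(3) by blast
  qed
qed

lemma rat_padic_abs_digit_tail:
  assumes "\<And>i. a i < CARD('p::prime_card)" "m \<le> n"
  shows "rat_padic_abs CARD('p) ((\<Sum>i<n. of_nat (a i) * of_nat CARD('p) ^ i) - (\<Sum>i<m. of_nat (a i) * of_nat CARD('p) ^ i))
    \<le> (1 / CARD('p)) ^ m"
proof -
  have *: "(\<Sum>i<n. of_nat (a i) * of_nat CARD('p) ^ i) - (\<Sum>i<m. of_nat (a i) * of_nat CARD('p) ^ i) =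
      (of_int (\<Sum>i\<in>{m..<n}. int (a i) * int CARD('p) ^ i) :: rat)"
    using assms(2) by (simp add: sum_diff_nat_ivl lessThan_atLeast0)
  have "int CARD('p) ^ m dvd (\<Sum>i\<in>{m..<n}. int (a i) * int CARD('p) ^ i)"
    by (intro dvd_sum dvd_mult le_imp_power_dvd) auto
  then show ?thesis
    unfolding * padic_norm_of_int_le_power_iff[where 'p = 'p, symmetric] padic_norm_of_int .
qed

lemma inverse_prime_power_tendsto_0: "(\<lambda>m. (1 / real CARD('p::prime_card)) ^ m) \<longlonglongrightarrow> 0"
  using one_less_prime_card[where 'p = 'p] by (intro LIMSEQ_power_zero) auto

text \<open>The partial sums form a Cauchy sequence of rationals, and its class is already the
  element sought; no limit has to be constructed.\<close>

lemma padic_expansion_realized: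
  assumes a: "\<And>i. a i < CARD('p)"
  shows "\<exists>x :: 'p::prime_card padic. padic_expansion a x"
proof -
  define X :: "nat \<Rightarrow> rat" where "X = (\<lambda>n. \<Sum>i<n. of_nat (a i) * of_nat CARD('p) ^ i)"
  have X: "rat_padic_abs CARD('p) (X n - X m) \<le> (1 / CARD('p)) ^ m" if "m \<le> n" for m n
    unfolding X_def by (rule rat_padic_abs_digit_tail[OF a that])
  have "padic_cauchy CARD('p) X"
    unfolding padic_cauchy_def
  proof (intro allI impI)
    fix r :: real
    assume "r > 0"
    then obtain N where N: "(1 / real CARD('p)) ^ N < r"
      using order_tendstoD(2)[OF inverse_prime_power_tendsto_0[where 'p = 'p]]
      unfolding eventually_sequentially by blast
    have "rat_padic_abs CARD('p) (X m - X n) < r" if "m \<ge> N" "n \<ge> N" for m n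
      using rat_padic_abs_ultrametric[of "CARD('p)" "X m - X N" "- (X n - X N)"]
        X[OF that(1)] X[OF that(2)] N by (simp del: minus_diff_eq)
    then show "\<exists>N. \<forall>m\<ge>N. \<forall>n\<ge>N. rat_padic_abs CARD('p) (X m - X n) < r"
      by blast
  qed
  then obtain Y :: "'p padic_seq" where Y: "Rep_padic_seq Y = X"
    by (metis Abs_padic_seq_inverse mem_Collect_eq)
  \<comment> \<open>From index \<open>m\<close> on, the terms of the representing sequence of the
    difference have absolute value at most p^-m, and this bound passes to the norm.\<close>
  have "\<exists>z\<in>Zp. abs_padic Y - of_nat (\<Sum>i<m. a i * CARD('p) ^ i) = P ^ m * z" for m
  proof -
    have "Rep_padic_seq (Y - of_nat (\<Sum>i<m. a i * CARD('p) ^ i)) = (\<lambda>n. X n - X m)"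
      by (simp only: minus_padic_seq.rep_eq Y of_nat_padic_seq) (simp add: X_def)
    moreover have "padic_cauchy CARD('p) (Rep_padic_seq (Y - of_nat (\<Sum>i<m. a i * CARD('p) ^ i)))"
      using Rep_padic_seq by blast
    ultimately have "(\<lambda>n. rat_padic_abs CARD('p) (X n - X m)) \<longlonglongrightarrow> padic_seq_norm (Y - of_nat (\<Sum>i<m. a i * CARD('p) ^ i))"
      using padic_seq_norm_LIMSEQ by (metis padic_seq_norm.rep_eq)
    then have "padic_seq_norm (Y - of_nat (\<Sum>i<m. a i * CARD('p) ^ i)) \<le> (1 / CARD('p)) ^ m"
      by (rule LIMSEQ_le_const2) (use X in blast)
    moreover have "abs_padic Y - of_nat (\<Sum>i<m. a i * CARD('p) ^ i) = abs_padic (Y - of_nat (\<Sum>i<m. a i * CARD('p) ^ i))"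
      by (simp only: of_nat_padic minus_padic_def uminus_padic.abs_eq plus_padic.abs_eq) simp
    ultimately show ?thesis
      by (subst padic_norm_le_power_iff[symmetric]) (simp only: padic_norm.abs_eq)
  qed
  then have "padic_expansion a (abs_padic Y)"
    unfolding padic_expansion_def by (simp add: a algebra_simps)
  then show ?thesis
    by blast
qed

lemma padic_sums_iff:
  fixes x :: "'p::prime_card padic"
  assumes "\<And>i. a i < CARD('p)"
  shows "(\<lambda>i. of_nat (a i) * P ^ i) sums x \<longleftrightarrow> padic_expansion a x"
proof -
  have sums: "(\<lambda>i. of_nat (a i) * P ^ i) sums y" if "padic_expansion a y" for y :: "'p padic"
    unfolding sums_def
  proof (rule metric_tendsto_imp_tendsto[OF inverse_prime_power_tendsto_0[where 'p = 'p]], intro always_eventually allI)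
    fix m
    have "padic_norm (y - (\<Sum>i<m. of_nat (a i) * P ^ i)) \<le> (1 / CARD('p)) ^ m"
      using that by (subst padic_norm_le_power_iff) (auto simp: padic_expansion_def algebra_simps)
    then show "dist (\<Sum>i<m. of_nat (a i) * P ^ i) y \<le> dist ((1 / real CARD('p)) ^ m) 0"
      by (simp add: dist_padic_def padic_norm_minus_commute[of _ y])
  qed
  \<comment> \<open>For the converse: some element has the expansion \<open>a\<close> and is the sum
    of the series, so uniqueness of limits identifies it with \<open>x\<close>.\<close>
  obtain y :: "'p padic" where "padic_expansion a y"
    using padic_expansion_realized assms by blast
  then show ?thesis
    using sums sums_unique2 by blast
qed

lemma padic_expansion_digits:
  assumes "(x :: 'p::prime_card padic) \<in> Zp"
  shows "padic_expansion (padic_digits x) x"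
proof -
  have "\<exists>!a. padic_expansion a x"
    using padic_expansion_exists[OF assms] padic_expansion_unique by blast
  moreover have "(\<lambda>a. (\<forall>i. a i < CARD('p)) \<and> (\<lambda>i. of_nat (a i) * P ^ i) sums x) = (\<lambda>a. padic_expansion a x)"
    using padic_sums_iff[where 'p = 'p] padic_expansion_less[where 'p = 'p] by (intro ext) metis
  ultimately show ?thesis
    unfolding padic_digits_def by (metis (no_types, lifting) theI')
qed

lemma padic_digits_eqI: "padic_expansion a x \<Longrightarrow> padic_digits x = a"
  by (rule padic_expansion_unique[OF padic_expansion_digits[OF padic_expansion_Zp]])

lemma padic_digits_less: "(x :: 'p padic) \<in> Zp \<Longrightarrow> padic_digits x i < CARD('p::prime_card)"
  by (rule padic_expansion_less[OF padic_expansion_digits])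

lemma padic_digits_shift:
  assumes "(x :: 'p::prime_card padic) \<in> Zp"
  obtains z where "z \<in> Zp" "x = of_nat (padic_digits x 0) + P * z" "\<forall>i. padic_digits z i = padic_digits x (Suc i)"
proof -
  obtain z where "z \<in> Zp" "x = of_nat (padic_digits x 0) + P * z" "padic_expansion (\<lambda>i. padic_digits x (Suc i)) z"
    using padic_expansion_shift[OF padic_expansion_digits[OF assms]] .
  then show ?thesis
    using that[of z] padic_digits_eqI[of _ z] by simp
qed

lemma padic_digits_cons:
  assumes "z \<in> Zp" "t < CARD('p)"
  shows "padic_digits (of_nat t + P * z :: 'p::prime_card padic) 0 = t"
    "padic_digits (of_nat t + P * z :: 'p padic) (Suc i) = padic_digits z i"
proof -
  have *: "of_nat t + P * z \<in> Zp"
    using assms(1) by blast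
  obtain w where w: "w \<in> Zp" "of_nat t + P * z = of_nat (padic_digits (of_nat t + P * z) 0) + P * w"
    "\<forall>i. padic_digits w i = padic_digits (of_nat t + P * z) (Suc i)"
    by (rule padic_digits_shift[OF *])
  note unique = Zp_first_digit_unique[OF assms(1) w(1) assms(2) padic_digits_less[OF *] w(2)]
  show "padic_digits (of_nat t + P * z :: 'p padic) 0 = t"
    by (rule unique(1)[symmetric])
  show "padic_digits (of_nat t + P * z :: 'p padic) (Suc i) = padic_digits z i"
    using w(3) unfolding unique(2)[symmetric] by metis
qed

text \<open>Balls of radius p^-m are the cylinders of depth m. If the first digits agree, removing
  them multiplies the distance by p; if they differ, the two numbers are incongruent modulo
  p.\<close>

lemma padic_digits_eq_iff_norm:
  assumes "x \<in> Zp" "(y :: 'p::prime_card padic) \<in> Zp"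
  shows "(\<forall>i<m. padic_digits x i = padic_digits y i) \<longleftrightarrow> padic_norm (x - y) \<le> (1 / CARD('p)) ^ m"
  using assms
proof (induction m arbitrary: x y)
  case 0
  then show ?case
    using Zp_diff[of x y] by (simp add: Zp_def)
next
  case (Suc m)
  obtain z where z: "z \<in> Zp" "x = of_nat (padic_digits x 0) + P * z" "\<forall>i. padic_digits z i = padic_digits x (Suc i)"
    by (rule padic_digits_shift[OF Suc.prems(1)])
  obtain w where w: "w \<in> Zp" "y = of_nat (padic_digits y 0) + P * w" "\<forall>i. padic_digits w i = padic_digits y (Suc i)"
    by (rule padic_digits_shift[OF Suc.prems(2)])
  have p: "real CARD('p) > 0"
    by simp
  obtain s t where st: "padic_digits x 0 = s" "padic_digits y 0 = t"
    by blast
  note xz = z(2)[unfolded st] and yw = w(2)[unfolded st]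
  show ?case
  proof (cases "s = t")
    case True
    then have "x - y = P * (z - w)"
      by (simp add: xz yw algebra_simps)
    then have "padic_norm (x - y) = padic_norm (z - w) / CARD('p)"
      by (simp add: padic_norm_mult padic_norm_prime)
    then have "padic_norm (x - y) \<le> (1 / CARD('p)) ^ Suc m \<longleftrightarrow> padic_norm (z - w) \<le> (1 / CARD('p)) ^ m"
      using p by (simp add: pos_divide_le_eq mult.commute)
    also have "\<dots> \<longleftrightarrow> (\<forall>i<m. padic_digits z i = padic_digits w i)"
      using Suc.IH[OF z(1) w(1)] by simp
    also have "\<dots> \<longleftrightarrow> (\<forall>i<Suc m. padic_digits x i = padic_digits y i)"
      using True st z(3) w(3) by (simp add: All_less_Suc2)
    finally show ?thesis
      by simp
  next
    case False
    have "\<not> padic_norm (x - y) \<le> (1 / CARD('p)) ^ Suc m"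
    proof
      assume "padic_norm (x - y) \<le> (1 / CARD('p)) ^ Suc m"
      then obtain v where "v \<in> Zp" "x - y = P ^ Suc m * v"
        unfolding padic_norm_le_power_iff by blast
      then have v: "P ^ m * v \<in> Zp" and eq: "of_nat s + P * z = of_nat t + P * (w + P ^ m * v)"
        unfolding xz yw by (auto simp: algebra_simps)
      then show False
        using Zp_first_digit_unique(1)[OF z(1) Zp_add[OF w(1) v] _ _ eq]
          padic_digits_less[OF Suc.prems(1), of 0] padic_digits_less[OF Suc.prems(2), of 0] False st by simp
    qed
    then show ?thesis
      using False st by blast
  qed
qed

lemma padic_digits_inject:
  assumes "x \<in> Zp" "y \<in> Zp" "padic_digits x = padic_digits y"
  shows "x = (y :: 'p::prime_card padic)"
proof -
  have "padic_norm (x - y) \<le> 0"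
    using assms padic_digits_eq_iff_norm[OF assms(1,2)]
    by (intro LIMSEQ_le_const[OF inverse_prime_power_tendsto_0[where 'p = 'p]]) auto
  then show ?thesis
    using padic_norm_nonneg[of "x - y"] padic_norm_eq_0[of "x - y"] by simp
qed

lemma decimation_Zp_digits:
  assumes "(x :: 'p::prime_card padic) \<in> Zp"
  shows "decimation j k x \<in> Zp" "padic_digits (decimation j k x) = (\<lambda>m. padic_digits x (j + m * k))"
proof -
  have less: "padic_digits x (j + m * k) < CARD('p)" for m
    using padic_digits_less[OF assms] .
  obtain y :: "'p padic" where y: "padic_expansion (\<lambda>m. padic_digits x (j + m * k)) y"
    using padic_expansion_realized[of "\<lambda>m. padic_digits x (j + m * k)", OF less] by auto
  then have "(\<lambda>m. of_nat (padic_digits x (j + m * k)) * P ^ m) sums y"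
    by (subst padic_sums_iff[OF less])
  then have "decimation j k x = y"
    unfolding decimation_def by (rule sums_unique[symmetric])
  then show "decimation j k x \<in> Zp" "padic_digits (decimation j k x) = (\<lambda>m. padic_digits x (j + m * k))"
    using padic_expansion_Zp[OF y] padic_digits_eqI[OF y] by simp_all
qed

lemma padic_residue_Zp:
  assumes "(x :: 'p::prime_card padic) \<in> Zp"
  shows "padic_residue m x < CARD('p) ^ m"
    "\<exists>y\<in>Zp. x - of_nat (padic_residue m x) = P ^ m * y"
proof -
  \<comment> \<open>The truncated expansion is the residue.\<close>
  define t where "t = (\<Sum>i<m. padic_digits x i * CARD('p) ^ i)"
  obtain z where z: "z \<in> Zp" "x = (\<Sum>i<m. of_nat (padic_digits x i) * P ^ i) + P ^ m * z"
    using padic_expansion_digits[OF assms] unfolding padic_expansion_def by blast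
  have less: "(\<Sum>i<m. padic_digits x i * CARD('p) ^ i) < CARD('p) ^ m"
  proof (induction m)
    case (Suc m)
    have "padic_digits x m + 1 \<le> CARD('p)"
      using padic_digits_less[OF assms, of m] by simp
    then have "(padic_digits x m + 1) * CARD('p) ^ m \<le> CARD('p) * CARD('p) ^ m"
      by (rule mult_right_mono) simp
    then show ?case
      using Suc by simp
  qed simp
  have ex: "t < CARD('p) ^ m \<and> (\<exists>y\<in>Zp. x - of_nat t = P ^ m * y)"
  proof (intro conjI bexI[OF _ z(1)])
    show "t < CARD('p) ^ m"
      using less by (simp add: t_def)
    show "x - of_nat t = P ^ m * z"
      using z(2) by (simp add: t_def diff_eq_eq add.commute)
  qed
  have "s = t" if s: "s < CARD('p) ^ m \<and> (\<exists>y\<in>Zp. x - of_nat s = P ^ m * y)" for s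
  proof -
    obtain y w where "y \<in> Zp" "w \<in> Zp" "x - of_nat s = P ^ m * y" "x - of_nat t = P ^ m * w"
      using s ex by blast
    then have "w - y \<in> Zp" "of_int (int s - int t) = P ^ m * (w - y)"
      by (auto simp: algebra_simps)
    then have "int CARD('p) ^ m dvd int s - int t"
      by (rule prime_power_times_Zp_of_int)
    then show ?thesis
      using s ex by (intro nat_eq_if_dvd_diff[of "CARD('p) ^ m"]) simp_all
  qed
  then have "\<exists>!s. s < CARD('p) ^ m \<and> (\<exists>y\<in>Zp. x - of_nat s = P ^ m * y)"
    using ex by blast
  then have "padic_residue m x < CARD('p) ^ m \<and> (\<exists>y\<in>Zp. x - of_nat (padic_residue m x) = P ^ m * y)"
    unfolding padic_residue_def by (rule theI')
  then show "padic_residue m x < CARD('p) ^ m" "\<exists>y\<in>Zp. x - of_nat (padic_residue m x) = P ^ m * y"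
    by (rule conjunct1, rule conjunct2)
qed

section \<open>Hausdorff dimension\<close>

lemma hausdorff_premeasure_le:
  assumes "A \<subseteq> (\<Union>i. U i)" "\<And>i. bounded (U i)" "\<And>i. diameter (U i) \<le> \<delta>"
  shows "hausdorff_premeasure s \<delta> A \<le> (\<Sum>i. ennreal (diameter (U i) powr s))"
  unfolding hausdorff_premeasure_def by (rule INF_lower) (use assms in auto)

lemma hausdorff_premeasure_le_finite_cover:
  assumes "finite \<U>" "A \<subseteq> \<Union>\<U>" "\<And>U. U \<in> \<U> \<Longrightarrow> bounded U \<and> diameter U \<le> r"
    and "0 \<le> r" "r \<le> \<delta>" "0 \<le> s"
  shows "hausdorff_premeasure s \<delta> A \<le> ennreal (card \<U> * r powr s)"
proof -
  obtain us where us: "set us = \<U>" "distinct us"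
    using finite_distinct_list[OF assms(1)] by blast
  \<comment> \<open>Padding with empty sets is free: their diameter is 0, and
    \<open>0 powr s\<close> is 0.\<close>
  define U where "U i = (if i < length us then us ! i else {})" for i
  have "hausdorff_premeasure s \<delta> A \<le> (\<Sum>i. ennreal (diameter (U i) powr s))"
  proof (rule hausdorff_premeasure_le)
    show "A \<subseteq> (\<Union>i. U i)"
    proof
      fix x
      assume "x \<in> A"
      then obtain i where "i < length us" "x \<in> us ! i"
        using assms(2) us(1) by (metis UnionE in_mono in_set_conv_nth)
      then show "x \<in> (\<Union>i. U i)"
        by (auto simp: U_def intro!: exI[of _ i])
    qed
    show "bounded (U i)" "diameter (U i) \<le> \<delta>" for i
      using assms(3)[of "us ! i"] assms(4,5) us(1) by (auto simp: U_def)
  qed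
  also have "\<dots> = (\<Sum>i<length us. ennreal (diameter (U i) powr s))"
    by (rule suminf_finite) (auto simp: U_def)
  also have "\<dots> \<le> (\<Sum>i<length us. ennreal (r powr s))"
    using assms(3,6) us(1)
    by (intro sum_mono ennreal_leI powr_mono2) (auto simp: U_def diameter_ge_0)
  also have "\<dots> = ennreal (card \<U> * r powr s)"
    using distinct_card[OF us(2)] us(1) by (simp add: ennreal_mult ennreal_of_nat_eq_real_of_nat)
  finally show ?thesis .
qed

lemma hausdorff_measure_eq_0_iff:
  "hausdorff_measure s A = 0 \<longleftrightarrow> (\<forall>\<delta>>0. hausdorff_premeasure s \<delta> A = 0)"
  unfolding hausdorff_measure_def bot_ennreal[symmetric] by (subst SUP_bot_conv) auto

lemma hausdorff_premeasure_mono: "A \<subseteq> B \<Longrightarrow> hausdorff_premeasure s \<delta> A \<le> hausdorff_premeasure s \<delta> B"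
  unfolding hausdorff_premeasure_def by (rule INF_superset_mono) auto

lemma hausdorff_measure_null_subset:
  "hausdorff_measure s B = 0 \<Longrightarrow> A \<subseteq> B \<Longrightarrow> hausdorff_measure s A = 0"
  unfolding hausdorff_measure_eq_0_iff using hausdorff_premeasure_mono by (metis le_zero_eq)

lemma hausdorff_measure_null_UN:
  assumes "\<And>n :: nat. hausdorff_measure s (A n) = 0"
  shows "hausdorff_measure s (\<Union>n. A n) = 0"
  unfolding hausdorff_measure_eq_0_iff
proof (intro allI impI)
  fix \<delta> :: real
  assume \<delta>: "\<delta> > 0"
  have "hausdorff_premeasure s \<delta> (\<Union>n. A n) \<le> ennreal e" if e: "e > 0" for e
  proof -
    \<comment> \<open>The n-th set is covered at cost at most e / 2^(n+1), so that the costs of the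
      double family add up to e.\<close>
    have "\<exists>U. A n \<subseteq> (\<Union>i. U i) \<and> (\<forall>i. bounded (U i) \<and> diameter (U i) \<le> \<delta>) \<and>
        (\<Sum>i. ennreal (diameter (U i) powr s)) \<le> ennreal (e * (1 / 2) ^ Suc n)" for n
    proof -
      have "hausdorff_premeasure s \<delta> (A n) < ennreal (e * (1 / 2) ^ Suc n)"
        using assms[of n] \<delta> e by (simp add: hausdorff_measure_eq_0_iff ennreal_zero_less_mult_iff)
      then obtain U where "A n \<subseteq> (\<Union>i. U i)" "\<forall>i. bounded (U i) \<and> diameter (U i) \<le> \<delta>"
          "(\<Sum>i. ennreal (diameter (U i) powr s)) < ennreal (e * (1 / 2) ^ Suc n)"
        unfolding hausdorff_premeasure_def INF_less_iff mem_Collect_eq by blast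
      then show ?thesis
        using less_imp_le by blast
    qed
    then have "\<exists>U. \<forall>n. A n \<subseteq> (\<Union>i. U n i) \<and> (\<forall>i. bounded (U n i) \<and> diameter (U n i) \<le> \<delta>) \<and>
        (\<Sum>i. ennreal (diameter (U n i) powr s)) \<le> ennreal (e * (1 / 2) ^ Suc n)"
      by (intro choice allI)
    then obtain U where U': "\<forall>n. A n \<subseteq> (\<Union>i. U n i) \<and> (\<forall>i. bounded (U n i) \<and> diameter (U n i) \<le> \<delta>) \<and>
        (\<Sum>i. ennreal (diameter (U n i) powr s)) \<le> ennreal (e * (1 / 2) ^ Suc n)" ..
    then have U: "A n \<subseteq> (\<Union>i. U n i)" "bounded (U n i)" "diameter (U n i) \<le> \<delta>"
        "(\<Sum>i. ennreal (diameter (U n i) powr s)) \<le> ennreal (e * (1 / 2) ^ Suc n)" for n i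
      by (auto dest!: spec[of _ n])
    define V where "V = (\<lambda>(n, i). U n i)"
    have "hausdorff_premeasure s \<delta> (\<Union>n. A n) \<le> (\<Sum>k. ennreal (diameter (V (prod_decode k)) powr s))"
    proof (rule hausdorff_premeasure_le)
      show "(\<Union>n. A n) \<subseteq> (\<Union>k. V (prod_decode k))"
      proof
        fix x
        assume "x \<in> (\<Union>n. A n)"
        then obtain n i where "x \<in> U n i"
          using U(1) by blast
        then have "x \<in> V (prod_decode (prod_encode (n, i)))"
          by (simp add: V_def)
        then show "x \<in> (\<Union>k. V (prod_decode k))"
          by blast
      qed
    qed (auto simp: V_def U split: prod.split)
    also have "\<dots> = (\<Sum>n. \<Sum>i. ennreal (diameter (U n i) powr s))"
      by (rule suminf_ennreal_2dimen[where f = "\<lambda>z. ennreal (diameter (V z) powr s)"]) (simp add: V_def)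
    also have "\<dots> \<le> (\<Sum>n. ennreal (e * (1 / 2) ^ Suc n))"
      by (intro suminf_le U(4)) auto
    also have "\<dots> = ennreal e"
      using sums_mult[OF power_half_series, of e] e
      by (intro suminf_ennreal_eq) auto
    finally show ?thesis .
  qed
  then have "hausdorff_premeasure s \<delta> (\<Union>n. A n) \<le> 0"
    by - (rule ennreal_le_epsilon, simp)
  then show "hausdorff_premeasure s \<delta> (\<Union>n. A n) = 0"
    by simp
qed

lemma hausdorff_measure_null_Un:
  assumes "hausdorff_measure s A = 0" "hausdorff_measure s B = 0"
  shows "hausdorff_measure s (A \<union> B) = 0"
proof -
  have "hausdorff_measure s (\<Union>n. if n = (0 :: nat) then A else B) = 0"
    by (rule hausdorff_measure_null_UN) (use assms in auto)
  then show ?thesis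
    by (rule hausdorff_measure_null_subset) (auto intro: exI[of _ 1])
qed

section \<open>Dimension bounds from null measures and from Hoelder maps\<close>

lemma hausdorff_dim_le:
  assumes "\<And>t. t > s \<Longrightarrow> hausdorff_measure t A = 0" "s \<ge> 0"
  shows "hausdorff_dim A \<le> ereal s"
proof (rule ereal_le_epsilon2)
  fix e :: real
  assume "e > 0"
  then have "hausdorff_dim A \<le> ereal (s + e)"
    unfolding hausdorff_dim_def using assms by (intro Inf_lower) force
  then show "hausdorff_dim A \<le> ereal s + ereal e"
    by simp
qed

lemma hausdorff_dim_nonneg: "0 \<le> hausdorff_dim A"
  unfolding hausdorff_dim_def by (rule Inf_greatest) auto

text \<open>Lebesgue measure on [0,1) takes the place of a mass distribution on \<open>A\<close>: a
  cover of \<open>A\<close> that is cheap for an exponent t < s is carried by \<open>f\<close> to a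
  cover of [0,1) by intervals of total length below 1.\<close>

lemma hausdorff_dim_ge_Hoelder:
  fixes f :: "'a::metric_space \<Rightarrow> real"
  assumes surj: "{0..<1} \<subseteq> f ` A" and "C > 0"
    and Hoelder: "\<And>x y. x \<in> A \<Longrightarrow> y \<in> A \<Longrightarrow> \<bar>f x - f y\<bar> \<le> C * dist x y powr s"
  shows "ereal s \<le> hausdorff_dim A"
proof -
  have "s \<le> t" if t: "t > 0" "hausdorff_measure t A = 0" for t
  proof (rule ccontr)
    assume "\<not> s \<le> t"
    then have "t < s"
      by simp
    \<comment> \<open>The budget fits because each covering set is sent into an interval of length
      2C times the t-th power of its diameter. The scale 1 keeps diameters at most 1, so that
      lowering the exponent from s to t does not decrease the power.\<close>
    have "hausdorff_premeasure t 1 A < ennreal (1 / (2 * C))"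
      using t(2) \<open>C > 0\<close> by (simp add: hausdorff_measure_eq_0_iff)
    then obtain U where U: "A \<subseteq> (\<Union>i. U i)" "\<And>i. bounded (U i)" "\<And>i. diameter (U i) \<le> 1"
        "(\<Sum>i. ennreal (diameter (U i) powr t)) < ennreal (1 / (2 * C))"
      unfolding hausdorff_premeasure_def INF_less_iff mem_Collect_eq by blast
    \<comment> \<open>The image itself need not be measurable, hence an enclosing interval.\<close>
    have "\<exists>J. f ` (U i \<inter> A) \<subseteq> J \<and> J \<in> sets lborel \<and> emeasure lborel J \<le> ennreal (2 * C) * ennreal (diameter (U i) powr t)" for i
    proof (cases "U i \<inter> A = {}")
      case True
      then show ?thesis
        by (intro exI[of _ "{}"]) auto
    next
      case False
      then obtain z where z: "z \<in> U i" "z \<in> A"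
        by blast
      define r where "r = C * diameter (U i) powr t"
      have "\<bar>f x - f z\<bar> \<le> r" if "x \<in> U i" "x \<in> A" for x
      proof -
        have "dist x z \<le> diameter (U i)"
          using diameter_bounded_bound[OF U(2)] that z by blast
        then have "dist x z powr s \<le> diameter (U i) powr s"
          using \<open>t < s\<close> \<open>t > 0\<close> by (intro powr_mono2) auto
        also have "\<dots> \<le> diameter (U i) powr t"
          using \<open>t < s\<close> U(3)[of i] diameter_ge_0[OF U(2), of i] by (intro powr_mono') auto
        finally have "C * dist x z powr s \<le> r"
          unfolding r_def using \<open>C > 0\<close> by (intro mult_left_mono) auto
        then show ?thesis
          using Hoelder[OF that(2) z(2)] by linarith
      qed
      then have "f ` (U i \<inter> A) \<subseteq> {f z - r..f z + r}"
        by (force simp: abs_le_iff)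
      moreover have "emeasure lborel {f z - r..f z + r} = ennreal (2 * C) * ennreal (diameter (U i) powr t)"
      proof -
        have "r \<ge> 0"
          using \<open>C > 0\<close> by (simp add: r_def)
        then have "emeasure lborel {f z - r..f z + r} = ennreal (2 * C * diameter (U i) powr t)"
          by (simp add: r_def)
        then show ?thesis
          using \<open>C > 0\<close> by (simp add: ennreal_mult)
      qed
      ultimately show ?thesis
        by (intro exI[of _ "{f z - r..f z + r}"]) simp
    qed
    then have "\<exists>J. \<forall>i. f ` (U i \<inter> A) \<subseteq> J i \<and> J i \<in> sets lborel \<and>
        emeasure lborel (J i) \<le> ennreal (2 * C) * ennreal (diameter (U i) powr t)"
      by (intro choice allI)
    then obtain J where "\<forall>i. f ` (U i \<inter> A) \<subseteq> J i \<and> J i \<in> sets lborel \<and>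
        emeasure lborel (J i) \<le> ennreal (2 * C) * ennreal (diameter (U i) powr t)" ..
    then have J: "f ` (U i \<inter> A) \<subseteq> J i" "J i \<in> sets lborel"
        "emeasure lborel (J i) \<le> ennreal (2 * C) * ennreal (diameter (U i) powr t)" for i
      by (auto dest!: spec[of _ i])
    have "{0..<1} \<subseteq> (\<Union>i. J i)"
    proof
      fix y :: real
      assume "y \<in> {0..<1}"
      then obtain x where x: "x \<in> A" "y = f x"
        using surj by blast
      then obtain i where "x \<in> U i"
        using U(1) by blast
      then show "y \<in> (\<Union>i. J i)"
        using J(1)[of i] x by blast
    qed
    then have "emeasure lborel {0..<1 :: real} \<le> emeasure lborel (\<Union>i. J i)"
      using J(2) by (intro emeasure_mono) auto
    also have "\<dots> \<le> (\<Sum>i. emeasure lborel (J i))"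
      using J(2) by (intro emeasure_subadditive_countably) auto
    also have "\<dots> \<le> (\<Sum>i. ennreal (2 * C) * ennreal (diameter (U i) powr t))"
      by (intro suminf_le J(3)) auto
    also have "\<dots> = ennreal (2 * C) * (\<Sum>i. ennreal (diameter (U i) powr t))"
      by (rule ennreal_suminf_cmult)
    also have "\<dots> < ennreal (2 * C) * ennreal (1 / (2 * C))"
      using U(4) \<open>C > 0\<close> by (intro ennreal_mult_strict_left_mono) auto
    also have "\<dots> = 1"
      using \<open>C > 0\<close> by (subst ennreal_mult[symmetric]) auto
    finally show False
      by simp
  qed
  then show ?thesis
    unfolding hausdorff_dim_def by (intro Inf_greatest) auto
qed

text \<open>The first M digits encode the floor of t N^M, so the partial sums equal this floor
  divided by N^M and lie within N^-M of t. The floor starts at 0 because t < 1.\<close>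

lemma radix_digit_sums:
  fixes t :: real
  assumes "0 \<le> t" "t < 1" "N \<ge> 2"
  shows "(\<lambda>m. real (nat (\<lfloor>t * real N ^ Suc m\<rfloor> mod int N)) / real N ^ Suc m) sums t"
proof -
  define F where "F M = \<lfloor>t * real N ^ M\<rfloor>" for M
  have N: "real N > 0"
    using assms(3) by simp
  have F_Suc: "F (Suc M) = int N * F M + F (Suc M) mod int N" for M
  proof -
    have "F M = \<lfloor>t * real N ^ Suc M / real_of_int (int N)\<rfloor>"
      using N by (simp add: F_def)
    also have "\<dots> = F (Suc M) div int N"
      unfolding F_def by (rule floor_divide_real_eq_div) simp
    finally show ?thesis
      by simp
  qed
  have partial: "(\<Sum>m<M. real (nat (F (Suc m) mod int N)) / real N ^ Suc m) = real_of_int (F M) / real N ^ M" for M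
  proof (induction M)
    case 0
    have "F 0 = 0"
      using assms by (simp add: F_def floor_eq_iff)
    then show ?case
      by simp
  next
    case (Suc M)
    have "real_of_int (F (Suc M)) = real N * real_of_int (F M) + real (nat (F (Suc M) mod int N))"
      using assms(3) by (subst F_Suc) simp
    then show ?case
      using Suc N by (simp add: field_simps)
  qed
  have "(\<lambda>M. t - (1 / real N) ^ M) \<longlonglongrightarrow> t - 0"
    using assms(3) by (intro tendsto_diff tendsto_const LIMSEQ_power_zero) auto
  then have lower: "(\<lambda>M. t - (1 / real N) ^ M) \<longlonglongrightarrow> t"
    by simp
  have "(\<lambda>M. real_of_int (F M) / real N ^ M) \<longlonglongrightarrow> t"
  proof (rule tendsto_sandwich[OF _ _ lower tendsto_const]; intro always_eventually allI)
    fix M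
    have "t * real N ^ M - 1 \<le> real_of_int (F M)" "real_of_int (F M) \<le> t * real N ^ M"
      unfolding F_def by linarith+
    then show "t - (1 / real N) ^ M \<le> real_of_int (F M) / real N ^ M" "real_of_int (F M) / real N ^ M \<le> t"
      using N by (simp_all add: pos_le_divide_eq pos_divide_le_eq power_one_over left_diff_distrib)
  qed
  then show ?thesis
    unfolding sums_def F_def[symmetric] partial .
qed

text \<open>Beyond the common prefix the difference is dominated by the tail with all digits N - 1,
  and that geometric tail equals N^-M.\<close>

lemma radix_series_agree:
  fixes a b :: "nat \<Rightarrow> nat"
  assumes "N \<ge> 2" "\<And>m. a m < N" "\<And>m. b m < N" "\<And>m. m < M \<Longrightarrow> a m = b m"
  shows "\<bar>(\<Sum>m. real (a m) / real N ^ Suc m) - (\<Sum>m. real (b m) / real N ^ Suc m)\<bar> \<le> (1 / real N) ^ M"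
proof -
  have N: "real N \<ge> 2"
    using assms(1) by simp
  have geo: "(\<lambda>m. (real N - 1) * (1 / real N) ^ Suc (m + M)) sums ((1 / real N) ^ M)"
  proof -
    have "(\<lambda>m. (real N - 1) * (1 / real N) ^ Suc M * (1 / real N) ^ m) sums
        ((real N - 1) * (1 / real N) ^ Suc M * (1 / (1 - 1 / real N)))"
      using N by (intro sums_mult geometric_sums) auto
    moreover have "(real N - 1) * (1 / real N) ^ Suc M * (1 / (1 - 1 / real N)) = (1 / real N) ^ M"
      using N by (simp add: field_simps)
    ultimately show ?thesis
      by (simp add: power_add algebra_simps)
  qed
  have bound: "real c / real N ^ Suc m \<le> (real N - 1) * (1 / real N) ^ Suc m" if "c < N" for c m
  proof -
    have "real c \<le> real N - 1"
      using that by linarith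
    then show ?thesis
      using N by (simp add: power_divide divide_right_mono)
  qed
  have summable: "summable (\<lambda>m. real (c m) / real N ^ Suc m)" if "\<And>m. c m < N" for c
  proof (rule summable_comparison_test')
    show "summable (\<lambda>m. (real N - 1) * (1 / real N) ^ Suc m)"
      using N by (intro summable_mult) (simp add: summable_geometric)
    show "norm (real (c m) / real N ^ Suc m) \<le> (real N - 1) * (1 / real N) ^ Suc m" for m
      using bound[OF that] by simp
  qed
  define D where "D m = real (a m) / real N ^ Suc m - real (b m) / real N ^ Suc m" for m
  have D_bound: "\<bar>D (m + M)\<bar> \<le> (real N - 1) * (1 / real N) ^ Suc (m + M)" for m
  proof -
    have "0 \<le> real (a (m + M)) / real N ^ Suc (m + M)" "0 \<le> real (b (m + M)) / real N ^ Suc (m + M)"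
      by simp_all
    then show ?thesis
      unfolding D_def using bound[OF assms(2)[of "m + M"], of "m + M"] bound[OF assms(3)[of "m + M"], of "m + M"]
      by linarith
  qed
  have "(\<Sum>m. real (a m) / real N ^ Suc m) - (\<Sum>m. real (b m) / real N ^ Suc m) = (\<Sum>m. D m)"
    unfolding D_def by (intro suminf_diff summable assms(2,3))
  also have "\<dots> = (\<Sum>m. D (m + M)) + (\<Sum>m<M. D m)"
    unfolding D_def by (intro suminf_split_initial_segment summable_diff summable assms(2,3))
  also have "(\<Sum>m<M. D m) = 0"
    by (rule sum.neutral) (simp add: D_def assms(4))
  finally have eq: "(\<Sum>m. real (a m) / real N ^ Suc m) - (\<Sum>m. real (b m) / real N ^ Suc m) = (\<Sum>m. D (m + M))"
    by simp
  have "\<bar>\<Sum>m. D (m + M)\<bar> \<le> (\<Sum>m. (real N - 1) * (1 / real N) ^ Suc (m + M))"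
    using norm_suminf_le[OF _ sums_summable[OF geo], of "\<lambda>m. D (m + M)"] D_bound
    by (simp only: real_norm_def)
  also have "\<dots> = (1 / real N) ^ M"
    using sums_unique[OF geo] by simp
  finally show ?thesis
    unfolding eq .
qed

lemma powr_ln_divide_ln: "x > 0 \<Longrightarrow> 1 < y \<Longrightarrow> y powr (ln x / ln y) = (x :: real)"
  by (simp add: powr_def)

lemma power_powr: "x > 0 \<Longrightarrow> (x ^ n) powr s = (x powr s) ^ n" for x :: real
  by (simp add: powr_def exp_of_nat_mult[symmetric] ln_realpow algebra_simps)

text \<open>Reading the digits from place \<open>m0\<close> on in base \<open>card E\<close> maps
  \<open>A\<close> onto [0,1). Each further common digit divides the distance by p and the bound in
  the image by \<open>card E\<close>, whence the exponent.\<close>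

lemma hausdorff_dim_ge_digits:
  fixes A :: "'p::prime_card padic set" and E :: "nat set"
  assumes "A \<subseteq> Zp" "finite E" "E \<noteq> {}"
    and free: "\<And>e. (\<And>m. e m \<in> E) \<Longrightarrow> \<exists>z\<in>A. \<forall>m. padic_digits z (m0 + m) = e m"
  shows "ereal (ln (card E) / ln CARD('p)) \<le> hausdorff_dim A"
proof -
  define N where "N = card E"
  define s where "s = ln (real N) / ln CARD('p)"
  have p: "1 < real CARD('p)"
    using one_less_prime_card[where 'p = 'p] by simp
  have "N \<noteq> 0"
    using assms(2,3) by (simp add: N_def)
  show ?thesis
  \<comment> \<open>A single digit admits no radix expansion, but the claimed bound is then
    0.\<close>
  proof (cases "N = 1")
    case True
    then show ?thesis
      using hausdorff_dim_nonneg[of A] by (simp add: N_def zero_ereal_def)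
  next
    case False
    then have N: "N \<ge> 2"
      using \<open>N \<noteq> 0\<close> by simp
    obtain g where g: "bij_betw g E {..<N}"
      using ex_bij_betw_finite_nat[OF assms(2)] by (auto simp: N_def lessThan_atLeast0)
    \<comment> \<open>Digits outside \<open>E\<close> may occur in \<open>A\<close> and are read as
      0: the Hoelder estimate only asks that equal digits be read equally.\<close>
    define c where "c z m = (if padic_digits z (m0 + m) \<in> E then g (padic_digits z (m0 + m)) else 0)" for z :: "'p padic" and m
    have c_less: "c z m < N" for z m
      using bij_betwE[OF g] N by (auto simp: c_def)
    define f where "f z = (\<Sum>m. real (c z m) / real N ^ Suc m)" for z
    have "ereal s \<le> hausdorff_dim A"
    \<comment> \<open>A first difference at place \<open>l\<close> gives distance above p^-(l+1),
      but only \<open>l - m0\<close> common digits that are read: a loss of at most m0 + 1 factors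
      N. For l < m0 the truncated difference is 0, and the trivial bound 1 is still good
      enough.\<close>
    proof (rule hausdorff_dim_ge_Hoelder[where f = f and C = "real N ^ Suc m0"])
      show "{0..<1} \<subseteq> f ` A"
      proof
        fix t :: real
        assume "t \<in> {0..<1}"
        then have t: "(\<lambda>m. real (nat (\<lfloor>t * real N ^ Suc m\<rfloor> mod int N)) / real N ^ Suc m) sums t"
          using N by (intro radix_digit_sums) auto
        define r where "r m = nat (\<lfloor>t * real N ^ Suc m\<rfloor> mod int N)" for m
        have r: "r m < N" for m
          using N by (simp add: r_def nat_less_iff)
        define e where "e m = inv_into E g (r m)" for m
        have e: "e m \<in> E" "g (e m) = r m" for m
          using r[of m] g inv_into_into[of "r m" g E] f_inv_into_f[of "r m" g E]
          by (auto simp: e_def bij_betw_def)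
        obtain z where z: "z \<in> A" "\<forall>m. padic_digits z (m0 + m) = e m"
          using free[of e] e(1) by blast
        then have "c z m = r m" for m
          using e by (simp add: c_def)
        then have "f z = t"
          using sums_unique[OF t] by (simp add: f_def r_def)
        then show "t \<in> f ` A"
          using z(1) by blast
      qed
      show "0 < real N ^ Suc m0"
        using N by simp
      fix x y
      assume xy: "x \<in> A" "y \<in> A"
      show "\<bar>f x - f y\<bar> \<le> real N ^ Suc m0 * dist x y powr s"
      proof (cases "x = y")
        case False
        then have ex: "\<exists>i. padic_digits x i \<noteq> padic_digits y i"
          using padic_digits_inject[of x y] xy assms(1) by blast
        define l where "l = (LEAST i. padic_digits x i \<noteq> padic_digits y i)"
        have l: "padic_digits x l \<noteq> padic_digits y l" "\<And>i. i < l \<Longrightarrow> padic_digits x i = padic_digits y i"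
          using LeastI_ex[OF ex] not_less_Least unfolding l_def by blast+
        have "\<not> padic_norm (x - y) \<le> (1 / CARD('p)) ^ Suc l"
          using padic_digits_eq_iff_norm[of x y "Suc l"] l(1) xy assms(1) by blast
        then have "((1 / CARD('p)) ^ Suc l) powr s \<le> dist x y powr s"
          using N p by (intro powr_mono2) (auto simp: dist_padic_def s_def)
        moreover have "((1 / CARD('p)) ^ Suc l) powr s = (1 / real N) ^ Suc l"
        proof -
          have "((1 / CARD('p)) ^ Suc l) powr s = ((1 / CARD('p)) powr s) ^ Suc l"
            using p by (intro power_powr) simp
          then show ?thesis
            using p N by (simp add: powr_divide s_def powr_ln_divide_ln)
        qed
        ultimately have *: "(1 / real N) ^ Suc l \<le> dist x y powr s"
          by simp
        have "\<bar>f x - f y\<bar> \<le> (1 / real N) ^ (l - m0)"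
          unfolding f_def by (rule radix_series_agree[OF N c_less c_less]) (simp add: c_def l(2))
        also have "\<dots> = real N ^ Suc m0 * (1 / real N) ^ (Suc m0 + (l - m0))"
          using N by (simp add: power_add power_divide)
        also have "\<dots> \<le> real N ^ Suc m0 * (1 / real N) ^ Suc l"
          using N by (intro mult_left_mono power_decreasing) auto
        also have "\<dots> \<le> real N ^ Suc m0 * dist x y powr s"
          using * by (intro mult_left_mono) auto
        finally show ?thesis .
      qed simp
    qed
    then show ?thesis
      by (simp add: s_def N_def)
  qed
qed

section \<open>Upper bounds by counting cylinders\<close>

lemma diameter_le_if_dist_le:
  assumes "0 \<le> r" "\<And>x y. x \<in> U \<Longrightarrow> y \<in> U \<Longrightarrow> dist x y \<le> r"
  shows "diameter U \<le> r"
  unfolding diameter_def using assms by (auto intro!: cSUP_least)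

text \<open>With the first \<open>M\<close> digits free and the next L in \<open>E\<close>, p^M
  (#E)^L cylinders cover the set. Since #E < p^t, their total cost tends to 0 as L grows.\<close>

lemma hausdorff_measure_eventual_digits_null:
  fixes E :: "nat set"
  assumes E: "finite E" "E \<noteq> {}" and t: "ln (card E) / ln CARD('p::prime_card) < t"
  shows "hausdorff_measure t {x :: 'p padic. x \<in> Zp \<and> (\<forall>i\<ge>M. padic_digits x i \<in> E)} = 0"
  unfolding hausdorff_measure_eq_0_iff
proof (intro allI impI)
  let ?G = "{x :: 'p padic. x \<in> Zp \<and> (\<forall>i\<ge>M. padic_digits x i \<in> E)}"
  fix \<delta> :: real
  assume \<delta>: "\<delta> > 0"
  have p: "1 < real CARD('p)"
    using one_less_prime_card[where 'p = 'p] by simp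
  have N: "card E \<ge> 1"
    using E by (simp add: Suc_le_eq card_gt_0_iff)
  then have "0 \<le> ln (real (card E)) / ln CARD('p)"
    using p by simp
  then have "t > 0"
    using t by linarith
  \<comment> \<open>The factor by which one more digit changes the cost: #E times as many sets, each
    weighted by a further p^-t.\<close>
  define q where "q = real (card E) * (1 / CARD('p)) powr t"
  have "real (card E) = CARD('p) powr (ln (card E) / ln CARD('p))"
    using N p by (simp add: powr_ln_divide_ln)
  also have "\<dots> < CARD('p) powr t"
    using t p by (intro powr_less_mono) auto
  finally have q: "0 \<le> q" "q < 1"
    using p by (simp_all add: q_def powr_divide)
  have bound: "hausdorff_premeasure t \<delta> ?G \<le> ennreal (real CARD('p) ^ M * q ^ L)"
    if L: "(1 / CARD('p)) ^ L \<le> \<delta>" for L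
  proof -
    define r where "r = (1 / real CARD('p)) ^ (M + L)"
    define cyl where "cyl = (\<lambda>(xs, ys). {x :: 'p padic. x \<in> Zp \<and> (\<forall>i<M. padic_digits x i = xs ! i) \<and> (\<forall>i<L. padic_digits x (M + i) = ys ! i)})"
    define W where "W = {xs. set xs \<subseteq> {..<CARD('p)} \<and> length xs = M} \<times> {ys. set ys \<subseteq> E \<and> length ys = L}"
    have r: "0 \<le> r" "r \<le> (1 / CARD('p)) ^ L"
      using p by (auto simp: r_def intro!: power_decreasing)
    have finW: "finite W" and cardW: "card W = CARD('p) ^ M * card E ^ L"
      using E(1) by (simp_all add: W_def finite_lists_length_eq card_lists_length_eq card_cartesian_product)
    have "hausdorff_premeasure t \<delta> ?G \<le> ennreal (card (cyl ` W) * r powr t)"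
    proof (rule hausdorff_premeasure_le_finite_cover)
      show "finite (cyl ` W)"
        using finW by simp
      show "?G \<subseteq> \<Union> (cyl ` W)"
      proof
        fix x
        assume x: "x \<in> ?G"
        have "(map (padic_digits x) [0..<M], map (\<lambda>i. padic_digits x (M + i)) [0..<L]) \<in> W"
          using x padic_digits_less[of x] by (auto simp: W_def)
        moreover have "x \<in> cyl (map (padic_digits x) [0..<M], map (\<lambda>i. padic_digits x (M + i)) [0..<L])"
          using x by (simp add: cyl_def)
        ultimately show "x \<in> \<Union> (cyl ` W)"
          by blast
      qed
      show "bounded U \<and> diameter U \<le> r" if "U \<in> cyl ` W" for U
      proof -
        have dist: "dist x y \<le> r" if xy: "x \<in> U" "y \<in> U" for x y
        proof -
          obtain xs ys where U: "U = cyl (xs, ys)"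
            using \<open>U \<in> cyl ` W\<close> by auto
          have *: "x \<in> Zp" "y \<in> Zp"
            using xy by (auto simp: U cyl_def)
          have "padic_digits x i = padic_digits y i" if "i < M + L" for i
          proof (cases "i < M")
            case True
            then show ?thesis
              using xy by (simp add: U cyl_def)
          next
            case False
            then have "i = M + (i - M)" "i - M < L"
              using that by auto
            then show ?thesis
              using xy by (metis (mono_tags, lifting) U cyl_def case_prod_conv mem_Collect_eq)
          qed
          then show ?thesis
            using padic_digits_eq_iff_norm[OF *, of "M + L"] by (simp add: r_def dist_padic_def)
        qed
        then show ?thesis
          using diameter_le_if_dist_le[OF r(1), of U] dist by (auto simp: bounded_two_points)
      qed
      show "0 \<le> r" "r \<le> \<delta>" "0 \<le> t"
        using r L \<open>t > 0\<close> by linarith+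
    qed
    \<comment> \<open>Of the diameter bound p^-(M+L) only p^-L is kept; the factor given away is
      constant in \<open>L\<close>.\<close>
    also have "\<dots> \<le> ennreal (card W * (1 / CARD('p) ^ L) powr t)"
      using r finW \<open>t > 0\<close> by (intro ennreal_leI mult_mono powr_mono2) (auto simp: card_image_le power_divide)
    also have "real (card W) * (1 / CARD('p) ^ L) powr t = real CARD('p) ^ M * q ^ L"
    proof -
      have "(1 / real CARD('p) ^ L) powr t = ((1 / CARD('p)) powr t) ^ L"
        using p power_powr[of "1 / real CARD('p)" L t] by (simp add: power_divide)
      then show ?thesis
        by (simp add: cardW q_def power_mult_distrib)
    qed
    finally show ?thesis .
  qed
  have "hausdorff_premeasure t \<delta> ?G \<le> 0 + ennreal e" if "e > 0" for e
  proof -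
    have "(\<lambda>L. real CARD('p) ^ M * q ^ L) \<longlonglongrightarrow> real CARD('p) ^ M * 0"
      using q by (intro tendsto_mult tendsto_const LIMSEQ_power_zero) auto
    then have "\<forall>\<^sub>F L in sequentially. real CARD('p) ^ M * q ^ L < e"
      using \<open>e > 0\<close> by (intro order_tendstoD(2)) auto
    moreover have "\<forall>\<^sub>F L in sequentially. (1 / CARD('p)) ^ L < \<delta>"
      using \<delta> by (intro order_tendstoD(2)[OF inverse_prime_power_tendsto_0])
    ultimately have "\<forall>\<^sub>F L in sequentially. real CARD('p) ^ M * q ^ L < e \<and> (1 / CARD('p)) ^ L < \<delta>"
      by eventually_elim simp
    then obtain L where "real CARD('p) ^ M * q ^ L < e" "(1 / CARD('p)) ^ L < \<delta>"
      by (auto simp: eventually_sequentially)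
    then have "hausdorff_premeasure t \<delta> ?G \<le> ennreal (real CARD('p) ^ M * q ^ L)" "ennreal (real CARD('p) ^ M * q ^ L) \<le> ennreal e"
      using bound[of L] by (auto intro: ennreal_leI)
    then show ?thesis
      by simp
  qed
  then have "hausdorff_premeasure t \<delta> ?G \<le> 0"
    by - (rule ennreal_le_epsilon, simp)
  then show "hausdorff_premeasure t \<delta> ?G = 0"
    by simp
qed

lemma hausdorff_dim_le_eventual_digits:
  fixes A :: "'p::prime_card padic set" and E :: "nat set"
  assumes "A \<subseteq> Zp" "finite E" "E \<noteq> {}"
    and digits: "\<And>x. x \<in> A \<Longrightarrow> \<exists>M. (\<forall>i\<ge>M. padic_digits x i \<in> E) \<or> (\<exists>a. \<forall>i\<ge>M. padic_digits x i = a)"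
  shows "hausdorff_dim A \<le> ereal (ln (card E) / ln CARD('p))"
proof (rule hausdorff_dim_le)
  have "card E \<ge> 1"
    using assms(2,3) by (simp add: Suc_le_eq card_gt_0_iff)
  then show nonneg: "0 \<le> ln (card E) / ln CARD('p)"
    using one_less_prime_card[where 'p = 'p] by simp
  fix t
  assume t: "ln (card E) / ln CARD('p) < t"
  define G where "G E' = (\<Union>M. {x :: 'p padic. x \<in> Zp \<and> (\<forall>i\<ge>M. padic_digits x i \<in> E')})" for E'
  have null: "hausdorff_measure t (G E') = 0"
    if "finite E'" "E' \<noteq> {}" "ln (card E') / ln CARD('p) < t" for E'
    unfolding G_def by (intro hausdorff_measure_null_UN hausdorff_measure_eventual_digits_null that)
  \<comment> \<open>One letter has exponent ln 1 / ln p = 0, which is below \<open>t\<close>, so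
    eventually constant expansions are negligible whatever the constant.\<close>
  have "hausdorff_measure t (G {a}) = 0" for a
    by (rule null) (use t nonneg in \<open>simp_all\<close>)
  then have "hausdorff_measure t (G E \<union> (\<Union>a. G {a})) = 0"
    by (intro hausdorff_measure_null_Un hausdorff_measure_null_UN null[OF assms(2,3) t])
  moreover have "A \<subseteq> G E \<union> (\<Union>a. G {a})"
  proof
    fix x
    assume x: "x \<in> A"
    then have "x \<in> Zp"
      using assms(1) by blast
    then show "x \<in> G E \<union> (\<Union>a. G {a})"
      using digits[OF x] unfolding G_def by blast
  qed
  ultimately show "hausdorff_measure t A = 0"
    by (rule hausdorff_measure_null_subset)
qed

section \<open>Digits and addition of integers\<close>

lemma padic_digits_0: "padic_digits (0 :: 'p::prime_card padic) i = 0"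
proof (induction i)
  case 0
  then show ?case
    using padic_digits_cons(1)[of "0 :: 'p padic" 0] Zp_of_nat[of 0, where 'a = 'p] by simp
next
  case (Suc i)
  then show ?case
    using padic_digits_cons(2)[of "0 :: 'p padic" 0 i] Zp_of_nat[of 0, where 'a = 'p] by simp
qed

lemma of_nat_prime_card_minus_1: "of_nat (CARD('p) - 1) = (P - 1 :: 'p::prime_card padic)"
  by (subst of_nat_diff) (simp_all add: Suc_leI)

lemma padic_digits_minus_1: "padic_digits (- 1 :: 'p::prime_card padic) i = CARD('p) - 1"
proof (induction i)
  have *: "- 1 = of_nat (CARD('p) - 1) + P * (- 1 :: 'p padic)"
    by (simp only: of_nat_prime_card_minus_1) simp
  have Zp: "(- 1 :: 'p padic) \<in> Zp"
    using Zp_of_int[of "- 1", where 'a = 'p] by simp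
  {
    case 0
    show ?case
      using padic_digits_cons(1)[OF Zp, of "CARD('p) - 1"] *[symmetric] by simp
  next
    case (Suc i)
    then show ?case
      using padic_digits_cons(2)[OF Zp, of "CARD('p) - 1" i] *[symmetric] by simp
  }
qed

text \<open>The carry turns initial digits p - 1 into 0 and stops at the first other digit; only -1
  has none. The induction runs over the index of some digit different from p - 1.\<close>

lemma eventually_padic_digits_add_1:
  assumes "(z :: 'p::prime_card padic) \<in> Zp"
  shows "(\<exists>M. \<forall>i\<ge>M. padic_digits (z + 1) i = padic_digits z i) \<or> z = - 1"
proof (cases "\<exists>i. padic_digits z i \<noteq> CARD('p) - 1")
  case True
  then obtain i where "padic_digits z i \<noteq> CARD('p) - 1"
    by blast
  then have "\<exists>M. \<forall>i\<ge>M. padic_digits (z + 1) i = padic_digits z i"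
    using assms
  proof (induction i arbitrary: z)
    case 0
    obtain w where w: "w \<in> Zp" "z = of_nat (padic_digits z 0) + P * w" "\<forall>i. padic_digits w i = padic_digits z (Suc i)"
      by (rule padic_digits_shift[OF 0(2)])
    obtain a where a: "padic_digits z 0 = a"
      by blast
    have "a + 1 < CARD('p)"
      using 0 padic_digits_less[OF 0(2), of 0] a by simp
    moreover have eq: "z + 1 = of_nat (a + 1) + P * w"
      using w(2)[unfolded a] by simp
    ultimately have "padic_digits (z + 1) (Suc i) = padic_digits z (Suc i)" for i
      unfolding eq using padic_digits_cons(2)[OF w(1), of "a + 1" i] w(3) by metis
    then have "\<forall>i\<ge>1. padic_digits (z + 1) i = padic_digits z i"
      by (metis Suc_le_D One_nat_def)
    then show ?case
      by blast
  next
    case (Suc i)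
    obtain w where w: "w \<in> Zp" "z = of_nat (padic_digits z 0) + P * w" "\<forall>i. padic_digits w i = padic_digits z (Suc i)"
      by (rule padic_digits_shift[OF Suc.prems(2)])
    obtain a where a: "padic_digits z 0 = a"
      by blast
    have less: "a < CARD('p)"
      using padic_digits_less[OF Suc.prems(2), of 0] a by simp
    obtain M where M: "\<forall>i\<ge>M. padic_digits (w + 1) i = padic_digits w i"
      using Suc.IH[of w] Suc.prems(1) w(1,3) by auto
    \<comment> \<open>Either the carry passes on to \<open>w\<close>, or the digit \<open>a\<close>
      absorbs it and \<open>w\<close> is unchanged; in both cases the new tail agrees with
      \<open>w\<close> from \<open>M\<close> on.\<close>
    have "\<exists>v\<in>Zp. \<exists>c<CARD('p). z + 1 = of_nat c + P * v \<and> (\<forall>i\<ge>M. padic_digits v i = padic_digits w i)"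
    proof (cases "a = CARD('p) - 1")
      case True
      then have "of_nat a + 1 = (P :: 'p padic)"
        by (simp only: of_nat_prime_card_minus_1) simp
      then have "z + 1 = of_nat 0 + P * (w + 1)"
        using w(2)[unfolded a] by (simp add: algebra_simps)
      moreover have "w + 1 \<in> Zp"
        using Zp_add[OF w(1) Zp_of_nat[of 1]] by simp
      ultimately show ?thesis
        using M prime_card_nonzero(2)[where 'p = 'p] by blast
    next
      case False
      then have "z + 1 = of_nat (a + 1) + P * w" "a + 1 < CARD('p)"
        using w(2)[unfolded a] less by simp_all
      then show ?thesis
        using w(1) by blast
    qed
    then obtain v c where v: "v \<in> Zp" "c < CARD('p)" "z + 1 = of_nat c + P * v"
        "\<forall>i\<ge>M. padic_digits v i = padic_digits w i"
      by blast
    have "padic_digits (z + 1) (Suc i) = padic_digits z (Suc i)" if "i \<ge> M" for i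
      unfolding v(3) using padic_digits_cons(2)[OF v(1,2), of i] v(4) w(3) that by metis
    then have "\<forall>i\<ge>Suc M. padic_digits (z + 1) i = padic_digits z i"
      by (metis Suc_le_D Suc_le_mono)
    then show ?case
      by blast
  qed
  then show ?thesis
    by blast
next
  case False
  then have "padic_digits z = padic_digits (- 1 :: 'p padic)"
    by (intro ext) (simp add: padic_digits_minus_1)
  then show ?thesis
    using padic_digits_inject[OF assms, of "- 1"] Zp_of_int[of "- 1", where 'a = 'p] by simp
qed

text \<open>For iterating a unit step: the step from \<open>g\<close> to \<open>h\<close> must be a
  genuine agreement, while a constant tail already reached by \<open>g\<close> is inherited by
  \<open>h\<close>.\<close>

lemma eventually_eq_or_const_trans:
  fixes f g h :: "nat \<Rightarrow> 'a"
  assumes hg: "\<forall>i\<ge>M. h i = g i" and gf: "\<exists>M. (\<forall>i\<ge>M. g i = f i) \<or> (\<exists>a. \<forall>i\<ge>M. g i = a)"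
  shows "\<exists>M. (\<forall>i\<ge>M. h i = f i) \<or> (\<exists>a. \<forall>i\<ge>M. h i = a)"
proof -
  obtain M' where "(\<forall>i\<ge>M'. g i = f i) \<or> (\<exists>a. \<forall>i\<ge>M'. g i = a)"
    using gf by blast
  then show ?thesis
  proof (elim disjE exE)
    assume "\<forall>i\<ge>M'. g i = f i"
    then have "\<forall>i\<ge>max M M'. h i = f i"
      using hg by simp
    then show ?thesis
      by blast
  next
    fix a
    assume "\<forall>i\<ge>M'. g i = a"
    then have "\<forall>i\<ge>max M M'. h i = a"
      using hg by simp
    then show ?thesis
      by blast
  qed
qed

lemma eventually_padic_digits_add_of_int:
  assumes "(z :: 'p::prime_card padic) \<in> Zp"
  shows "\<exists>M. (\<forall>i\<ge>M. padic_digits (z + of_int m) i = padic_digits z i) \<or>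
    (\<exists>a. \<forall>i\<ge>M. padic_digits (z + of_int m) i = a)"
proof (induction m rule: int_induct[where k = 0])
  case base
  then show ?case
    by simp
next
  case (step1 m)
  define y where "y = z + of_int m"
  have y: "y \<in> Zp" "z + of_int (m + 1) = y + 1"
    using assms by (auto simp: y_def)
  from eventually_padic_digits_add_1[OF y(1)] show ?case
  proof (elim disjE exE)
    fix M
    assume M: "\<forall>i\<ge>M. padic_digits (y + 1) i = padic_digits y i"
    show ?thesis
      unfolding y(2) by (rule eventually_eq_or_const_trans[of M _ "padic_digits y"])
        (use M step1.IH in \<open>simp_all only: y_def\<close>)
  next
    assume "y = - 1"
    then show ?thesis
      unfolding y(2) by (auto simp: padic_digits_0)
  qed
next
  case (step2 m)
  define y where "y = z + of_int m"
  \<comment> \<open>Going down, the carry lemma is applied to \<open>y - 1\<close>. Its exceptional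
    case is y = 0, where the result -1 has all digits p - 1.\<close>
  have y: "y - 1 \<in> Zp" "z + of_int (m - 1) = y - 1"
    using assms Zp_diff[of y 1] Zp_of_nat[of 1, where 'a = 'p] by (auto simp: y_def)
  from eventually_padic_digits_add_1[OF y(1)] show ?case
  proof (elim disjE exE)
    fix M
    assume M: "\<forall>i\<ge>M. padic_digits (y - 1 + 1) i = padic_digits (y - 1) i"
    have "\<forall>i\<ge>M. padic_digits (y - 1) i = padic_digits y i"
      using M[unfolded diff_add_cancel] by metis
    then show ?thesis
      unfolding y(2) by (rule eventually_eq_or_const_trans) (use step2.IH in \<open>simp only: y_def\<close>)
  next
    assume "y - 1 = - 1"
    then show ?thesis
      unfolding y(2) by (auto simp: padic_digits_minus_1)
  qed
qed

section \<open>Paths in automata\<close>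

lemma nfa_path_append:
  "nfa_path S \<E> q w q' \<Longrightarrow> nfa_path S \<E> q' w' q'' \<Longrightarrow> nfa_path S \<E> q (w @ w') q''"
  by (induction rule: nfa_path.induct) (auto intro: nfa_path.intros)

lemma nfa_path_mono: "nfa_path S \<E> q w q' \<Longrightarrow> S \<subseteq> S' \<Longrightarrow> nfa_path S' \<E> q w q'"
  by (induction rule: nfa_path.induct) (auto intro: nfa_path.intros)

lemma nfa_path_end: "nfa_path S \<E> q w q' \<Longrightarrow> q' \<in> S"
  by (induction rule: nfa_path.induct)

lemma nfa_path_start: "nfa_path S \<E> q w q' \<Longrightarrow> q \<in> S"
  by (induction rule: nfa_path.induct)

lemma essential_class_subset: "essential_class Q \<E> EC \<Longrightarrow> EC \<subseteq> Q"
  by (simp add: essential_class_def)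

lemma essential_class_closed:
  assumes "essential_class Q \<E> EC" "q \<in> EC" "nfa_path Q \<E> q w q'"
  shows "q' \<in> EC"
proof -
  have "\<forall>q\<in>EC. \<forall>w q'. nfa_path Q \<E> q w q' \<longrightarrow> q' \<in> EC"
    using assms(1) by (simp add: essential_class_def)
  then show ?thesis
    using assms(2,3) by blast
qed

lemma essential_class_step:
  assumes "essential_class Q \<E> EC" "q \<in> EC" "\<E> q a q'" "q' \<in> Q"
  shows "q' \<in> EC"
proof -
  have "nfa_path Q \<E> q [a] q'"
    using essential_class_subset[OF assms(1)] assms(2-4) by (auto intro: nfa_path.intros)
  then show ?thesis
    by (rule essential_class_closed[OF assms(1,2)])
qed

lemma essential_class_path:
  assumes "essential_class Q \<E> EC" "q \<in> EC" "q' \<in> EC"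
  obtains w where "nfa_path Q \<E> q w q'"
proof -
  have "internally_connected \<E> EC"
    using assms(1) by (simp add: essential_class_def)
  then obtain w where "nfa_path EC \<E> q w q'"
    using assms(2,3) unfolding internally_connected_def by blast
  then show ?thesis
    using that nfa_path_mono essential_class_subset[OF assms(1)] by metis
qed

text \<open>A path that starts in an essential class never leaves it, so each of its letters labels
  an edge inside the class.\<close>

lemma essential_class_letter:
  assumes "nfa_path Q \<E> q w q'" "essential_class Q \<E> EC" "q \<in> EC" "a \<in> set w"
  shows "\<exists>r\<in>EC. \<exists>r'\<in>EC. \<E> r a r'"
  using assms
proof (induction rule: nfa_path.induct)
  case (Cons q c q' w q'')
  have "q' \<in> EC"
    using essential_class_step[OF Cons.prems(1,2) Cons.hyps(2)] nfa_path_start[OF Cons.hyps(3)] .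
  then show ?case
    using Cons by auto
qed simp

section \<open>Loops of every large length with a prescribed letter\<close>

lemma frobenius_two:
  fixes a b :: nat
  assumes "coprime a b"
  shows "\<exists>L. \<forall>m\<ge>L. \<exists>x y. m = x * a + y * b"
proof (cases "a = 0")
  case True
  then show ?thesis
    using assms by auto
next
  case False
  obtain u v where uv: "u * int a + v * int b = 1"
    using bezout_int[of "int a" "int b"] assms by auto
  \<comment> \<open>Since \<open>v\<close> inverts \<open>b\<close> modulo \<open>a\<close>, the
    residue y of m v modulo \<open>a\<close> makes m - y b divisible by \<open>a\<close>; y < a and
    m >= a b keep it nonnegative.\<close>
  have "\<exists>x y. m = x * a + y * b" if "m \<ge> a * b" for m
  proof -
    define y where "y = nat (int m * v mod int a)"
    have y: "int y = int m * v mod int a" "y < a"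
      using False by (simp_all add: y_def nat_less_iff)
    have "y * b \<le> m"
      using y(2) that by (meson le_trans less_imp_le mult_le_mono1)
    have "int m - int y * int b = int m * (u * int a + v * int b) - (int m * v - int a * (int m * v div int a)) * int b"
      unfolding y(1) uv by (simp add: minus_mult_div_eq_mod)
    also have "\<dots> = int a * (int m * u + (int m * v div int a) * int b)"
      by (simp add: algebra_simps)
    finally have "int a dvd int (m - y * b)"
      using \<open>y * b \<le> m\<close> by (simp add: of_nat_diff)
    then obtain x where "m - y * b = x * a"
      by (metis dvdE int_dvd_int_iff mult.commute)
    then show ?thesis
      using \<open>y * b \<le> m\<close> by (intro exI[of _ x] exI[of _ y]) simp
  qed
  then show ?thesis
    by blast
qed

lemma nfa_loop_power:
  assumes "nfa_path S \<E> q u q"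
  shows "\<exists>w. nfa_path S \<E> q w q \<and> length w = x * length u"
proof (induction x)
  case 0
  then show ?case
    using nfa_path.Nil nfa_path_start[OF assms] by fastforce
next
  case (Suc x)
  then obtain w where "nfa_path S \<E> q w q" "length w = x * length u"
    by blast
  then show ?case
    using nfa_path_append[OF assms] by (intro exI[of _ "u @ w"]) auto
qed

lemma nfa_long_loops:
  assumes "nfa_path S \<E> q u q" "nfa_path S \<E> q v q" "coprime (length u) (length v)"
  shows "\<exists>L. \<forall>m\<ge>L. \<exists>w. nfa_path S \<E> q w q \<and> length w = m"
proof -
  obtain L where L: "\<And>m. m \<ge> L \<Longrightarrow> \<exists>x y. m = x * length u + y * length v"
    using frobenius_two[OF assms(3)] by blast
  have "\<exists>w. nfa_path S \<E> q w q \<and> length w = m" if "m \<ge> L" for m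
  proof -
    obtain x y where m: "m = x * length u + y * length v"
      using L \<open>m \<ge> L\<close> by blast
    obtain w1 where "nfa_path S \<E> q w1 q" "length w1 = x * length u"
      using nfa_loop_power[OF assms(1)] by blast
    moreover obtain w2 where "nfa_path S \<E> q w2 q" "length w2 = y * length v"
      using nfa_loop_power[OF assms(2)] by blast
    ultimately show ?thesis
      using nfa_path_append[of S \<E> q w1 q w2 q] m by (intro exI[of _ "w1 @ w2"]) simp
  qed
  then show ?thesis
    by blast
qed

text \<open>Uniformity is the point: one place \<open>h\<close> and one threshold \<open>k0\<close>
  serve all letters of \<open>E\<close>, so that blocks of a fixed length can be concatenated in any
  order.\<close>

lemma nfa_loops_with_letter:
  assumes "finite E" and L: "\<And>m. m \<ge> L \<Longrightarrow> \<exists>w. nfa_path S \<E> q w q \<and> length w = m"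
    and E: "\<And>e. e \<in> E \<Longrightarrow> \<exists>w1 r1 r2 w2. nfa_path S \<E> q w1 r1 \<and> \<E> r1 e r2 \<and> nfa_path S \<E> r2 w2 q"
  shows "\<exists>h k0. \<forall>k\<ge>k0. \<forall>e\<in>E. \<exists>w. nfa_path S \<E> q w q \<and> length w = k \<and> h < k \<and> w ! h = e"
proof -
  have "\<exists>w1 w2. \<exists>r1 r2. nfa_path S \<E> q w1 r1 \<and> \<E> r1 e r2 \<and> nfa_path S \<E> r2 w2 q" if "e \<in> E" for e
    using E[OF that] by blast
  then obtain f g where fg: "\<And>e. e \<in> E \<Longrightarrow> \<exists>r1 r2. nfa_path S \<E> q (f e) r1 \<and> \<E> r1 e r2 \<and> nfa_path S \<E> r2 (g e) q"
    by metis
  \<comment> \<open>The sums over \<open>E\<close> dominate every single detour, and the two terms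
    \<open>L\<close> leave room for padding loops at \<open>q\<close> before and after it.\<close>
  define h where "h = L + (\<Sum>e\<in>E. length (f e))"
  define k0 where "k0 = h + 1 + L + (\<Sum>e\<in>E. length (g e))"
  have "\<exists>w. nfa_path S \<E> q w q \<and> length w = k \<and> h < k \<and> w ! h = e" if k: "k \<ge> k0" and e: "e \<in> E" for k e
  proof -
    obtain r1 r2 where r: "nfa_path S \<E> q (f e) r1" "\<E> r1 e r2" "nfa_path S \<E> r2 (g e) q"
      using fg[OF e] by blast
    have f: "length (f e) \<le> (\<Sum>e\<in>E. length (f e))" and g: "length (g e) \<le> (\<Sum>e\<in>E. length (g e))"
      using assms(1) e by (auto intro: member_le_sum)
    have "L \<le> h - length (f e)" "L \<le> k - h - 1 - length (g e)"
      using f g k by (simp_all add: h_def k0_def)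
    then obtain w1 w2 where w1: "nfa_path S \<E> q w1 q" "length w1 = h - length (f e)"
        and w2: "nfa_path S \<E> q w2 q" "length w2 = k - h - 1 - length (g e)"
      using L by meson
    have *: "length (w1 @ f e) = h"
      using w1(2) f by (simp add: h_def)
    have "nfa_path S \<E> q ((w1 @ f e) @ e # g e @ w2) q"
      using w1(1) w2(1) r nfa_path_end[OF r(1)] by (intro nfa_path_append nfa_path.Cons)
    moreover have "length ((w1 @ f e) @ e # g e @ w2) = k" "h < k"
      using * w2(2) g k by (simp_all add: k0_def)
    moreover have "((w1 @ f e) @ e # g e @ w2) ! h = e"
      using * by (metis nth_append_length)
    ultimately show ?thesis
      by blast
  qed
  then show ?thesis
    by blast
qed

section \<open>The automaton of a $p$-adic iterated function system\<close>

locale padic_ifs =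
  fixes n :: nat and b k :: "nat \<Rightarrow> nat" and d :: "nat \<Rightarrow> 'p::prime_card padic" and K :: "'p padic set"
  assumes k_pos: "\<And>i. i \<in> {1..n} \<Longrightarrow> k i \<ge> 1"
    and d_Zp_Rats: "\<And>i. i \<in> {1..n} \<Longrightarrow> d i \<in> Zp \<inter> \<rat>"
    and self_similar: "is_self_similar_set n b k d K"
begin

abbreviation "S \<equiv> transducer_states n b k d"
abbreviation "\<delta> \<equiv> transducer_next b k d"
abbreviation "out \<equiv> transducer_out k d"
abbreviation "Q \<equiv> ndfa_states n b k d"
abbreviation "\<E> \<equiv> ndfa_edge n b k d"
abbreviation "vertex \<equiv> path_vertex b k d"

lemma compact_K: "compact K" and K_nonempty: "K \<noteq> {}"
  using self_similar by (auto simp: is_self_similar_set_def)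

lemma K_step: "i \<in> {1..n} \<Longrightarrow> y \<in> K \<Longrightarrow> (- 1) ^ b i * P ^ k i * y + d i \<in> K"
proof -
  assume "i \<in> {1..n}" "y \<in> K"
  then have "ifs_map b k d i y \<in> (\<Union>i\<in>{1..n}. ifs_map b k d i ` K)"
    by blast
  also have "\<dots> = K"
    using self_similar by (simp add: is_self_similar_set_def)
  finally show ?thesis
    by (simp add: ifs_map_def)
qed

lemma K_cases:
  assumes "x \<in> K"
  obtains i y where "i \<in> {1..n}" "y \<in> K" "x = (- 1) ^ b i * P ^ k i * y + d i"
proof -
  have "x \<in> (\<Union>i\<in>{1..n}. ifs_map b k d i ` K)"
    using assms self_similar by (simp add: is_self_similar_set_def)
  then show ?thesis
    using that by (auto simp: ifs_map_def)
qed

lemma d_Zp: "i \<in> {1..n} \<Longrightarrow> d i \<in> Zp"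
  using d_Zp_Rats by blast

text \<open>Compactness gives x in \<open>K\<close> of maximal norm. Were it above 1, the
  ultrametric inequality would make the summand d irrelevant in x = \<plusminus>p^k y + d, giving
  |x| <= p^-k |y| < |x|.\<close>

lemma K_subset_Zp: "K \<subseteq> Zp"
proof -
  have "continuous_on K (\<lambda>x. dist x 0)"
    by (intro continuous_intros)
  then obtain x where x: "x \<in> K" "\<And>y. y \<in> K \<Longrightarrow> padic_norm y \<le> padic_norm x"
    using continuous_attains_sup[OF compact_K K_nonempty, of "\<lambda>x. dist x 0"] by (auto simp: dist_padic_def)
  have "padic_norm x \<le> 1"
  proof (rule ccontr)
    assume gt: "\<not> padic_norm x \<le> 1"
    obtain i y where iy: "i \<in> {1..n}" "y \<in> K" "x = (- 1) ^ b i * P ^ k i * y + d i"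
      by (rule K_cases[OF x(1)])
    have "padic_norm (d i) \<le> 1"
      using d_Zp[OF iy(1)] by (simp add: Zp_def)
    then have "padic_norm x \<le> padic_norm ((- 1) ^ b i * P ^ k i * y)"
      using gt padic_norm_ultrametric[of "(- 1) ^ b i * P ^ k i * y" "d i"] iy(3) by auto
    also have "\<dots> = (1 / CARD('p)) ^ k i * padic_norm y"
      by (simp add: padic_norm_mult padic_norm_power padic_norm_minus padic_norm_prime)
    also have "\<dots> \<le> (1 / CARD('p)) ^ k i * padic_norm x"
      using x(2)[OF iy(2)] by (intro mult_left_mono) auto
    also have "\<dots> < 1 * padic_norm x"
      using gt one_less_prime_card[where 'p = 'p] k_pos[OF iy(1)]
      by (intro mult_strict_right_mono) (auto intro!: power_less_one_iff[THEN iffD2])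
    finally show False
      by simp
  qed
  then have "\<And>y. y \<in> K \<Longrightarrow> padic_norm y \<le> 1"
    using x(2) order_trans by blast
  then show ?thesis
    by (auto simp: Zp_def)
qed

section \<open>Transducer steps and the values of states\<close>

lemma transducer_next_eq:
  "fst s + of_int (snd s) * d i = of_nat (out s i) + P ^ k i * fst (\<delta> s i)"
  by (simp add: transducer_next_def)

lemma snd_transducer_next: "snd (\<delta> s i) = snd s * (- 1) ^ b i"
  by (simp add: transducer_next_def)

lemma transducer_step_Zp:
  assumes "fst s \<in> Zp" "i \<in> {1..n}"
  shows "out s i < CARD('p) ^ k i" "fst (\<delta> s i) \<in> Zp"
proof -
  have *: "fst s + of_int (snd s) * d i \<in> Zp"
    using assms d_Zp by blast
  show "out s i < CARD('p) ^ k i"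
    unfolding transducer_out_def by (rule padic_residue_Zp[OF *])
  obtain y where "y \<in> Zp" "fst s + of_int (snd s) * d i - of_nat (out s i) = P ^ k i * y"
    unfolding transducer_out_def using padic_residue_Zp(2)[OF *] by blast
  moreover have "P ^ k i * fst (\<delta> s i) = fst s + of_int (snd s) * d i - of_nat (out s i)"
    by (simp add: transducer_next_eq)
  ultimately show "fst (\<delta> s i) \<in> Zp"
    by simp
qed

lemma transducer_state_Zp: "s \<in> S \<Longrightarrow> fst s \<in> Zp"
proof (induction rule: transducer_states.induct)
  case initial
  show ?case
    using Zp_of_nat[of 0, where 'a = 'p] by simp
next
  case (step s i)
  then show ?case
    using transducer_step_Zp(2) by blast
qed

lemma transducer_out_less: "s \<in> S \<Longrightarrow> i \<in> {1..n} \<Longrightarrow> out s i < CARD('p) ^ k i"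
  using transducer_step_Zp(1) transducer_state_Zp by blast

text \<open>The composition of the maps read so far, applied to y in \<open>K\<close>, equals the
  number output so far plus a power of p times c + \<epsilon>y. This set is therefore what remains
  to be output at (c,\<epsilon>).\<close>

definition state_values :: "'p tstate \<Rightarrow> 'p padic set" where
  "state_values s = {fst s + of_int (snd s) * y |y. y \<in> K}"

text \<open>After \<open>l\<close> digits of a transition there remain the quotient of its output by
  p^l and, \<open>k i - l\<close> places higher, the values of the next state.\<close>

definition tail_values :: "'p tstate \<Rightarrow> nat \<Rightarrow> nat \<Rightarrow> 'p padic set" where
  "tail_values s i l =
     {of_nat (out s i div CARD('p) ^ l) + P ^ (k i - l) * w |w. w \<in> state_values (\<delta> s i)}"

text \<open>
  \<open>node_values r\<close> consists of the $p$-adic integers whose expansions label the infinite paths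
  from \<open>r\<close>.
\<close>

definition node_values :: "'p nstate \<Rightarrow> 'p padic set" where
  "node_values r = (case r of Main s \<Rightarrow> state_values s | Inner s i l \<Rightarrow> tail_values s i l)"

lemma state_values_Zp: "s \<in> S \<Longrightarrow> state_values s \<subseteq> Zp"
  using transducer_state_Zp K_subset_Zp unfolding state_values_def by blast

lemma tail_values_Zp: "s \<in> S \<Longrightarrow> i \<in> {1..n} \<Longrightarrow> tail_values s i l \<subseteq> Zp"
  using state_values_Zp[OF transducer_states.step] unfolding tail_values_def by blast

lemma state_values_eq: "state_values s = (\<Union>i\<in>{1..n}. tail_values s i 0)"
proof -
  \<comment> \<open>An image point of \<open>K\<close> is inserted into c + \<epsilon>K: the sign of
    the map joins \<epsilon>, and \<epsilon> times \<open>d i\<close> is absorbed by the output and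
    the new first component.\<close>
  have eq: "fst s + of_int (snd s) * ((- 1) ^ b i * P ^ k i * y + d i) =
      of_nat (out s i) + P ^ k i * (fst (\<delta> s i) + of_int (snd (\<delta> s i)) * y)" for i y
    using transducer_next_eq[of s i] by (simp add: snd_transducer_next algebra_simps)
  show ?thesis
  proof (intro equalityI subsetI)
    fix z
    assume "z \<in> state_values s"
    then obtain x where x: "x \<in> K" "z = fst s + of_int (snd s) * x"
      by (auto simp: state_values_def)
    obtain i y where iy: "i \<in> {1..n}" "y \<in> K" "x = (- 1) ^ b i * P ^ k i * y + d i"
      by (rule K_cases[OF x(1)])
    then have "z = of_nat (out s i) + P ^ k i * (fst (\<delta> s i) + of_int (snd (\<delta> s i)) * y)"
      using x(2) eq by simp
    then have "z \<in> tail_values s i 0"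
      using iy(2) by (auto simp: tail_values_def state_values_def)
    then show "z \<in> (\<Union>i\<in>{1..n}. tail_values s i 0)"
      using iy(1) by blast
  next
    fix z
    assume "z \<in> (\<Union>i\<in>{1..n}. tail_values s i 0)"
    then obtain i y where iy: "i \<in> {1..n}" "y \<in> K"
        "z = of_nat (out s i) + P ^ k i * (fst (\<delta> s i) + of_int (snd (\<delta> s i)) * y)"
      by (auto simp: tail_values_def state_values_def)
    then have "z = fst s + of_int (snd s) * ((- 1) ^ b i * P ^ k i * y + d i)"
      by (simp only: eq)
    then show "z \<in> state_values s"
      using K_step[OF iy(1,2)] unfolding state_values_def by blast
  qed
qed

text \<open>At l = 0 there is only an inclusion, because a main state branches over all letters. At
  l = \<open>k i\<close> the output, being below p^(k i), is exhausted, and the tail is the value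
  set of the next state.\<close>

lemma node_values_vertex:
  assumes "s \<in> S" "i \<in> {1..n}" "l \<le> k i"
  shows "tail_values s i l \<subseteq> node_values (vertex s i l)" "0 < l \<Longrightarrow> node_values (vertex s i l) = tail_values s i l"
proof -
  have "tail_values s i (k i) = state_values (\<delta> s i)"
    using transducer_out_less[OF assms(1,2)] by (simp add: tail_values_def)
  then show "0 < l \<Longrightarrow> node_values (vertex s i l) = tail_values s i l"
    using assms(3) by (cases "l = k i") (auto simp: path_vertex_def node_values_def)
  then show "tail_values s i l \<subseteq> node_values (vertex s i l)"
    using assms(2) by (cases "l = 0") (auto simp: path_vertex_def node_values_def state_values_eq[of s])
qed

lemma tail_values_step:
  assumes "l < k i"
  shows "tail_values s i l =
    (\<lambda>z. of_nat (out s i div CARD('p) ^ l mod CARD('p)) + P * z) ` tail_values s i (Suc l)"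
proof -
  have "of_nat (out s i div CARD('p) ^ l) =
      (of_nat (out s i div CARD('p) ^ l mod CARD('p)) + P * of_nat (out s i div CARD('p) ^ Suc l) :: 'p padic)"
    by (subst mod_mult_div_eq[symmetric, of "out s i div CARD('p) ^ l" "CARD('p)"])
      (simp only: of_nat_add of_nat_mult div_mult2_eq power_Suc2)
  moreover have "P ^ (k i - l) = (P * P ^ (k i - Suc l) :: 'p padic)"
    using assms by (metis Suc_diff_Suc power_Suc)
  ultimately have eq: "of_nat (out s i div CARD('p) ^ l) + P ^ (k i - l) * w =
      of_nat (out s i div CARD('p) ^ l mod CARD('p)) +
      P * (of_nat (out s i div CARD('p) ^ Suc l) + P ^ (k i - Suc l) * (w :: 'p padic))" for w
    by (simp add: algebra_simps)
  show ?thesis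
    unfolding tail_values_def eq by blast
qed

lemma vertex_state:
  assumes "s \<in> S" "i \<in> {1..n}"
  shows "vertex s i l \<in> Q"
proof -
  have "Main s \<in> Q" "Main (\<delta> s i) \<in> Q"
    using assms(1) transducer_states.step[OF assms] unfolding ndfa_states_def by blast+
  moreover have "Inner s i l \<in> Q" if "1 \<le> l" "l < k i"
    using assms that unfolding ndfa_states_def by blast
  ultimately show ?thesis
    by (simp add: path_vertex_def)
qed

lemma edge_states: "\<E> r a r' \<Longrightarrow> r \<in> Q \<and> r' \<in> Q \<and> a < CARD('p)"
  by (induction rule: ndfa_edge.induct) (simp add: vertex_state)

lemma edge_values:
  assumes "\<E> r a r'" "z \<in> node_values r'"
  shows "of_nat a + P * z \<in> node_values r"
  using assms
proof (induction rule: ndfa_edge.induct)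
  case (1 s i l)
  then have "z \<in> tail_values s i (Suc l)"
    using node_values_vertex(2)[of s i "Suc l"] by simp
  then show ?case
    using node_values_vertex(1)[of s i l] tail_values_step[of l i s] 1 by fastforce
qed

text \<open>Converse to \<open>edge_values\<close>. At a main state the letter comes from
  \<open>K\<close> being the union of its images; inside a transition the edge is forced.\<close>

lemma node_values_edge:
  assumes "r \<in> Q" "z \<in> node_values r"
  shows "\<exists>a r' z'. \<E> r a r' \<and> z' \<in> node_values r' \<and> z = of_nat a + P * z'"
proof -
  have "\<exists>s i l. s \<in> S \<and> i \<in> {1..n} \<and> l < k i \<and> r = vertex s i l \<and> z \<in> tail_values s i l"
  proof (cases r)
    case (Main s)
    then have "s \<in> S" "z \<in> state_values s"
      using assms by (auto simp: ndfa_states_def node_values_def)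
    then obtain i where i: "i \<in> {1..n}" "z \<in> tail_values s i 0"
      by (auto simp: state_values_eq[of s])
    moreover have "0 < k i"
      using k_pos[OF i(1)] by simp
    moreover have "r = vertex s i 0"
      by (simp add: path_vertex_def Main)
    ultimately show ?thesis
      using \<open>s \<in> S\<close> by blast
  next
    case (Inner s i l)
    then have "s \<in> S" "i \<in> {1..n}" "1 \<le> l" "l < k i" "z \<in> tail_values s i l"
      using assms by (auto simp: ndfa_states_def node_values_def)
    moreover have "r = vertex s i l"
      using calculation by (simp add: path_vertex_def Inner)
    ultimately show ?thesis
      by blast
  qed
  then obtain s i l where sil: "s \<in> S" "i \<in> {1..n}" "l < k i" "r = vertex s i l" "z \<in> tail_values s i l"
    by blast
  then obtain z' where "z' \<in> tail_values s i (Suc l)" "z = of_nat (out s i div CARD('p) ^ l mod CARD('p)) + P * z'"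
    using tail_values_step[OF sil(3)] by blast
  moreover have "\<E> r (out s i div CARD('p) ^ l mod CARD('p)) (vertex s i (Suc l))"
    unfolding sil(4) by (rule ndfa_edge.intros[OF sil(1-3)])
  ultimately show ?thesis
    using node_values_vertex(2)[of s i "Suc l"] sil by auto
qed

lemma node_values_Zp: "r \<in> Q \<Longrightarrow> node_values r \<subseteq> Zp"
  using state_values_Zp tail_values_Zp
  by (cases r) (simp_all only: node_values_def ndfa_states_def nstate.case, blast+)

lemma node_values_nonempty: "node_values r \<noteq> {}"
  using K_nonempty by (auto simp: node_values_def state_values_def tail_values_def split: nstate.split)

lemma node_values_initial: "node_values (Main (0, 1)) = K"
  by (auto simp: node_values_def state_values_def)

text \<open>The end state has a value since \<open>K\<close> is nonempty; prefixing the labels to it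
  one by one gives the value sought.\<close>

lemma path_values:
  assumes "nfa_path Q \<E> r w r'"
  shows "\<exists>z\<in>node_values r. \<forall>i<length w. padic_digits z i = w ! i"
  using assms
proof (induction rule: nfa_path.induct)
  case (Nil r)
  then show ?case
    using node_values_nonempty by auto
next
  case (Cons r a r' w r'')
  then obtain z where z: "z \<in> node_values r'" "\<forall>i<length w. padic_digits z i = w ! i"
    by blast
  have a: "r' \<in> Q" "a < CARD('p)"
    using edge_states[OF Cons.hyps(2)] by auto
  have "z \<in> Zp"
    using z(1) node_values_Zp[OF a(1)] by blast
  then have "\<forall>i<length (a # w). padic_digits (of_nat a + P * z) i = (a # w) ! i"
    using padic_digits_cons[OF _ a(2), of z] z(2) by (auto simp: less_Suc_eq_0_disj)
  then show ?case
    using edge_values[OF Cons.hyps(2) z(1)] by blast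
qed

lemma essential_values_digits:
  assumes EC: "essential_class Q \<E> EC"
    and E: "E = (\<Union>r\<in>EC. \<Union>w\<in>accepted_from Q \<E> r. set w)"
    and "r \<in> EC" "z \<in> node_values r"
  shows "padic_digits z i \<in> E"
  using assms(3,4)
proof (induction i arbitrary: r z)
  have step: "\<exists>a r' z'. a \<in> E \<and> a < CARD('p) \<and> r' \<in> EC \<and> z' \<in> node_values r' \<and> z' \<in> Zp \<and> z = of_nat a + P * z'"
    if r: "r \<in> EC" and z: "z \<in> node_values r" for r z
  proof -
    have "r \<in> Q"
      using essential_class_subset[OF EC] r by blast
    then obtain a r' z' where *: "\<E> r a r'" "z' \<in> node_values r'" "z = of_nat a + P * z'"
      using node_values_edge z by blast
    have a: "r' \<in> Q" "a < CARD('p)"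
      using edge_states[OF *(1)] by auto
    have "nfa_path Q \<E> r [a] r'"
      using a(1) *(1) \<open>r \<in> Q\<close> by (auto intro: nfa_path.intros)
    \<comment> \<open>The label of a single edge is already an accepted word, hence a digit in
      \<open>E\<close>.\<close>
    then have "[a] \<in> accepted_from Q \<E> r"
      by (auto simp: accepted_from_def)
    then have "a \<in> E"
      unfolding E using r by force
    then show ?thesis
      using * a essential_class_step[OF EC r *(1) a(1)] node_values_Zp[OF a(1)] by blast
  qed
  {
    case 0
    obtain a r' z' where *: "a \<in> E" "a < CARD('p)" "r' \<in> EC" "z' \<in> node_values r'" "z' \<in> Zp"
        and z: "z = of_nat a + P * z'"
      using step[OF 0] by blast
    show ?case
      unfolding z by (simp only: padic_digits_cons(1)[OF *(5,2)] *(1))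
  next
    case (Suc i)
    obtain a r' z' where *: "a \<in> E" "a < CARD('p)" "r' \<in> EC" "z' \<in> node_values r'" "z' \<in> Zp"
        and z: "z = of_nat a + P * z'"
      using step[OF Suc.prems] by blast
    show ?case
      unfolding z padic_digits_cons(2)[OF *(5,2)] by (rule Suc.IH[OF *(3,4)])
  }
qed

lemma vertex_path:
  assumes "s \<in> S" "i \<in> {1..n}" "l \<le> l'" "l' \<le> k i"
  shows "\<exists>w. nfa_path Q \<E> (vertex s i l) w (vertex s i l')"
  using assms(3,4)
proof (induction rule: dec_induct)
  case base
  then show ?case
    using nfa_path.Nil vertex_state[OF assms(1,2)] by metis
next
  case (step m)
  then obtain w where "nfa_path Q \<E> (vertex s i l) w (vertex s i m)"
    by auto
  moreover have "\<E> (vertex s i m) (out s i div CARD('p) ^ m mod CARD('p)) (vertex s i (Suc m))"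
    using assms(1,2) step by (intro ndfa_edge.intros) auto
  then have "nfa_path Q \<E> (vertex s i m) [out s i div CARD('p) ^ m mod CARD('p)] (vertex s i (Suc m))"
    using vertex_state[OF assms(1,2)] by (blast intro: nfa_path.intros)
  ultimately show ?case
    using nfa_path_append by metis
qed

lemma vertex_ends: "i \<in> {1..n} \<Longrightarrow> vertex s i 0 = Main s" "i \<in> {1..n} \<Longrightarrow> vertex s i (k i) = Main (\<delta> s i)"
  using k_pos[of i] by (auto simp: path_vertex_def)

lemma transducer_step_path:
  assumes "s \<in> S" "i \<in> {1..n}"
  shows "\<exists>w. nfa_path Q \<E> (Main s) w (Main (\<delta> s i))"
  using vertex_path[OF assms, of 0 "k i"] vertex_ends[OF assms(2)] by simp

lemma initial_path_Main: "s \<in> S \<Longrightarrow> \<exists>w. nfa_path Q \<E> (Main (0, 1)) w (Main s)"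
proof (induction rule: transducer_states.induct)
  case initial
  have "Main (0, 1) \<in> Q"
    using transducer_states.initial unfolding ndfa_states_def by blast
  then show ?case
    using nfa_path.Nil by metis
next
  case (step s i)
  then show ?case
    using transducer_step_path nfa_path_append by metis
qed

lemma initial_path:
  assumes "r \<in> Q"
  shows "\<exists>w. nfa_path Q \<E> (Main (0, 1)) w r"
proof (cases r)
  case (Main s)
  then show ?thesis
    using assms initial_path_Main by (auto simp: ndfa_states_def)
next
  case (Inner s i l)
  then have sil: "s \<in> S" "i \<in> {1..n}" "1 \<le> l" "l < k i"
    using assms by (auto simp: ndfa_states_def)
  then have "vertex s i l = r"
    by (simp add: path_vertex_def Inner)
  then show ?thesis
    using vertex_path[OF sil(1,2), of 0 l] vertex_ends(1)[OF sil(2)] sil(4)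
      initial_path_Main[OF sil(1)] nfa_path_append by (metis le0 less_imp_le)
qed

lemma essential_Main_next:
  assumes "essential_class Q \<E> EC" "s \<in> S" "Main s \<in> EC" "i \<in> {1..n}"
  shows "Main (\<delta> s i) \<in> EC"
  using transducer_step_path[OF assms(2,4)] essential_class_closed[OF assms(1,3)] by blast

lemma essential_Main_exists:
  assumes EC: "essential_class Q \<E> EC" "r \<in> EC"
  shows "\<exists>s\<in>S. Main s \<in> EC"
proof (cases r)
  case (Main s)
  then have "s \<in> S"
    using essential_class_subset[OF EC(1)] EC(2) by (auto simp: ndfa_states_def)
  then show ?thesis
    using EC(2) Main by blast
next
  case (Inner s i l)
  have "r \<in> Q"
    using essential_class_subset[OF EC(1)] EC(2) by blast
  then have sil: "s \<in> S" "i \<in> {1..n}" "1 \<le> l" "l < k i"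
    by (auto simp: ndfa_states_def Inner)
  then have "vertex s i l = r"
    by (simp add: path_vertex_def Inner)
  then have "\<exists>w. nfa_path Q \<E> r w (Main (\<delta> s i))"
    using vertex_path[OF sil(1,2), of l "k i"] vertex_ends(2)[OF sil(2)] sil(4) by simp
  then show ?thesis
    using essential_class_closed[OF EC] transducer_states.step[OF sil(1,2)] by blast
qed

end

section \<open>Finiteness of the transducer and congruent states\<close>

lemma Zp_Rats_fraction:
  assumes "x \<in> Zp \<inter> \<rat>"
  shows "\<exists>a b. b > 0 \<and> \<not> int CARD('p) dvd b \<and> x * of_int b = (of_int a :: 'p::prime_card padic)"
proof -
  obtain r where r: "x = of_rat r"
    using assms by (auto elim: Rats_cases)
  obtain a b where ab: "quotient_of r = (a, b)"
    by fastforce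
  have b: "b > 0"
    using quotient_of_denom_pos[OF ab] .
  have "r * of_int b = of_int a"
    using quotient_of_div[OF ab] b by simp
  then have "x * of_int b = of_int a"
    unfolding r by (metis of_rat_mult of_rat_of_int_eq)
  then show ?thesis
    using prime_not_dvd_denominator[of x b a] quotient_of_coprime[OF ab] assms b by blast
qed

lemma common_denominator:
  assumes "finite I" "\<And>i. i \<in> I \<Longrightarrow> x i \<in> Zp \<inter> \<rat>"
  shows "\<exists>N>0. \<forall>i\<in>I. \<exists>a. x i * of_int N = (of_int a :: 'p::prime_card padic)"
  using assms
proof (induction I rule: finite_induct)
  case empty
  show ?case
    by (intro exI[of _ 1]) simp
next
  case (insert j I)
  then obtain N where N: "N > 0" "\<And>i. i \<in> I \<Longrightarrow> \<exists>a. x i * of_int N = of_int a"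
    by blast
  obtain a c where c: "c > 0" "x j * of_int c = of_int a"
    using Zp_Rats_fraction insert.prems by blast
  have "\<exists>a. x i * of_int (N * c) = of_int a" if i: "i \<in> insert j I" for i
  proof (cases "i = j")
    case True
    have "x j * of_int (N * c) = of_int N * (x j * of_int c)"
      by (simp add: mult_ac)
    then show ?thesis
      using c(2) True by (metis of_int_mult)
  next
    case False
    then obtain a' where "x i * of_int N = of_int a'"
      using N(2) i by blast
    moreover have "x i * of_int (N * c) = (x i * of_int N) * of_int c"
      by (simp add: mult_ac)
    ultimately show ?thesis
      by (metis of_int_mult)
  qed
  then show ?case
    using N(1) c(1) by (intro exI[of _ "N * c"]) simp
qed

lemma funpow_in:
  assumes "\<And>s. s \<in> A \<Longrightarrow> f s \<in> A" "s \<in> A"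
  shows "(f ^^ m) s \<in> A"
  by (induction m) (use assms in auto)

lemma foldl_in:
  assumes "\<And>s i. s \<in> A \<Longrightarrow> i \<in> I \<Longrightarrow> f s i \<in> A" "s \<in> A" "set js \<subseteq> I"
  shows "foldl f s js \<in> A"
  using assms(2,3)
proof (induction js arbitrary: s)
  case (Cons i js)
  then show ?case
    using Cons.IH[OF assms(1)] by simp
qed simp

context padic_ifs
begin

text \<open>All first components are a / N for one common denominator \<open>N\<close> of the
  \<open>d i\<close>, and the division by a power of p keeps the numerators bounded.\<close>

lemma finite_transducer_states: "finite S"
proof -
  obtain N where N: "N > 0" "\<And>i. i \<in> {1..n} \<Longrightarrow> \<exists>a. d i * of_int N = of_int a"
    using common_denominator[of "{1..n}" d] d_Zp_Rats by blast
  then obtain e where e: "\<And>i. i \<in> {1..n} \<Longrightarrow> d i * of_int N = of_int (e i)"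
    by metis
  define M where "M = (\<Sum>i\<in>{1..n}. \<bar>e i\<bar>)"
  \<comment> \<open>This bound is preserved by a step: |a'| > B would give p^k (|a'| - N) >= 2 (M +
    N + 1), whereas that product is at most B + M = 2 M + 2 N.\<close>
  define B where "B = M + 2 * N"
  have M: "\<bar>e i\<bar> \<le> M" if "i \<in> {1..n}" for i
    unfolding M_def using that by (intro member_le_sum) auto
  have "0 \<le> M"
    by (simp add: M_def sum_nonneg)
  have inv: "(\<exists>a. fst s * of_int N = of_int a \<and> \<bar>a\<bar> \<le> B) \<and> (snd s = 1 \<or> snd s = - 1)" if "s \<in> S" for s
    using that
  proof (induction rule: transducer_states.induct)
    case initial
    show ?case
      using N(1) \<open>0 \<le> M\<close> by (auto simp: B_def intro: exI[of _ 0])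
  next
    case (step s i)
    obtain a where a: "fst s * of_int N = of_int a" "\<bar>a\<bar> \<le> B"
      using step.IH by blast
    have sgn: "snd s = 1 \<or> snd s = - 1"
      using step.IH by blast
    have next_Zp: "fst (\<delta> s i) * of_int N \<in> Zp"
      using transducer_state_Zp[OF transducer_states.step[OF step.hyps]] by blast
    define t where "t = a + snd s * e i - N * int (out s i)"
    have eq: "of_int t = P ^ k i * (fst (\<delta> s i) * of_int N)"
    proof -
      have "P ^ k i * (fst (\<delta> s i) * of_int N) = (P ^ k i * fst (\<delta> s i)) * of_int N"
        by (simp add: mult.assoc)
      also have "P ^ k i * fst (\<delta> s i) = fst s + of_int (snd s) * d i - of_nat (out s i)"
        by (simp add: transducer_next_eq)
      also have "(fst s + of_int (snd s) * d i - of_nat (out s i)) * of_int N =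
          fst s * of_int N + of_int (snd s) * (d i * of_int N) - of_int N * of_nat (out s i)"
        by (simp add: algebra_simps)
      also have "\<dots> = of_int t"
        using a(1) e[OF step.hyps(2)] by (simp add: t_def)
      finally show ?thesis
        by simp
    qed
    \<comment> \<open>The new numerator is an integer because the new first component lies in
      \<open>Zp\<close>.\<close>
    then have "int CARD('p) ^ k i dvd t"
      by (rule prime_power_times_Zp_of_int[OF next_Zp])
    then obtain a' where a': "t = int CARD('p) ^ k i * a'"
      by blast
    have "P ^ k i * of_int a' = P ^ k i * (fst (\<delta> s i) * of_int N)"
      using eq by (simp add: a')
    then have a'_eq: "fst (\<delta> s i) * of_int N = of_int a'"
      by simp
    have "\<bar>a'\<bar> \<le> B"
    proof (rule ccontr)
      assume "\<not> \<bar>a'\<bar> \<le> B"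
      then have big: "B + 1 - N \<le> \<bar>a'\<bar> - N"
        by simp
      have "2 \<le> int CARD('p)"
        using one_less_prime_card[where 'p = 'p] by simp
      also have "\<dots> \<le> int CARD('p) ^ k i"
        using k_pos[OF step.hyps(2)] one_less_prime_card[where 'p = 'p] by (intro self_le_power) auto
      finally have p2: "2 \<le> int CARD('p) ^ k i" .
      have "\<bar>t\<bar> \<le> \<bar>a\<bar> + \<bar>snd s * e i\<bar> + \<bar>N * int (out s i)\<bar>"
        by (simp add: t_def)
      also have "\<bar>snd s * e i\<bar> = \<bar>e i\<bar>"
        using sgn by (auto simp: abs_mult)
      also have "\<bar>N * int (out s i)\<bar> \<le> N * int CARD('p) ^ k i"
        using transducer_out_less[OF step.hyps] N(1)
        by (simp add: abs_mult less_imp_le flip: of_nat_power)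
      finally have "int CARD('p) ^ k i * \<bar>a'\<bar> \<le> B + M + N * int CARD('p) ^ k i"
        using a(2) M[OF step.hyps(2)] by (simp add: a' abs_mult)
      then have "int CARD('p) ^ k i * (\<bar>a'\<bar> - N) \<le> B + M"
        by (simp add: algebra_simps)
      moreover have "2 * (B + 1 - N) \<le> int CARD('p) ^ k i * (\<bar>a'\<bar> - N)"
        using big p2 N(1) \<open>0 \<le> M\<close> by (intro mult_mono) (auto simp: B_def)
      ultimately show False
        by (simp add: B_def)
    qed
    then show ?case
      using a'_eq sgn by (auto simp: snd_transducer_next minus_one_power_iff)
  qed
  have "S \<subseteq> (\<lambda>(a, \<epsilon>). (of_int a / of_int N, \<epsilon>)) ` ({- B..B} \<times> {1, - 1})"
  proof
    fix s
    assume "s \<in> S"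
    then obtain a where a: "fst s * of_int N = of_int a" "\<bar>a\<bar> \<le> B" "snd s = 1 \<or> snd s = - 1"
      using inv by blast
    have "of_int N \<noteq> (0 :: 'p padic)"
      using N(1) by simp
    then have "s = (\<lambda>(a, \<epsilon>). (of_int a / of_int N, \<epsilon>)) (a, snd s)"
      using a(1) by (cases s) (simp add: nonzero_eq_divide_eq)
    moreover have "(a, snd s) \<in> {- B..B} \<times> {1, - 1}"
      using a(2,3) by auto
    ultimately show "s \<in> (\<lambda>(a, \<epsilon>). (of_int a / of_int N, \<epsilon>)) ` ({- B..B} \<times> {1, - 1})"
      by blast
  qed
  then show ?thesis
    by (rule finite_subset) simp
qed

text \<open>For congruent states the value sets c + \<epsilon>K differ by an integer translation;
  the equal signs make the terms \<epsilon> times \<open>d i\<close> cancel when steps are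
  compared.\<close>

definition congruent_states :: "'p tstate \<Rightarrow> 'p tstate \<Rightarrow> bool" where
  "congruent_states s t \<longleftrightarrow> snd s = snd t \<and> fst s - fst t \<in> \<int>"

text \<open>The old first component is, up to an integer, p^k times the new one minus \<epsilon>
  times \<open>d i\<close>. Equality of states need not pull back in this way, since a transition
  forgets the number it outputs.\<close>

lemma congruent_states_back:
  assumes "congruent_states (\<delta> s i) (\<delta> t i)"
  shows "congruent_states s t"
proof -
  have snd: "snd s = snd t"
    using assms by (simp add: congruent_states_def snd_transducer_next)
  have "fst s - fst t = of_nat (out s i) + P ^ k i * fst (\<delta> s i) - (of_nat (out t i) + P ^ k i * fst (\<delta> t i))"
    unfolding transducer_next_eq[symmetric] by (simp add: snd)
  also have "\<dots> = of_nat (out s i) - of_nat (out t i) + P ^ k i * (fst (\<delta> s i) - fst (\<delta> t i))"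
    by (simp add: algebra_simps)
  also have "\<dots> \<in> \<int>"
    using assms by (auto simp: congruent_states_def)
  finally show ?thesis
    by (simp add: congruent_states_def snd)
qed

lemma congruent_states_back_word:
  "congruent_states (foldl \<delta> s js) (foldl \<delta> t js) \<Longrightarrow> congruent_states s t"
proof (induction js arbitrary: s t)
  case (Cons i js)
  then show ?case
    using congruent_states_back[OF Cons.IH[of "\<delta> s i" "\<delta> t i"]] by simp
qed simp

lemma congruent_states_back_power:
  "congruent_states (((\<lambda>s. foldl \<delta> s js) ^^ m) s) (((\<lambda>s. foldl \<delta> s js) ^^ m) t) \<Longrightarrow> congruent_states s t"
  by (induction m) (auto dest: congruent_states_back_word)

lemma transducer_states_word:
  "s \<in> S \<Longrightarrow> \<exists>js. set js \<subseteq> {1..n} \<and> s = foldl \<delta> (0, 1) js"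
proof (induction rule: transducer_states.induct)
  case initial
  show ?case
    by (intro exI[of _ "[]"]) simp
next
  case (step s i)
  then obtain js where "set js \<subseteq> {1..n}" "s = foldl \<delta> (0, 1) js"
    by blast
  then show ?case
    using step.hyps(2) by (intro exI[of _ "js @ [i]"]) simp
qed

text \<open>
  A transition acts on the states modulo \<^term>\<open>congruent_states\<close> by an injection of a finite set, hence
  by a permutation. So a word that leads from the initial state into the essential class returns,
  when it is repeated, to a state congruent to the initial one.
\<close>

lemma essential_integer_state:
  assumes EC: "essential_class Q \<E> EC" "r \<in> EC"
  shows "\<exists>m. (of_int m, 1) \<in> S \<and> Main (of_int m, 1) \<in> EC"
proof -
  define C where "C = {s \<in> S. Main s \<in> EC}"
  have C_step: "\<delta> s i \<in> C" if "s \<in> C" "i \<in> {1..n}" for s i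
    using that essential_Main_next[OF EC(1)] transducer_states.step unfolding C_def by blast
  obtain s where "s \<in> C"
    using essential_Main_exists[OF EC] by (auto simp: C_def)
  then obtain js where js: "set js \<subseteq> {1..n}" "s = foldl \<delta> (0, 1) js"
    using transducer_states_word unfolding C_def by blast
  define f where "f = (\<lambda>s. foldl \<delta> s js)"
  have f_C: "(f ^^ m) s \<in> C" for m
    unfolding f_def by (rule funpow_in[OF foldl_in[OF C_step _ js(1)] \<open>s \<in> C\<close>])
  \<comment> \<open>At least one application is required: the first one lands on \<open>s\<close>,
    and thus in the class.\<close>
  have f_Suc: "(f ^^ Suc m) (0, 1) \<in> C" for m
  proof -
    have "s = f (0, 1)"
      by (simp add: f_def js(2))
    then show ?thesis
      using f_C[of m] by (simp add: funpow_swap1)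
  qed
  have "(f ^^ m) (0, 1) \<in> S" for m
    unfolding f_def
    by (rule funpow_in[OF foldl_in[OF transducer_states.step _ js(1)] transducer_states.initial])
  then have "range (\<lambda>m. (f ^^ m) (0, 1)) \<subseteq> S"
    by (rule image_subsetI)
  then have "finite (range (\<lambda>m. (f ^^ m) (0, 1)))"
    by (rule finite_subset[OF _ finite_transducer_states])
  then have "\<not> inj (\<lambda>m. (f ^^ m) (0, 1))"
    using infinite_UNIV_nat by (auto dest: finite_imageD)
  then obtain x y where "x \<noteq> y" "(f ^^ x) (0, 1) = (f ^^ y) (0, 1)"
    by (auto simp: inj_def)
  then obtain x y where xy: "x < y" "(f ^^ x) (0, 1) = (f ^^ y) (0, 1)"
    by (metis nat_neq_iff)
  then obtain m where "y = Suc (x + m)"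
    using less_imp_Suc_add by blast
  then have "y = x + Suc m"
    by simp
  \<comment> \<open>The orbit is known only to be eventually periodic. Pulling congruence back
    through the preperiod \<open>x\<close> turns this into a return to the initial state modulo
    congruence.\<close>
  then have "(f ^^ x) (0, 1) = (f ^^ x) ((f ^^ Suc m) (0, 1))"
    using xy(2) by (simp only: funpow_add o_apply)
  moreover have "congruent_states ((f ^^ x) (0, 1)) ((f ^^ x) (0, 1))"
    by (simp add: congruent_states_def)
  ultimately have "congruent_states ((f ^^ x) (0, 1)) ((f ^^ x) ((f ^^ Suc m) (0, 1)))"
    by metis
  then have cong: "congruent_states (0, 1) ((f ^^ Suc m) (0, 1))"
    unfolding f_def by (rule congruent_states_back_power)
  obtain c \<epsilon> where ce: "(f ^^ Suc m) (0, 1) = (c, \<epsilon>)"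
    by fastforce
  have "\<epsilon> = 1" "- c \<in> \<int>"
    using cong unfolding ce by (simp_all add: congruent_states_def)
  then obtain m' where "c = of_int m'"
    by (metis Ints_cases Ints_minus minus_minus)
  then show ?thesis
    using f_Suc[of m] \<open>\<epsilon> = 1\<close> unfolding ce C_def by blast
qed

lemma essential_digits_cases:
  assumes EC: "essential_class Q \<E> EC" "r \<in> EC"
    and E: "E = (\<Union>r\<in>EC. \<Union>w\<in>accepted_from Q \<E> r. set w)"
    and x: "x \<in> K"
  shows "\<exists>M. (\<forall>i\<ge>M. padic_digits x i \<in> E) \<or> (\<exists>a. \<forall>i\<ge>M. padic_digits x i = a)"
proof -
  obtain m where m: "(of_int m, 1) \<in> S" "Main (of_int m, 1) \<in> EC"
    using essential_integer_state[OF EC] by blast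
  define z where "z = of_int m + x"
  have "z \<in> node_values (Main (of_int m, 1))"
    using x by (auto simp: z_def node_values_def state_values_def)
  then have digits: "padic_digits z i \<in> E" for i
    by (rule essential_values_digits[OF EC(1) E m(2)])
  have "z \<in> Zp"
    using x K_subset_Zp by (auto simp: z_def)
  moreover have "x = z + of_int (- m)"
    by (simp add: z_def)
  ultimately obtain M where "(\<forall>i\<ge>M. padic_digits x i = padic_digits z i) \<or> (\<exists>a. \<forall>i\<ge>M. padic_digits x i = a)"
    using eventually_padic_digits_add_of_int by blast
  then show ?thesis
    using digits by metis
qed

subsection \<open>Digits of decimations\<close>

text \<open>A finite path prescribes finitely many digits; a limit point of the approximants has all
  of them, because each digit is locally constant.\<close>

lemma compact_K_digits:
  fixes g e :: "nat \<Rightarrow> nat"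
  assumes "\<And>M. \<exists>x\<in>K. \<forall>i<M. padic_digits x (g i) = e i"
  shows "\<exists>x\<in>K. \<forall>i. padic_digits x (g i) = e i"
proof -
  obtain x :: "nat \<Rightarrow> 'p padic" where x: "\<And>M. x M \<in> K" "\<And>M i. i < M \<Longrightarrow> padic_digits (x M) (g i) = e i"
    using assms by metis
  obtain l and r :: "nat \<Rightarrow> nat" where l: "l \<in> K" "strict_mono r" "(x \<circ> r) \<longlonglongrightarrow> l"
    using compact_imp_seq_compact[OF compact_K] x(1) unfolding seq_compact_def by metis
  have "padic_digits l (g i) = e i" for i
  proof -
    have "0 < (1 / real CARD('p)) ^ Suc (g i)"
      by simp
    then have "\<forall>\<^sub>F M in sequentially. dist ((x \<circ> r) M) l < (1 / CARD('p)) ^ Suc (g i)"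
      by (rule tendstoD[OF l(3)])
    moreover have "\<forall>\<^sub>F M in sequentially. i < M"
      by (rule eventually_gt_at_top)
    ultimately have "\<forall>\<^sub>F M in sequentially. dist ((x \<circ> r) M) l < (1 / CARD('p)) ^ Suc (g i) \<and> i < M"
      by eventually_elim simp
    then obtain M where M: "dist (x (r M)) l < (1 / CARD('p)) ^ Suc (g i)" "i < M"
      by (auto simp: eventually_sequentially)
    have "padic_digits (x (r M)) (g i) = padic_digits l (g i)"
      using padic_digits_eq_iff_norm[of "x (r M)" l "Suc (g i)"] M(1) x(1) l(1) K_subset_Zp
      by (auto simp: dist_padic_def)
    moreover have "i < r M"
      using M(2) seq_suble[OF l(2), of M] by linarith
    ultimately show ?thesis
      using x(2) by simp
  qed
  then show ?thesis
    using l(1) by blast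
qed

text \<open>The words consist of a path to \<open>q\<close>, a padding loop, and loops of length
  exactly m, one for each prescribed digit. As the block length does not depend on the digit, the
  digits can be chosen independently.\<close>

lemma essential_free_digits:
  assumes EC: "essential_class Q \<E> EC" and q: "q \<in> EC"
    and E: "E = (\<Union>r\<in>EC. \<Union>w\<in>accepted_from Q \<E> r. set w)"
    and u: "nfa_path Q \<E> q u q" and v: "nfa_path Q \<E> q v q" and coprime: "coprime (length u) (length v)"
    and "finite E"
  shows "\<exists>m1. \<forall>m\<ge>m1. \<exists>m0. \<forall>e. (\<forall>i. e i \<in> E) \<longrightarrow> (\<exists>x\<in>K. \<forall>i. padic_digits x (j + (m0 + i) * m) = e i)"
proof -
  obtain L where L: "\<And>m. m \<ge> L \<Longrightarrow> \<exists>w. nfa_path Q \<E> q w q \<and> length w = m"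
    using nfa_long_loops[OF u v coprime] by blast
  have "\<exists>w1 r1 r2 w2. nfa_path Q \<E> q w1 r1 \<and> \<E> r1 e r2 \<and> nfa_path Q \<E> r2 w2 q" if e: "e \<in> E" for e
  proof -
    obtain r w where "r \<in> EC" "w \<in> accepted_from Q \<E> r" "e \<in> set w"
      using e unfolding E by blast
    then obtain r1 r2 where r: "r1 \<in> EC" "r2 \<in> EC" "\<E> r1 e r2"
      using essential_class_letter[OF _ EC] unfolding accepted_from_def by blast
    obtain w1 where "nfa_path Q \<E> q w1 r1"
      by (rule essential_class_path[OF EC q r(1)])
    moreover obtain w2 where "nfa_path Q \<E> r2 w2 q"
      by (rule essential_class_path[OF EC r(2) q])
    ultimately show ?thesis
      using r(3) by blast
  qed
  from nfa_loops_with_letter[OF \<open>finite E\<close> L this] obtain h k0 where loops: "\<And>m e. m \<ge> k0 \<Longrightarrow> e \<in> E \<Longrightarrow>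
      \<exists>w. nfa_path Q \<E> q w q \<and> length w = m \<and> h < m \<and> w ! h = e"
    by blast
  have "q \<in> Q"
    using EC q essential_class_subset by blast
  then obtain w0 where w0: "nfa_path Q \<E> (Main (0, 1)) w0 q"
    using initial_path by blast
  \<comment> \<open>Room to reach \<open>q\<close>, to have a padding loop of the required length,
    and for the offset \<open>h\<close> inside a block.\<close>
  define m0 where "m0 = length w0 + L + h"
  have "\<exists>x\<in>K. \<forall>i. padic_digits x (j + (m0 + i) * m) = e i"
    if m: "m \<ge> max 1 k0" and e: "\<forall>i. e i \<in> E" for m e
  proof (rule compact_K_digits)
    fix M
    \<comment> \<open>The length before the first block, chosen so that offset \<open>h\<close> of
      block \<open>i\<close> falls on index j + (m0 + i) m.\<close>
    define T where "T = j + m0 * m - h"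
    have "m0 * 1 \<le> m0 * m"
      using m by (intro mult_le_mono2) simp
    then have "m0 \<le> m0 * m"
      by (simp only: mult_1_right)
    then have T: "T + h = j + m0 * m" "T - length w0 \<ge> L" "length w0 \<le> T"
      using m0_def unfolding T_def by linarith+
    obtain w1 where w1: "nfa_path Q \<E> q w1 q" "length w1 = T - length w0"
      using L[OF T(2)] by blast
    have "\<exists>w. nfa_path Q \<E> (Main (0, 1)) w q \<and> length w = T + M * m \<and> (\<forall>i<M. w ! (T + i * m + h) = e i)"
    proof (induction M)
      case 0
      show ?case
        using nfa_path_append[OF w0 w1(1)] w1(2) T(3) by (intro exI[of _ "w0 @ w1"]) simp
    next
      case (Suc M)
      then obtain w where w: "nfa_path Q \<E> (Main (0, 1)) w q" "length w = T + M * m"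
          "\<And>i. i < M \<Longrightarrow> w ! (T + i * m + h) = e i"
        by blast
      obtain w' where w': "nfa_path Q \<E> q w' q" "length w' = m" "h < m" "w' ! h = e M"
        using loops[of m "e M"] m e by auto
      have "(w @ w') ! (T + i * m + h) = e i" if "i < Suc M" for i
      proof (cases "i = M")
        case True
        then show ?thesis
          using w(2) w'(4) by (simp add: nth_append)
      next
        case False
        then have "i < M"
          using that by simp
        then have "Suc i * m \<le> M * m"
          by (intro mult_le_mono1) simp
        then have "T + i * m + h < length w"
          using w(2) w'(3) by simp
        then show ?thesis
          using w(3)[OF \<open>i < M\<close>] by (simp add: nth_append)
      qed
      then show ?case
        using nfa_path_append[OF w(1) w'(1)] w(2) w'(2) by (intro exI[of _ "w @ w'"]) simp
    qed
    then obtain w where w: "nfa_path Q \<E> (Main (0, 1)) w q" "length w = T + M * m"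
        "\<And>i. i < M \<Longrightarrow> w ! (T + i * m + h) = e i"
      by blast
    obtain x where x: "x \<in> K" "\<forall>i<length w. padic_digits x i = w ! i"
      using path_values[OF w(1)] unfolding node_values_initial by blast
    have h: "h < m"
      using loops[of m "e 0"] m e by auto
    have "padic_digits x (j + (m0 + i) * m) = e i" if "i < M" for i
    proof -
      have "Suc i * m \<le> M * m"
        using that by (intro mult_le_mono1) simp
      then have "T + i * m + h < length w"
        using w(2) h by simp
      moreover have "T + i * m + h = j + (m0 + i) * m"
        using T(1) by (simp add: algebra_simps)
      ultimately show ?thesis
        using x(2) w(3)[OF that] by metis
    qed
    then show "\<exists>x\<in>K. \<forall>i<M. padic_digits x (j + (m0 + i) * m) = e i"
      using x(1) by blast
  qed
  then show ?thesis
    by blast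
qed

section \<open>The digit set and the two bounds for decimations\<close>

lemma essential_digit_set:
  assumes EC: "essential_class Q \<E> EC" "r \<in> EC"
    and E: "E = (\<Union>r\<in>EC. \<Union>w\<in>accepted_from Q \<E> r. set w)"
  shows "finite E" "E \<noteq> {}"
proof -
  have "E \<subseteq> {..<CARD('p)}"
  proof
    fix a
    assume "a \<in> E"
    then obtain r w where "r \<in> EC" "w \<in> accepted_from Q \<E> r" "a \<in> set w"
      unfolding E by blast
    then show "a \<in> {..<CARD('p)}"
      using essential_class_letter[OF _ EC(1)] edge_states unfolding accepted_from_def by blast
  qed
  then show "finite E"
    by (rule finite_subset) simp
  show "E \<noteq> {}"
    using essential_values_digits[OF EC(1) E EC(2)] node_values_nonempty[of r] by blast
qed

lemma hausdorff_dim_decimation: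
  assumes EC: "essential_class Q \<E> EC" and q: "q \<in> EC"
    and E: "E = (\<Union>r\<in>EC. \<Union>w\<in>accepted_from Q \<E> r. set w)"
    and loops: "nfa_path Q \<E> q u q" "nfa_path Q \<E> q v q" "coprime (length u) (length v)"
  shows "\<forall>\<^sub>F m in sequentially.
    hausdorff_dim (decimation j m ` K) = ereal (ln (real (card E)) / ln (real CARD('p)))"
proof -
  note fin = essential_digit_set[OF EC q E]
  obtain m1 where free: "\<And>m. m \<ge> m1 \<Longrightarrow>
      \<exists>m0. \<forall>e. (\<forall>i. e i \<in> E) \<longrightarrow> (\<exists>x\<in>K. \<forall>i. padic_digits x (j + (m0 + i) * m) = e i)"
    using essential_free_digits[OF EC q E loops fin(1)] by blast
  have "hausdorff_dim (decimation j m ` K) = ereal (ln (card E) / ln CARD('p))" if m: "m \<ge> max 1 m1" for m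
  proof (rule antisym)
    have K_Zp: "x \<in> Zp" if "x \<in> K" for x
      using that K_subset_Zp by blast
    have Zp: "decimation j m ` K \<subseteq> Zp"
      using decimation_Zp_digits(1) K_Zp by blast
    show "hausdorff_dim (decimation j m ` K) \<le> ereal (ln (card E) / ln CARD('p))"
    proof (rule hausdorff_dim_le_eventual_digits[OF Zp fin])
      fix y
      assume "y \<in> decimation j m ` K"
      then obtain x where x: "x \<in> K" "y = decimation j m x"
        by blast
      have digits: "padic_digits y i = padic_digits x (j + i * m)" for i
        using decimation_Zp_digits(2)[OF K_Zp[OF x(1)]] x(2) by simp
      obtain M where M: "(\<forall>i\<ge>M. padic_digits x i \<in> E) \<or> (\<exists>a. \<forall>i\<ge>M. padic_digits x i = a)"
        using essential_digits_cases[OF EC q E x(1)] by blast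
      \<comment> \<open>As m >= 1, the i-th sampled index is at least i, so what holds for all late
        digits of \<open>x\<close> holds for all late digits of its decimation.\<close>
      have "M \<le> j + i * m" if "M \<le> i" for i
      proof -
        have "i * 1 \<le> i * m"
          using m by (intro mult_le_mono2) simp
        then have "i \<le> i * m"
          by (simp only: mult_1_right)
        then show ?thesis
          using that by linarith
      qed
      then show "\<exists>M. (\<forall>i\<ge>M. padic_digits y i \<in> E) \<or> (\<exists>a. \<forall>i\<ge>M. padic_digits y i = a)"
        using M digits by metis
    qed
    obtain m0 where m0: "\<And>e. \<forall>i. e i \<in> E \<Longrightarrow> \<exists>x\<in>K. \<forall>i. padic_digits x (j + (m0 + i) * m) = e i"
      using free[of m] m by auto
    show "ereal (ln (card E) / ln CARD('p)) \<le> hausdorff_dim (decimation j m ` K)"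
    proof (rule hausdorff_dim_ge_digits[OF Zp fin])
      fix e :: "nat \<Rightarrow> nat"
      assume "\<And>i. e i \<in> E"
      then obtain x where x: "x \<in> K" "\<forall>i. padic_digits x (j + (m0 + i) * m) = e i"
        using m0 by blast
      then have "\<forall>i. padic_digits (decimation j m x) (m0 + i) = e i"
        using decimation_Zp_digits(2)[OF K_Zp[OF x(1)]] by simp
      then show "\<exists>z\<in>decimation j m ` K. \<forall>i. padic_digits z (m0 + i) = e i"
        using x(1) by blast
    qed
  qed
  then show ?thesis
    using eventually_sequentially by blast
qed

end

theorem theorem6p1:
  fixes n :: nat and b k :: "nat \<Rightarrow> nat" and d :: "nat \<Rightarrow> 'p::prime_card padic"
    and K :: "'p padic set" and q :: "'p nstate" and EC :: "'p nstate set" and E :: "nat set"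
    and u v :: "nat list"
  defines "Q \<equiv> ndfa_states n b k d" and "\<E> \<equiv> ndfa_edge n b k d"
  assumes "\<And>i. i \<in> {1..n} \<Longrightarrow> b i \<in> {0, 1}"
    and "\<And>i. i \<in> {1..n} \<Longrightarrow> k i \<ge> 1"
    and "\<And>i. i \<in> {1..n} \<Longrightarrow> d i \<in> Zp \<inter> \<rat>"
    and "is_self_similar_set n b k d K"
    and "essential_class Q \<E> EC" and "q \<in> EC"
    and "nfa_path Q \<E> q u q" and "nfa_path Q \<E> q v q" and "coprime (length u) (length v)"
    and "E = (\<Union>r\<in>EC. \<Union>w\<in>accepted_from Q \<E> r. set w)"
  shows "\<forall>j. \<forall>\<^sub>F m in sequentially.
           hausdorff_dim (decimation j m ` K) = ereal (ln (real (card E)) / ln (real CARD('p)))"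
proof
  fix j
  interpret padic_ifs n b k d K
    by unfold_locales (use assms in auto)
  show "\<forall>\<^sub>F m in sequentially.
      hausdorff_dim (decimation j m ` K) = ereal (ln (real (card E)) / ln (real CARD('p)))"
    by (rule hausdorff_dim_decimation) (use assms in auto)
qed

end
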